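(* Let $(3,c,m)$ be an e-admissible triplet of integers with $3\le c\le m$. (i) If $c=3$, then $\alpha(3,3,m)=\beta(3,3,m)=3/4$. (ii) If $c\ge4$ and $m=c+1$, then $\alpha(3,c,c+1)=\beta(3,c,c+1)=c/4$. (iii) If $c\ge4$ and $m=c+u$ with $2\le u<\lfloor (c-2)/2\rfloor$, then $1\le\alpha(3,c,c+u)\le \frac54+\frac14\left\lceil\frac{c-2}{u}\right\rceil$. (iv) If $c\ge 4$ and $c+\lfloor (c-2)/2\rfloor\le m<\binom{c}{2}$, then $1\le\alpha(3,c,m)\le 3/2$. (v) If $c\ge4$ and $m\ge\binom{c}{2}$, then $\alpha(3,c,m)=1$.
   Context: All graphs are finite, simple and connected. A graph $G$ is regarded as a geodesic metric space by identifying each edge isometrically with $[0,1]$; points are vertices and interior points of edges, $d$ is the shortest-path length. A geodesic triangle $T=\{x,y,z\}$ is a union of three geodesics $[xy],[yz],[zx]$; $\delta(T)$ is the infimum of $\delta\ge0$ such that each side lies in the $\delta$-neighbourhood of the union of the other two; $\delta(G)=\sup_T\delta(T)$ over geodesic triangles. Girth $g(G)$ / circumference $c(G)$: length of a shortest / longest cycle. $\mathcal{H}(g,c,m)$ is the set of graphs with girth $g$, circumference $c$ and $m$ edges, $\alpha(g,c,m)=\min\{\delta(G):G\in\mathcal{H}(g,c,m)\}$ and $\beta(g,c,m)=\max\{\delta(G):G\in\mathcal{H}(g,c,m)\}$. A triplet $(g,c,m)$ is e-admissible if $\mathcal{H}(g,c,m)\ne\emptyset$. *)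

theory Defs
  imports Complex_Main
begin

definition simple_graph :: "'a set \<Rightarrow> 'a set set \<Rightarrow> bool" where
  "simple_graph V E \<longleftrightarrow> finite V \<and> (\<forall>e\<in>E. e \<subseteq> V \<and> card e = 2)"

definition connected_graph :: "'a set \<Rightarrow> 'a set set \<Rightarrow> bool" where
  "connected_graph V E \<longleftrightarrow> V \<noteq> {} \<and> (\<forall>u\<in>V. \<forall>v\<in>V. (u, v) \<in> {(a, b). {a, b} \<in> E}\<^sup>*)"

definition is_cycle :: "'a set set \<Rightarrow> 'a list \<Rightarrow> bool" where
  "is_cycle E cs \<longleftrightarrow> 3 \<le> length cs \<and> distinct cs \<and>
     successively (\<lambda>a b. {a, b} \<in> E) cs \<and> {last cs, hd cs} \<in> E"

text \<open>Since \<open>Inf {} = Sup {} = 0\<close> on \<^typ>\<open>nat\<close>, both parameters below are 0 for a forest;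
  as every cycle has length at least 3, the value 3 is never due to this convention.\<close>

definition girth :: "'a set set \<Rightarrow> nat" where
  "girth E = Inf {length cs | cs. is_cycle E cs}"

definition circumference :: "'a set set \<Rightarrow> nat" where
  "circumference E = Sup {length cs | cs. is_cycle E cs}"

text \<open>The graph as a metric space is its geometric realisation in barycentric coordinates:
  the vertex \<open>v\<close> is the point with \<open>p v = 1\<close>, and the interior points of the edge \<open>{u, v}\<close> are
  the \<open>p\<close> with \<open>p u, p v > 0\<close>, \<open>p u + p v = 1\<close> and all other coordinates 0.\<close>

definition graph_points :: "'a set \<Rightarrow> 'a set set \<Rightarrow> ('a \<Rightarrow> real) set" where
  "graph_points V E = {p. (\<forall>w. 0 \<le> p w) \<and> (\<Sum>w\<in>V. p w) = 1 \<and>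
     {w. p w \<noteq> 0} \<in> E \<union> {{v} | v. v \<in> V}}"

definition on_common_edge :: "'a set set \<Rightarrow> ('a \<Rightarrow> real) \<Rightarrow> ('a \<Rightarrow> real) \<Rightarrow> bool" where
  "on_common_edge E p q \<longleftrightarrow> (\<exists>e\<in>E. {w. p w \<noteq> 0} \<subseteq> e \<and> {w. q w \<noteq> 0} \<subseteq> e)"

text \<open>For two points of the edge \<open>{u, v}\<close> this equals \<open>\<bar>p u - q u\<bar> = \<bar>p v - q v\<bar>\<close>, so the edge is
  isometric to the unit interval.\<close>

definition seg_length :: "'a set \<Rightarrow> ('a \<Rightarrow> real) \<Rightarrow> ('a \<Rightarrow> real) \<Rightarrow> real" where
  "seg_length V p q = (\<Sum>w\<in>V. \<bar>p w - q w\<bar>) / 2"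

text \<open>A path is given by its successive break points, each contiguous pair of which is joined
  by a segment inside one edge.\<close>

definition path_between ::
  "'a set \<Rightarrow> 'a set set \<Rightarrow> ('a \<Rightarrow> real) \<Rightarrow> ('a \<Rightarrow> real) \<Rightarrow> ('a \<Rightarrow> real) list \<Rightarrow> bool" where
  "path_between V E p q ps \<longleftrightarrow> ps \<noteq> [] \<and> set ps \<subseteq> graph_points V E \<and> hd ps = p \<and> last ps = q \<and>
     successively (on_common_edge E) ps"

definition path_length :: "'a set \<Rightarrow> ('a \<Rightarrow> real) list \<Rightarrow> real" where
  "path_length V ps = (\<Sum>i<length ps - 1. seg_length V (ps ! i) (ps ! Suc i))"

definition graph_dist :: "'a set \<Rightarrow> 'a set set \<Rightarrow> ('a \<Rightarrow> real) \<Rightarrow> ('a \<Rightarrow> real) \<Rightarrow> real" where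
  "graph_dist V E p q = Inf {path_length V ps | ps. path_between V E p q ps}"

definition is_geodesic ::
  "'a set \<Rightarrow> 'a set set \<Rightarrow> ('a \<Rightarrow> real) \<Rightarrow> ('a \<Rightarrow> real) \<Rightarrow> ('a \<Rightarrow> real) set \<Rightarrow> bool" where
  "is_geodesic V E x y S \<longleftrightarrow> (\<exists>\<gamma> :: real \<Rightarrow> 'a \<Rightarrow> real.
     let L = graph_dist V E x y in
       \<gamma> 0 = x \<and> \<gamma> L = y \<and> \<gamma> ` {0..L} \<subseteq> graph_points V E \<and>
       (\<forall>s\<in>{0..L}. \<forall>t\<in>{0..L}. graph_dist V E (\<gamma> s) (\<gamma> t) = \<bar>s - t\<bar>) \<and>
       S = \<gamma> ` {0..L})"

text \<open>The vertices of a triangle need not be vertices of the graph, nor distinct.\<close>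

definition geodesic_triangle ::
  "'a set \<Rightarrow> 'a set set \<Rightarrow> ('a \<Rightarrow> real) set \<Rightarrow> ('a \<Rightarrow> real) set \<Rightarrow> ('a \<Rightarrow> real) set \<Rightarrow> bool" where
  "geodesic_triangle V E A B C \<longleftrightarrow>
     (\<exists>x\<in>graph_points V E. \<exists>y\<in>graph_points V E. \<exists>z\<in>graph_points V E.
        is_geodesic V E x y A \<and> is_geodesic V E y z B \<and> is_geodesic V E z x C)"

definition neighbourhood ::
  "'a set \<Rightarrow> 'a set set \<Rightarrow> real \<Rightarrow> ('a \<Rightarrow> real) set \<Rightarrow> ('a \<Rightarrow> real) set" where
  "neighbourhood V E r S = {p \<in> graph_points V E. \<exists>q\<in>S. graph_dist V E p q \<le> r}"

definition triangle_delta ::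
  "'a set \<Rightarrow> 'a set set \<Rightarrow> ('a \<Rightarrow> real) set \<Rightarrow> ('a \<Rightarrow> real) set \<Rightarrow> ('a \<Rightarrow> real) set \<Rightarrow> real" where
  "triangle_delta V E A B C = Inf {r. 0 \<le> r \<and>
     A \<subseteq> neighbourhood V E r (B \<union> C) \<and>
     B \<subseteq> neighbourhood V E r (C \<union> A) \<and>
     C \<subseteq> neighbourhood V E r (A \<union> B)}"

definition hyperbolicity :: "'a set \<Rightarrow> 'a set set \<Rightarrow> real" where
  "hyperbolicity V E = Sup {triangle_delta V E A B C | A B C. geodesic_triangle V E A B C}"

text \<open>Every finite graph is isomorphic to one whose vertices are natural numbers, so these
  represent all graphs. \<open>LEAST\<close> and \<open>GREATEST\<close> are the minimum and maximum of the set of values.\<close>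

definition graph_class :: "nat \<Rightarrow> nat \<Rightarrow> nat \<Rightarrow> (nat set \<times> nat set set) set" where
  "graph_class g c m = {(V, E). simple_graph V E \<and> connected_graph V E \<and>
     girth E = g \<and> circumference E = c \<and> card E = m}"

definition e_admissible :: "nat \<Rightarrow> nat \<Rightarrow> nat \<Rightarrow> bool" where
  "e_admissible g c m \<longleftrightarrow> graph_class g c m \<noteq> {}"

definition alpha :: "nat \<Rightarrow> nat \<Rightarrow> nat \<Rightarrow> real" where
  "alpha g c m = (LEAST r. \<exists>(V, E)\<in>graph_class g c m. r = hyperbolicity V E)"

definition beta :: "nat \<Rightarrow> nat \<Rightarrow> nat \<Rightarrow> real" where
  "beta g c m = (GREATEST r. \<exists>(V, E)\<in>graph_class g c m. r = hyperbolicity V E)"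

end

theory Submission
  imports Defs
begin

text \<open>Everything rests on a bottleneck criterion: if a path between the ends of a geodesic always
  meets the closed \<open>D\<close>-ball about each point of that geodesic, then the hyperbolicity constant is at
  most \<open>D\<close>, because the other two sides of a triangle form such a path. Conversely, a bigon with a point of
  one side at distance \<open>D\<close> from the other side shows that the constant is at least \<open>D\<close>.

  A path avoiding the \<open>D\<close>-ball closes a geodesic up to a cycle of length more than \<open>4 * D\<close>,
  whence the bound by a quarter of the circumference. It is sharp for a triangle, and
  for a cycle with one chord cutting off a triangle. If the constant is less than 1, then in the breadth-first
  layers around any vertex parents are unique and adjacent vertices of a layer share their parent, so
  that every cycle through the vertex is a triangle.

  The upper bounds for \<open>\<alpha>\<close> come from ladders with \<open>u\<close> chords, one of them cutting off a triangle,
  from graphs with a dominating vertex, and from complete graphs with pendant edges. The minimum exists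
  because the constant is invariant under relabelling, so that it takes finitely many values on a class.\<close>

section \<open>The metric of the geometric realisation\<close>

text \<open>As given, neither notion is combinatorial: a distance is an infimum over all lists of
  break points, and a side of a triangle is the image of a real interval. Both gaps close because a
  list can pass from one edge to another only in a common vertex. Hence only finitely many lengths
  compete for a distance and the infimum is attained, and a side can be replaced by a list of break
  points arbitrarily close to it, so that the criterion may speak of break points alone.

  The quarter arises as follows: a point more than \<open>D\<close> away from both ends of a
  geodesic lies inside an arc longer than \<open>2 * D\<close>, and the arc closing the cycle has
  the same ends, so it cannot be shorter.

  In a ladder with rungs at most \<open>2 * h\<close> apart, a piece of rail between neighbouring
  rungs has length at most \<open>h\<close>. A point on it is within \<open>h / 2\<close> of the end
  of some rung, hence within \<open>1 + h / 2\<close> of that whole rung, which separates the graph.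
  With \<open>h\<close> equal to half of \<open>k = \<lceil>(c - 2) / u\<rceil>\<close>, rounded up,
  this is at most \<open>5 / 4 + k / 4\<close>.\<close>

definition vp :: "'a \<Rightarrow> 'a \<Rightarrow> real" where
  "vp v = (\<lambda>w. if w = v then 1 else 0)"

abbreviation supp :: "('a \<Rightarrow> real) \<Rightarrow> 'a set" where
  "supp p \<equiv> {w. p w \<noteq> 0}"

lemma vp_simps [simp]: "vp v v = 1" "w \<noteq> v \<Longrightarrow> vp v w = 0"
  by (auto simp: vp_def)

lemma supp_vp [simp]: "supp (vp v) = {v}"
  by (auto simp: vp_def)

lemma vp_inject [simp]: "vp u = vp v \<longleftrightarrow> u = v"
  by (metis vp_simps zero_neq_one)

lemma on_common_edge_sym: "on_common_edge E p q \<longleftrightarrow> on_common_edge E q p"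
  by (auto simp: on_common_edge_def)

lemma seg_length_sym: "seg_length V p q = seg_length V q p"
  by (simp add: seg_length_def abs_minus_commute)

lemma seg_length_self [simp]: "seg_length V p p = 0"
  by (simp add: seg_length_def)

lemma seg_length_nonneg [simp]: "0 \<le> seg_length V p q"
  by (simp add: seg_length_def sum_nonneg)

lemma seg_length_triangle: "seg_length V p r \<le> seg_length V p q + seg_length V q r"
proof -
  have "(\<Sum>w\<in>V. \<bar>p w - r w\<bar>) \<le> (\<Sum>w\<in>V. \<bar>p w - q w\<bar> + \<bar>q w - r w\<bar>)"
    by (intro sum_mono) auto
  then show ?thesis by (simp add: seg_length_def sum.distrib)
qed

lemma path_length_simps [simp]:
  "path_length V [] = 0" "path_length V [p] = 0"
  "path_length V (p # q # ps) = seg_length V p q + path_length V (q # ps)"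
  by (simp_all add: path_length_def sum.lessThan_Suc_shift del: sum.lessThan_Suc)

lemma path_length_nonneg [simp]: "0 \<le> path_length V ps"
  by (simp add: path_length_def sum_nonneg)

lemma path_length_append:
  "path_length V (ps @ r # qs) = path_length V (ps @ [r]) + path_length V (r # qs)"
proof (induction ps)
  case (Cons p ps)
  then show ?case by (cases ps) auto
qed auto

lemma path_length_rev: "path_length V (rev ps) = path_length V ps"
proof (induction ps rule: induct_list012)
  case (3 p q ps)
  have "path_length V (rev (p # q # ps)) = path_length V (rev ps @ q # [p])" by simp
  also have "\<dots> = path_length V (rev (q # ps)) + seg_length V q p"
    by (subst path_length_append) simp
  finally show ?case using 3 by (simp add: seg_length_sym)
qed auto

lemma path_between_rev:
  assumes "path_between V E p q ps" shows "path_between V E q p (rev ps)"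
proof -
  have "successively (on_common_edge E) (rev ps)"
    using assms unfolding path_between_def successively_rev
    by (subst on_common_edge_sym) auto
  then show ?thesis using assms by (auto simp: path_between_def hd_rev last_rev)
qed

lemma path_between_append:
  assumes "path_between V E p q (ps @ [q])" "path_between V E q r (q # qs)"
  shows "path_between V E p r (ps @ q # qs)"
  using assms by (auto simp: path_between_def successively_append_iff hd_append split: if_splits)

lemma path_between_snoc:
  assumes "path_between V E p q ps" obtains qs where "ps = qs @ [q]"
  using assms by (metis append_butlast_last_id path_between_def)

lemma path_between_hd:
  assumes "path_between V E p q ps" obtains qs where "ps = p # qs"
  using assms by (metis list.collapse path_between_def)

definition adjrel :: "'a set set \<Rightarrow> ('a \<times> 'a) set" where
  "adjrel E = {(a, b). {a, b} \<in> E}"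

definition vdist :: "'a set set \<Rightarrow> 'a \<Rightarrow> 'a \<Rightarrow> nat" where
  "vdist E a b = (LEAST n. (a, b) \<in> adjrel E ^^ n)"

lemma adjrel_iff [simp]: "(a, b) \<in> adjrel E \<longleftrightarrow> {a, b} \<in> E"
  by (simp add: adjrel_def)

lemma adjrel_relpow_sym: "(a, b) \<in> adjrel E ^^ n \<longleftrightarrow> (b, a) \<in> adjrel E ^^ n"
proof -
  have "(a, b) \<in> adjrel E ^^ n \<Longrightarrow> (b, a) \<in> adjrel E ^^ n" for a b
  proof (induction n arbitrary: a b)
    case (Suc n)
    then obtain c where "(a, c) \<in> adjrel E ^^ n" "{c, b} \<in> E" by auto
    then have "(c, a) \<in> adjrel E ^^ n" "(b, c) \<in> adjrel E"
      using Suc.IH by (auto simp: insert_commute)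
    then show ?case by (metis relpow_Suc_I2)
  qed auto
  then show ?thesis by blast
qed

text \<open>Excluding the edgeless graph puts every vertex, and hence every point, on an edge;
  otherwise \<open>on_common_edge\<close> would not be reflexive on points.\<close>

locale fgraph =
  fixes V :: "'a set" and E :: "'a set set"
  assumes simple: "simple_graph V E" and conn: "connected_graph V E" and ne: "E \<noteq> {}"
begin

abbreviation P :: "('a \<Rightarrow> real) set" where "P \<equiv> graph_points V E"
abbreviation d :: "('a \<Rightarrow> real) \<Rightarrow> ('a \<Rightarrow> real) \<Rightarrow> real" where "d \<equiv> graph_dist V E"
abbreviation sg :: "('a \<Rightarrow> real) \<Rightarrow> ('a \<Rightarrow> real) \<Rightarrow> real" where "sg \<equiv> seg_length V"
abbreviation ce :: "('a \<Rightarrow> real) \<Rightarrow> ('a \<Rightarrow> real) \<Rightarrow> bool" where "ce \<equiv> on_common_edge E"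
abbreviation dv :: "'a \<Rightarrow> 'a \<Rightarrow> nat" where "dv \<equiv> vdist E"

section \<open>Points, edges and segments of the realisation\<close>

lemma finV [simp]: "finite V"
  using simple by (simp add: simple_graph_def)

lemma edge_subset: "e \<in> E \<Longrightarrow> e \<subseteq> V"
  using simple by (simp add: simple_graph_def)

lemma edgeE:
  assumes "e \<in> E" obtains a b where "a \<noteq> b" "e = {a, b}" "a \<in> V" "b \<in> V"
proof -
  have "card e = 2" using assms simple by (simp add: simple_graph_def)
  then obtain a b where "e = {a, b}" "a \<noteq> b" by (auto simp: card_2_iff)
  then show ?thesis using that edge_subset[OF assms] by auto
qed

lemma edgeD:
  assumes "{a, b} \<in> E" shows "a \<noteq> b" "a \<in> V" "b \<in> V"
  using assms edge_subset[OF assms] simple by (auto simp: simple_graph_def)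

lemma edge_eqI: "e \<in> E \<Longrightarrow> f \<in> E \<Longrightarrow> e \<subseteq> f \<Longrightarrow> e = f"
  using simple by (metis card_subset_eq finite_subset finV simple_graph_def)

lemma vertex_in_edge:
  assumes "v \<in> V" obtains e where "e \<in> E" "v \<in> e"
proof -
  obtain e0 where "e0 \<in> E" using ne by blast
  then obtain a b where ab: "a \<noteq> b" "e0 = {a, b}" "a \<in> V" "b \<in> V" by (rule edgeE)
  obtain w where w: "w \<in> V" "w \<noteq> v" using ab by metis
  have "(v, w) \<in> {(a, b). {a, b} \<in> E}\<^sup>*" using conn assms w by (auto simp: connected_graph_def)
  then obtain u where "{v, u} \<in> E" using w by (auto elim: converse_rtranclE)
  then show ?thesis using that by blast
qed

lemma point_nonneg: "p \<in> P \<Longrightarrow> 0 \<le> p w"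
  and point_sum: "p \<in> P \<Longrightarrow> (\<Sum>w\<in>V. p w) = 1"
  and point_supp: "p \<in> P \<Longrightarrow> supp p \<in> E \<union> {{v} | v. v \<in> V}"
  by (auto simp: graph_points_def)

lemma point_supp_subset: "p \<in> P \<Longrightarrow> supp p \<subseteq> V"
proof -
  assume "p \<in> P"
  then consider "supp p \<in> E" | v where "v \<in> V" "supp p = {v}" using point_supp[of p] by auto
  then show ?thesis using edge_subset by cases simp_all
qed

lemma point_edge:
  assumes "p \<in> P" obtains e where "e \<in> E" "supp p \<subseteq> e"
proof -
  consider "supp p \<in> E" | v where "v \<in> V" "supp p = {v}" using point_supp[OF assms] by auto
  then show ?thesis
  proof cases
    case 2
    obtain e where "e \<in> E" "v \<in> e" using vertex_in_edge 2 by blast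
    then show ?thesis using that 2 by simp
  qed (use that in blast)
qed

lemma sum_two:
  fixes f :: "'a \<Rightarrow> real"
  assumes "a \<noteq> b" "a \<in> V" "b \<in> V" "\<And>w. w \<noteq> a \<Longrightarrow> w \<noteq> b \<Longrightarrow> f w = 0"
  shows "sum f V = f a + f b"
proof -
  have "sum f V = sum f {a, b}"
    by (rule sum.mono_neutral_right) (use assms in auto)
  then show ?thesis using assms by simp
qed

lemma point_sum_edge:
  assumes "p \<in> P" "{a, b} \<in> E" "supp p \<subseteq> {a, b}" shows "p a + p b = 1"
  using sum_two[of a b p] assms point_sum[of p] edgeD[of a b] by auto

lemma point_le_1: "p \<in> P \<Longrightarrow> p w \<le> 1"
proof -
  assume p: "p \<in> P"
  show ?thesis
  proof (cases "w \<in> V")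
    case True
    have "p w \<le> (\<Sum>w\<in>V. p w)" by (rule member_le_sum) (use p point_nonneg True in auto)
    then show ?thesis using point_sum[OF p] by simp
  next
    case False
    then have "p w = 0" using point_supp_subset[OF p] by auto
    then show ?thesis by simp
  qed
qed

lemma vp_point [simp]: "v \<in> V \<Longrightarrow> vp v \<in> P"
  by (auto simp: graph_points_def) (auto simp: vp_def)

lemma edge_pointI:
  assumes "{a, b} \<in> E" "\<And>w. 0 \<le> p w" "supp p \<subseteq> {a, b}" "p a + p b = 1"
  shows "p \<in> P"
proof -
  note ab = edgeD[OF assms(1)]
  have "(\<Sum>w\<in>V. p w) = 1" using sum_two[of a b p] assms ab by auto
  moreover have "supp p = {a, b} \<or> supp p = {a} \<or> supp p = {b} \<or> supp p = {}"
    using assms(3) by blast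
  then have "supp p \<in> E \<union> {{v} | v. v \<in> V}"
    using assms ab by (elim disjE) auto
  ultimately show ?thesis using assms by (simp add: graph_points_def)
qed

lemma point_eqI:
  assumes "p \<in> P" "q \<in> P" "{a, b} \<in> E" "supp p \<subseteq> {a, b}" "supp q \<subseteq> {a, b}" "p a = q a"
  shows "p = q"
proof
  fix w
  have "p b = q b" using point_sum_edge[of p a b] point_sum_edge[of q a b] assms by auto
  moreover have "w \<noteq> a \<Longrightarrow> w \<noteq> b \<Longrightarrow> p w = 0 \<and> q w = 0" using assms by auto
  ultimately show "p w = q w" using assms by (cases "w = a"; cases "w = b") auto
qed

lemma point_vertexI:
  assumes "p \<in> P" "p v = 1" shows "p = vp v"
proof -
  obtain e where e: "e \<in> E" "supp p \<subseteq> e" using point_edge assms(1) by blast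
  then have "v \<in> e" using assms by auto
  then obtain b where b: "e = {v, b}" using edgeE[OF e(1)] by (metis insert_commute insertE singletonD)
  have "v \<in> V" using b e edgeD by auto
  then show ?thesis using point_eqI[of p "vp v" v b] assms e b by auto
qed

lemma point_supp_single: "p \<in> P \<Longrightarrow> supp p \<subseteq> {v} \<Longrightarrow> p = vp v"
proof -
  assume p: "p \<in> P" "supp p \<subseteq> {v}"
  have "supp p \<notin> E"
  proof
    assume "supp p \<in> E"
    then obtain a b where "a \<noteq> b" "supp p = {a, b}" by (rule edgeE)
    then show False using p by auto
  qed
  then have "v \<in> V" using point_supp[OF p(1)] p by auto
  have "(\<Sum>w\<in>V. p w) = (\<Sum>w\<in>{v}. p w)"
    by (rule sum.mono_neutral_right) (use p \<open>v \<in> V\<close> in auto)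
  then show ?thesis using point_sum p point_vertexI by auto
qed

text \<open>Distinct edges share at most one vertex, so an interior point determines its edge. Every
  change of edge along a path is handled by this.\<close>

lemma two_edges:
  assumes "p \<in> P" "e \<in> E" "f \<in> E" "supp p \<subseteq> e" "supp p \<subseteq> f" "e \<noteq> f"
  obtains v where "v \<in> e" "v \<in> f" "p = vp v"
proof -
  have "supp p \<notin> E" using assms edge_eqI by metis
  then obtain v where "supp p = {v}" using point_supp[OF assms(1)] by auto
  then show ?thesis using that assms point_supp_single[of p v] by auto
qed

lemma sg_edge:
  assumes "p \<in> P" "q \<in> P" "{a, b} \<in> E" "supp p \<subseteq> {a, b}" "supp q \<subseteq> {a, b}"
  shows "sg p q = \<bar>p a - q a\<bar>"
proof -
  have "(\<Sum>w\<in>V. \<bar>p w - q w\<bar>) = \<bar>p a - q a\<bar> + \<bar>p b - q b\<bar>"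
  proof (rule sum_two)
    fix w assume "w \<noteq> a" "w \<noteq> b"
    then have "w \<notin> supp p" "w \<notin> supp q" using assms by blast+
    then show "\<bar>p w - q w\<bar> = 0" by simp
  qed (use edgeD[OF assms(3)] in auto)
  moreover have "p b - q b = q a - p a"
    using point_sum_edge[of p a b] point_sum_edge[of q a b] assms by auto
  ultimately show ?thesis by (simp add: seg_length_def)
qed

lemma sg_vertex:
  assumes "p \<in> P" "v \<in> V" shows "sg p (vp v) = 1 - p v"
proof -
  have "(\<Sum>w\<in>V. \<bar>p w - vp v w\<bar>) = \<bar>p v - 1\<bar> + (\<Sum>w\<in>V-{v}. p w)"
    by (subst sum.remove[of V v]) (use assms point_nonneg in \<open>auto intro!: sum.cong\<close>)
  also have "(\<Sum>w\<in>V-{v}. p w) = 1 - p v"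
    using point_sum[OF assms(1)] sum.remove[of V v p] assms by auto
  finally show ?thesis using point_le_1[OF assms(1), of v] by (simp add: seg_length_def)
qed

text \<open>By \<open>sg_vertex\<close> the coordinate at \<open>v\<close> is 1 minus the segment
  length to \<open>vp v\<close>, so this is the triangle inequality through
  \<open>vp v\<close>.\<close>

lemma sg_coord:
  assumes "p \<in> P" "q \<in> P" shows "\<bar>p v - q v\<bar> \<le> sg p q"
proof (cases "v \<in> V")
  case True
  have "\<bar>(1 - p v) - (1 - q v)\<bar> \<le> sg p q"
    using sg_vertex[of p v] sg_vertex[of q v] True assms seg_length_triangle[of V p "vp v" q]
      seg_length_triangle[of V q "vp v" p] seg_length_sym[of V p q] by linarith
  then show ?thesis by linarith
next
  case False
  then have "p v = 0" "q v = 0" using assms point_supp_subset by blast+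
  then show ?thesis by simp
qed

lemma ce_edge: "ce p q \<longleftrightarrow> (\<exists>e\<in>E. supp p \<subseteq> e \<and> supp q \<subseteq> e)"
  by (simp add: on_common_edge_def)

lemma ce_refl [simp]: "p \<in> P \<Longrightarrow> ce p p"
  by (metis point_edge ce_edge)

lemma ce_sym: "ce p q \<Longrightarrow> ce q p"
  using on_common_edge_sym by blast

lemma ce_vertex: "ce p (vp v) \<longleftrightarrow> (\<exists>e\<in>E. supp p \<subseteq> e \<and> v \<in> e)"
  by (auto simp: ce_edge)

lemma sg_le_1: "p \<in> P \<Longrightarrow> q \<in> P \<Longrightarrow> ce p q \<Longrightarrow> sg p q \<le> 1"
proof -
  assume a: "p \<in> P" "q \<in> P" "ce p q"
  then obtain e where e: "e \<in> E" "supp p \<subseteq> e" "supp q \<subseteq> e" by (auto simp: ce_edge)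
  then obtain u v where "e = {u, v}" using edgeE by metis
  then have "sg p q = \<bar>p u - q u\<bar>" using sg_edge a e by auto
  then show ?thesis using a point_nonneg[of p u] point_nonneg[of q u] point_le_1[of p u] point_le_1[of q u]
    by linarith
qed

text \<open>The triangle inequality for \<open>seg_length\<close> holds for arbitrary points, not
  only on one edge, so \<open>seg_length\<close> is a lower bound for the path metric.\<close>

lemma path_length_ge_sg:
  assumes "path_between V E p q ps" shows "sg p q \<le> path_length V ps"
  using assms
proof (induction ps arbitrary: p rule: induct_list012)
  case (3 a b ps)
  then have "path_between V E b q (b # ps)" "p = a" by (auto simp: path_between_def)
  then show ?case using 3 seg_length_triangle[of V p q b] by fastforce
qed (auto simp: path_between_def)

lemma bdd_paths: "bdd_below {path_length V ps | ps. path_between V E p q ps}"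
  by (rule bdd_belowI[of _ 0]) auto

lemma d_le_path: "path_between V E p q ps \<Longrightarrow> d p q \<le> path_length V ps"
  unfolding graph_dist_def by (rule cInf_lower[OF _ bdd_paths]) blast

section \<open>Vertex distances and shortest routes\<close>

lemma rtrancl_adj: "u \<in> V \<Longrightarrow> v \<in> V \<Longrightarrow> (u, v) \<in> (adjrel E)\<^sup>*"
  using conn by (simp add: connected_graph_def adjrel_def)

lemma dv_relpow:
  assumes "u \<in> V" "v \<in> V" shows "(u, v) \<in> adjrel E ^^ dv u v"
proof -
  obtain n where "(u, v) \<in> adjrel E ^^ n" using rtrancl_adj[OF assms] rtrancl_imp_relpow by blast
  then show ?thesis unfolding vdist_def by (rule LeastI)
qed

lemma dv_le: "(u, v) \<in> adjrel E ^^ n \<Longrightarrow> dv u v \<le> n"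
  unfolding vdist_def by (rule Least_le)

lemma dv_self [simp]: "dv u u = 0"
  using dv_le[of u u 0] by simp

lemma dv_0: "u \<in> V \<Longrightarrow> v \<in> V \<Longrightarrow> dv u v = 0 \<longleftrightarrow> u = v"
  using dv_relpow[of u v] by auto

lemma dv_sym: "dv u v = dv v u"
  unfolding vdist_def using adjrel_relpow_sym by metis

lemma dv_triangle: "u \<in> V \<Longrightarrow> v \<in> V \<Longrightarrow> w \<in> V \<Longrightarrow> dv u w \<le> dv u v + dv v w"
  by (rule dv_le) (use dv_relpow in \<open>auto simp: relpow_add\<close>)

lemma dv_edge: "{u, v} \<in> E \<Longrightarrow> dv u v = 1"
proof -
  assume e: "{u, v} \<in> E"
  then have "dv u v \<le> 1" using dv_le[of u v 1] by simp
  moreover have "dv u v \<noteq> 0" using dv_0 edgeD[OF e] by auto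
  ultimately show ?thesis by simp
qed

lemma dv_pred:
  assumes "u \<in> V" "v \<in> V" "dv u v = Suc n"
  obtains w where "w \<in> V" "{w, v} \<in> E" "dv u w = n"
proof -
  have "(u, v) \<in> adjrel E ^^ Suc n" using dv_relpow assms by metis
  then obtain w where w: "(u, w) \<in> adjrel E ^^ n" "{w, v} \<in> E" by auto
  then have "w \<in> V" using edgeD by blast
  moreover have "dv u w \<le> n" using dv_le w by blast
  moreover have "Suc n \<le> dv u w + 1"
    using dv_triangle[of u w v] dv_edge[of w v] assms w calculation by simp
  ultimately show ?thesis using that w by simp
qed

lemma vertex_path:
  assumes "(u, v) \<in> adjrel E ^^ n" "u \<in> V"
  obtains ps where "path_between V E (vp u) (vp v) ps" "path_length V ps = n"
  using assms
proof (induction n arbitrary: v thesis)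
  case 0
  then have "path_between V E (vp u) (vp v) [vp v]" by (auto simp: path_between_def)
  then show ?case using 0 by fastforce
next
  case (Suc n)
  then obtain w where w: "(u, w) \<in> adjrel E ^^ n" "{w, v} \<in> E" by auto
  obtain ps where ps: "path_between V E (vp u) (vp w) ps" "path_length V ps = n"
    using Suc.IH w Suc.prems by blast
  obtain qs where qs: "ps = qs @ [vp w]" using path_between_snoc ps by blast
  note wv = edgeD[OF w(2)]
  have "path_between V E (vp w) (vp v) [vp w, vp v]"
    using wv w by (auto simp: path_between_def ce_edge)
  then have "path_between V E (vp u) (vp v) (qs @ vp w # [vp v])"
    using path_between_append ps qs by blast
  moreover have "path_length V (qs @ vp w # [vp v]) = Suc n"
    using ps qs path_length_append[of V qs "vp w" "[vp v]"] sg_vertex[of "vp w" v] wv by simp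
  ultimately show ?case using Suc.prems by blast
qed

text \<open>The competing lengths: the segment in a common edge, or an exit vertex \<open>a\<close>,
  a shortest vertex route and an entry vertex \<open>b\<close>. There are finitely many of them,
  which turns the infimum in \<open>graph_dist\<close> into a minimum.\<close>

definition reach :: "('a \<Rightarrow> real) \<Rightarrow> ('a \<Rightarrow> real) \<Rightarrow> real \<Rightarrow> bool" where
  "reach p q r \<longleftrightarrow> ce p q \<and> r = sg p q \<or>
     (\<exists>a\<in>V. \<exists>b\<in>V. ce p (vp a) \<and> ce q (vp b) \<and> r = sg p (vp a) + dv a b + sg (vp b) q)"

lemma reach_path:
  assumes "reach p q r" "p \<in> P" "q \<in> P"
  obtains ps where "path_between V E p q ps" "path_length V ps = r"
proof -
  consider "ce p q" "r = sg p q"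
    | a b where "a \<in> V" "b \<in> V" "ce p (vp a)" "ce q (vp b)" "r = sg p (vp a) + dv a b + sg (vp b) q"
    using assms unfolding reach_def by blast
  then show ?thesis
  proof cases
    case 1
    then have "path_between V E p q [p, q]" using assms by (auto simp: path_between_def)
    then show ?thesis using that[of "[p, q]"] 1 by simp
  next
    case 2
    obtain ps where ps: "path_between V E (vp a) (vp b) ps" "path_length V ps = dv a b"
      using vertex_path[OF dv_relpow] 2 by metis
    obtain qs where qs: "ps = vp a # qs" using path_between_hd ps by blast
    have "path_between V E p (vp a) ([p] @ [vp a])" using 2 assms by (auto simp: path_between_def)
    then have 3: "path_between V E p (vp b) ([p] @ vp a # qs)" using path_between_append ps qs by blast
    obtain rs where rs: "[p] @ vp a # qs = rs @ [vp b]" using path_between_snoc 3 by blast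
    have "path_between V E (vp b) q [vp b, q]"
      using 2 assms ce_sym by (auto simp: path_between_def)
    then have "path_between V E p q (rs @ vp b # [q])" using path_between_append 3 rs by metis
    moreover have "path_length V (rs @ vp b # [q]) = r"
      using path_length_append[of V rs "vp b" "[q]"] rs[symmetric] qs ps 2 by simp
    ultimately show ?thesis using that by blast
  qed
qed

text \<open>Inductive step for comparing an arbitrary path with the candidates: a candidate extended
  by one segment can be traded for another candidate that is no longer.\<close>

lemma reach_step:
  assumes "reach p q r" "ce q q'" "p \<in> P" "q \<in> P" "q' \<in> P"
  shows "\<exists>r'\<le>r + sg q q'. reach p q' r'"
proof -
  obtain e where e: "e \<in> E" "supp q \<subseteq> e" "supp q' \<subseteq> e" using assms by (auto simp: ce_edge)
  consider "ce p q" "r = sg p q"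
    | a b where "a \<in> V" "b \<in> V" "ce p (vp a)" "ce q (vp b)" "r = sg p (vp a) + dv a b + sg (vp b) q"
    using assms unfolding reach_def by blast
  then show ?thesis
  proof cases
    case 1
    obtain f where f: "f \<in> E" "supp p \<subseteq> f" "supp q \<subseteq> f" using 1 by (auto simp: ce_edge)
    show ?thesis
    proof (cases "e = f")
      case True
      then have "reach p q' (sg p q')" using e f by (auto simp: reach_def ce_edge)
      then show ?thesis using 1 seg_length_triangle[of V p q' q] by auto
    next
      case False
      \<comment> \<open>The edge changes at \<open>q\<close>, so \<open>q\<close> is a vertex and
        serves as exit and entry at once, with \<open>dv v v = 0\<close>.\<close>
      then obtain v where v: "v \<in> e" "v \<in> f" "q = vp v" using two_edges[of q e f] assms e f by metis
      have "v \<in> V" "ce p (vp v)" "ce q' (vp v)" using v e f edge_subset ce_vertex by blast+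
      then have "reach p q' (sg p (vp v) + dv v v + sg (vp v) q')"
        unfolding reach_def by blast
      then show ?thesis using 1 v by (intro exI[of _ "sg p (vp v) + sg (vp v) q'"]) simp
    qed
  next
    case 2
    obtain f where f: "f \<in> E" "supp q \<subseteq> f" "b \<in> f" using 2 by (auto simp: ce_vertex)
    show ?thesis
    proof (cases "b \<in> e")
      case True
      then have "reach p q' (sg p (vp a) + dv a b + sg (vp b) q')"
        unfolding reach_def using 2 e ce_vertex by blast
      then show ?thesis using 2 seg_length_triangle[of V "vp b" q' q]
        by (intro exI[of _ "sg p (vp a) + dv a b + sg (vp b) q'"]) simp
    next
      case False
      then obtain v where v: "v \<in> e" "v \<in> f" "q = vp v"
        using two_edges[of q e f] assms e f by metis
      \<comment> \<open>The old entry vertex \<open>b\<close> is the other end of the edge at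
        \<open>v\<close>. The way from \<open>b\<close> to \<open>q = vp v\<close> costs exactly 1
        and is moved into the vertex route.\<close>
      have "f = {v, b}" using v f False edgeE[OF f(1)] by (metis insertE insert_commute singletonD)
      then have vb: "{v, b} \<in> E" using f by simp
      have "reach p q' (sg p (vp a) + dv a v + sg (vp v) q')"
        unfolding reach_def using 2 e v ce_vertex edgeD[OF vb] by blast
      moreover have "dv a v \<le> dv a b + 1"
        using dv_triangle[of a b v] 2 edgeD[OF vb] dv_edge[OF vb] by (simp add: dv_sym)
      moreover have "sg (vp b) q = 1" using v sg_vertex[of "vp b" v] edgeD[OF vb] by simp
      ultimately show ?thesis using 2 v
        by (intro exI[of _ "sg p (vp a) + dv a v + sg (vp v) q'"]) simp
    qed
  qed
qed

lemma reach_le_path: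
  assumes "path_between V E p q ps"
  shows "\<exists>r\<le>path_length V ps. reach p q r"
  using assms
proof (induction ps arbitrary: q rule: rev_induct)
  case (snoc z zs)
  show ?case
  proof (cases "zs = []")
    case True
    then show ?thesis using snoc by (auto simp: path_between_def reach_def)
  next
    case False
    then have q: "z = q" and pb: "path_between V E p (last zs) zs" and "ce (last zs) q" "q \<in> P" "p \<in> P"
      using snoc.prems by (auto simp: path_between_def successively_append_iff hd_append)
    obtain r where r: "r \<le> path_length V zs" "reach p (last zs) r" using snoc.IH pb by blast
    have "last zs \<in> P" using pb False by (auto simp: path_between_def)
    then obtain r' where "r' \<le> r + sg (last zs) q" "reach p q r'"
      using reach_step r \<open>ce _ _\<close> \<open>q \<in> P\<close> \<open>p \<in> P\<close> by metis
    moreover have "path_length V (zs @ [z]) = path_length V zs + sg (last zs) q"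
      using False q path_length_append[of V "butlast zs" "last zs" "[z]"]
      by (metis append_Cons append_Nil append_assoc append_butlast_last_id path_length_simps(2,3) add.right_neutral)
    ultimately show ?thesis using r by (intro exI[of _ r']) (simp add: q)
  qed
qed (auto simp: path_between_def)

lemma finite_reach: "finite {r. reach p q r}"
proof -
  have "{r. reach p q r} \<subseteq> insert (sg p q) ((\<lambda>(a, b). sg p (vp a) + dv a b + sg (vp b) q) ` (V \<times> V))"
    by (auto simp: reach_def)
  then show ?thesis by (rule finite_subset) auto
qed

lemma ex_reach: "p \<in> P \<Longrightarrow> q \<in> P \<Longrightarrow> \<exists>r. reach p q r"
proof -
  assume pq: "p \<in> P" "q \<in> P"
  have *: "\<exists>a\<in>V. ce p (vp a)" if p: "p \<in> P" for p
  proof -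
    obtain e where "e \<in> E" "supp p \<subseteq> e" using p point_edge by blast
    then show ?thesis using ce_vertex edgeE by (metis insertI1)
  qed
  then show ?thesis using pq unfolding reach_def by blast
qed

text \<open>The smallest candidate is a path length by \<open>reach_path\<close> and a lower bound
  for all path lengths by \<open>reach_le_path\<close>.\<close>

lemma d_reach:
  assumes "p \<in> P" "q \<in> P" shows "reach p q (d p q)"
proof -
  define m where "m = Min {r. reach p q r}"
  have nonempty: "{r. reach p q r} \<noteq> {}" using ex_reach assms by auto
  have m: "reach p q m" unfolding m_def using Min_in[OF finite_reach nonempty] by simp
  then obtain ps where ps: "path_between V E p q ps" "path_length V ps = m"
    using reach_path assms by metis
  have "d p q = m" unfolding graph_dist_def
  proof (rule cInf_eq_minimum)
    show "m \<in> {path_length V ps | ps. path_between V E p q ps}" using ps by blast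
  next
    fix x assume "x \<in> {path_length V ps | ps. path_between V E p q ps}"
    then obtain r where "r \<le> x" "reach p q r" using reach_le_path by blast
    then show "m \<le> x" unfolding m_def using Min_le[OF finite_reach, of r p q] by simp
  qed
  then show ?thesis using m by simp
qed

lemma d_path:
  assumes "p \<in> P" "q \<in> P"
  obtains ps where "path_between V E p q ps" "path_length V ps = d p q"
  using reach_path d_reach assms by metis

lemma sg_le_d: "p \<in> P \<Longrightarrow> q \<in> P \<Longrightarrow> sg p q \<le> d p q"
  by (metis d_path path_length_ge_sg)

lemma d_nonneg: "p \<in> P \<Longrightarrow> q \<in> P \<Longrightarrow> 0 \<le> d p q"
  using sg_le_d seg_length_nonneg order_trans by meson

lemma d_reach_le: "reach p q r \<Longrightarrow> p \<in> P \<Longrightarrow> q \<in> P \<Longrightarrow> d p q \<le> r"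
  by (metis reach_path d_le_path)

lemma d_ce: "p \<in> P \<Longrightarrow> q \<in> P \<Longrightarrow> ce p q \<Longrightarrow> d p q = sg p q"
  by (intro antisym d_reach_le sg_le_d) (auto simp: reach_def)

lemma d_self [simp]: "p \<in> P \<Longrightarrow> d p p = 0"
  by (simp add: d_ce)

lemma d_sym: "p \<in> P \<Longrightarrow> q \<in> P \<Longrightarrow> d p q = d q p"
  by (intro antisym) (metis d_path d_le_path path_between_rev path_length_rev)+

lemma d_triangle:
  assumes "p \<in> P" "q \<in> P" "r \<in> P" shows "d p r \<le> d p q + d q r"
proof -
  obtain ps where ps: "path_between V E p q ps" "path_length V ps = d p q" using d_path assms by metis
  obtain qs where qs: "path_between V E q r qs" "path_length V qs = d q r" using d_path assms by metis
  obtain ps' where ps': "ps = ps' @ [q]" using path_between_snoc ps by blast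
  obtain qs' where qs': "qs = q # qs'" using path_between_hd qs by blast
  have "path_between V E p r (ps' @ q # qs')" using path_between_append ps qs ps' qs' by blast
  from d_le_path[OF this] show ?thesis using path_length_append[of V ps' q qs'] ps qs ps' qs' by simp
qed

lemma d_eq_0: "p \<in> P \<Longrightarrow> q \<in> P \<Longrightarrow> d p q \<le> 0 \<Longrightarrow> p = q"
proof
  fix w assume a: "p \<in> P" "q \<in> P" "d p q \<le> 0"
  have "\<bar>p w - q w\<bar> \<le> 0" using sg_coord[of p q w] sg_le_d[of p q] a by linarith
  then show "p w = q w" by simp
qed

lemma d_vertices:
  assumes "a \<in> V" "b \<in> V" shows "d (vp a) (vp b) = dv a b"
proof (rule antisym)
  have "reach (vp a) (vp b) (sg (vp a) (vp a) + dv a b + sg (vp b) (vp b))"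
    unfolding reach_def using assms by (metis ce_refl vp_point)
  then show "d (vp a) (vp b) \<le> dv a b" using d_reach_le assms by fastforce
next
  have s: "sg (vp u) (vp v) = dv u v" if uv: "u \<in> V" "v \<in> V" "ce (vp u) (vp v)" for u v
  proof -
    obtain e where "e \<in> E" "u \<in> e" "v \<in> e" using uv by (auto simp: ce_edge)
    then have "u = v \<or> {u, v} \<in> E" using edgeE by (metis doubleton_eq_iff insertE singletonD)
    then show ?thesis using sg_vertex[of "vp u" v] dv_edge[of u v] edgeD[of u v] uv by auto
  qed
  have "reach (vp a) (vp b) (d (vp a) (vp b))" using d_reach assms by simp
  then consider "ce (vp a) (vp b)" "d (vp a) (vp b) = sg (vp a) (vp b)"
    | u v where "u \<in> V" "v \<in> V" "ce (vp a) (vp u)" "ce (vp b) (vp v)"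
       "d (vp a) (vp b) = sg (vp a) (vp u) + dv u v + sg (vp v) (vp b)" unfolding reach_def by blast
  then show "dv a b \<le> d (vp a) (vp b)"
  proof cases
    case 1
    then show ?thesis using s assms by simp
  next
    case 2
    then have "d (vp a) (vp b) = dv a u + dv u v + dv v b"
      using s[of a u] s[of v b] assms ce_sym[of "vp b" "vp v"] by simp
    then show ?thesis using dv_triangle[of a u b] dv_triangle[of u v b] assms 2 by simp
  qed
qed

lemma d_cases:
  assumes "p \<in> P" "q \<in> P"
  obtains "ce p q" "d p q = sg p q"
  | a b where "a \<in> V" "b \<in> V" "ce p (vp a)" "ce q (vp b)"
      "d p q = d p (vp a) + d (vp a) (vp b) + d (vp b) q"
proof -
  have "reach p q (d p q)" using d_reach assms by simp
  then consider "ce p q" "d p q = sg p q"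
    | a b where "a \<in> V" "b \<in> V" "ce p (vp a)" "ce q (vp b)"
       "d p q = sg p (vp a) + dv a b + sg (vp b) q" unfolding reach_def by blast
  then show ?thesis
  proof cases
    case 2
    then show ?thesis using that(2)[of a b] d_ce[of p "vp a"] d_ce[of "vp b" q] d_vertices assms ce_sym
      by simp
  qed (use that in blast)
qed

lemma d_vertex_ce: "p \<in> P \<Longrightarrow> v \<in> V \<Longrightarrow> ce p (vp v) \<Longrightarrow> d p (vp v) = 1 - p v"
  by (simp add: d_ce sg_vertex)

lemma d_vertex_ge: "p \<in> P \<Longrightarrow> v \<in> V \<Longrightarrow> 1 - p v \<le> d p (vp v)"
  by (metis sg_le_d sg_vertex vp_point)

text \<open>The form of \<open>d_cases\<close> for lower bounds: away from a common edge it is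
  enough to bound the remaining distance from each vertex through which \<open>p\<close> can leave
  its edge.\<close>

lemma d_exit:
  assumes "p \<in> P" "q \<in> P"
  obtains "ce p q" "d p q = sg p q"
  | a where "a \<in> V" "ce p (vp a)" "d p q = d p (vp a) + d (vp a) q"
proof -
  consider "ce p q" "d p q = sg p q"
  | a b where "a \<in> V" "b \<in> V" "ce p (vp a)" "ce q (vp b)"
      "d p q = d p (vp a) + d (vp a) (vp b) + d (vp b) q" using d_cases[OF assms] by metis
  then show ?thesis
  proof cases
    case 2
    then show ?thesis using that(2)[of a] d_triangle[of "vp a" "vp b" q] d_triangle[of p "vp a" q] assms
      by simp
  qed (use that in blast)
qed

end

section \<open>Geodesics and the bottleneck criterion\<close>

definition between :: "('a \<Rightarrow> real) \<Rightarrow> ('a \<Rightarrow> real) \<Rightarrow> real \<Rightarrow> 'a \<Rightarrow> real" where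
  "between p q t = (\<lambda>w. (1 - t) * p w + t * q w)"

text \<open>The trace of the polygonal path with the given break points.\<close>

fun pts :: "('a \<Rightarrow> real) list \<Rightarrow> ('a \<Rightarrow> real) set" where
  "pts [] = {}"
| "pts [p] = {p}"
| "pts (p # q # ps) = between p q ` {0..1} \<union> pts (q # ps)"

lemma between_0 [simp]: "between p q 0 = p" and between_1 [simp]: "between p q 1 = q"
  by (simp_all add: between_def)

lemma between_le: "p w \<le> m \<Longrightarrow> q w \<le> m \<Longrightarrow> t \<in> {0..1} \<Longrightarrow> between p q t w \<le> m"
  unfolding between_def by (rule convex_bound_le) auto

lemma pts_le:
  assumes "q \<in> pts ps" "\<And>p. p \<in> set ps \<Longrightarrow> p w \<le> m" shows "q w \<le> m"
  using assms by (induction ps rule: pts.induct) (auto intro: between_le)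

lemma set_subset_pts: "set ps \<subseteq> pts ps"
proof (induction ps rule: pts.induct)
  case (3 p q ps)
  have "p \<in> between p q ` {0..1}" using between_0[of p q] by (metis atLeastAtMost_iff image_eqI order_refl zero_le_one)
  then show ?case using 3 by auto
qed auto

text \<open>Affine extension of a vertex function to the realisation. If adjacent values differ by
  at most \<open>K\<close>, it is \<open>K\<close>-Lipschitz, and so it serves as a potential for
  bounding distances from below.\<close>

definition lin :: "'a set \<Rightarrow> ('a \<Rightarrow> real) \<Rightarrow> ('a \<Rightarrow> real) \<Rightarrow> real" where
  "lin V g p = (\<Sum>w\<in>V. p w * g w)"

lemma lin_between: "lin V g (between p q t) = (1 - t) * lin V g p + t * lin V g q"
  by (simp add: lin_def between_def sum_distrib_left sum.distrib[symmetric] algebra_simps)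

lemma pts_lin_le:
  assumes "q \<in> pts ps" "\<And>p. p \<in> set ps \<Longrightarrow> lin V g p \<le> m" shows "lin V g q \<le> m"
  using assms
  by (induction ps rule: pts.induct) (auto simp: lin_between intro!: convex_bound_le)

context fgraph
begin

lemma lin_edge:
  assumes "{a, b} \<in> E" "supp p \<subseteq> {a, b}"
  shows "lin V g p = p a * g a + p b * g b"
  unfolding lin_def by (rule sum_two) (use assms edgeD[OF assms(1)] in auto)

lemma lin_vp [simp]: "v \<in> V \<Longrightarrow> lin V g (vp v) = g v"
  by (simp add: lin_def vp_def if_distrib[of "\<lambda>x. x * _"] sum.delta cong: if_cong)

lemma lin_lipschitz_sg:
  assumes g: "\<And>a b. {a, b} \<in> E \<Longrightarrow> \<bar>g a - g b\<bar> \<le> K" and pq: "p \<in> P" "q \<in> P" "ce p q"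
  shows "\<bar>lin V g p - lin V g q\<bar> \<le> K * sg p q"
proof -
  obtain e where e: "e \<in> E" "supp p \<subseteq> e" "supp q \<subseteq> e" using pq by (auto simp: ce_edge)
  then obtain a b where ab: "e = {a, b}" using edgeE by metis
  have pb: "p b = 1 - p a" "q b = 1 - q a"
    using point_sum_edge[of p a b] point_sum_edge[of q a b] e ab pq by auto
  have "lin V g p - lin V g q = (p a * g a + (1 - p a) * g b) - (q a * g a + (1 - q a) * g b)"
    using lin_edge[of a b p g] lin_edge[of a b q g] e ab by (simp add: pb)
  also have "\<dots> = (p a - q a) * (g a - g b)" by (simp add: algebra_simps)
  finally have "lin V g p - lin V g q = (p a - q a) * (g a - g b)" .
  then have "\<bar>lin V g p - lin V g q\<bar> = sg p q * \<bar>g a - g b\<bar>"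
    using sg_edge[of p q a b] e ab pq by (simp add: abs_mult)
  also have "\<dots> \<le> sg p q * K" using g e ab by (intro mult_left_mono) auto
  finally show ?thesis by (simp add: mult.commute)
qed

lemma lin_lipschitz:
  assumes g: "\<And>a b. {a, b} \<in> E \<Longrightarrow> \<bar>g a - g b\<bar> \<le> K" and pq: "p \<in> P" "q \<in> P"
  shows "\<bar>lin V g p - lin V g q\<bar> \<le> K * d p q"
proof -
  obtain ps where ps: "path_between V E p q ps" "path_length V ps = d p q" using d_path pq by metis
  have "path_between V E p q ps \<Longrightarrow> \<bar>lin V g p - lin V g q\<bar> \<le> K * path_length V ps" for ps
  proof (induction ps arbitrary: p rule: induct_list012)
    case (3 a b ps)
    then have "path_between V E b q (b # ps)" "p = a" "a \<in> P" "b \<in> P" "ce a b"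
      by (auto simp: path_between_def)
    then show ?case using 3(2)[of b] lin_lipschitz_sg[of g K a b] g by (auto simp: algebra_simps)
  qed (auto simp: path_between_def)
  then show ?thesis using ps by metis
qed

lemma between_point:
  assumes "p \<in> P" "q \<in> P" "ce p q" "t \<in> {0..1}"
  shows "between p q t \<in> P" "\<And>e. supp p \<subseteq> e \<Longrightarrow> supp q \<subseteq> e \<Longrightarrow> supp (between p q t) \<subseteq> e"
proof -
  show s: "supp p \<subseteq> e \<Longrightarrow> supp q \<subseteq> e \<Longrightarrow> supp (between p q t) \<subseteq> e" for e
  proof
    fix x assume "supp p \<subseteq> e" "supp q \<subseteq> e" "x \<in> supp (between p q t)"
    moreover have "p x = 0 \<and> q x = 0 \<Longrightarrow> between p q t x = 0" by (simp add: between_def)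
    ultimately show "x \<in> e" by blast
  qed
  obtain e where e: "e \<in> E" "supp p \<subseteq> e" "supp q \<subseteq> e" using assms by (auto simp: ce_edge)
  then obtain a b where ab: "e = {a, b}" using edgeE by metis
  have "p a + p b = 1" "q a + q b = 1"
    using point_sum_edge[of p a b] point_sum_edge[of q a b] e ab assms by auto
  moreover have "between p q t a + between p q t b = (1 - t) * (p a + p b) + t * (q a + q b)"
    by (simp add: between_def algebra_simps)
  ultimately have "between p q t a + between p q t b = 1" by simp
  moreover have "0 \<le> between p q t w" for w
    using point_nonneg assms by (simp add: between_def)
  ultimately show "between p q t \<in> P" using edge_pointI[of a b] s e ab by metis
qed

lemma sg_between:
  assumes "p \<in> P" "q \<in> P" "ce p q" "t \<in> {0..1}" "u \<in> {0..1}"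
  shows "sg (between p q t) (between p q u) = \<bar>t - u\<bar> * sg p q"
proof -
  obtain e where e: "e \<in> E" "supp p \<subseteq> e" "supp q \<subseteq> e" using assms by (auto simp: ce_edge)
  then obtain a b where ab: "e = {a, b}" using edgeE by metis
  have "sg (between p q t) (between p q u) = \<bar>between p q t a - between p q u a\<bar>"
    using sg_edge[of _ _ a b] between_point[of p q] assms e ab by metis
  also have "between p q t a - between p q u a = (u - t) * (p a - q a)"
    by (simp add: between_def algebra_simps)
  also have "\<bar>(u - t) * (p a - q a)\<bar> = \<bar>t - u\<bar> * sg p q"
    using sg_edge[of p q a b] assms e ab by (simp add: abs_mult abs_minus_commute)
  finally show ?thesis .
qed

lemma pts_subset:
  assumes "set ps \<subseteq> P" "successively ce ps" shows "pts ps \<subseteq> P"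
  using assms by (induction ps rule: pts.induct) (auto simp: between_point)

section \<open>Geodesics: segments, concatenation, approximation by paths\<close>

definition isog :: "('a \<Rightarrow> real) \<Rightarrow> ('a \<Rightarrow> real) \<Rightarrow> (real \<Rightarrow> 'a \<Rightarrow> real) \<Rightarrow> bool" where
  "isog x y \<gamma> \<longleftrightarrow> \<gamma> 0 = x \<and> \<gamma> (d x y) = y \<and> \<gamma> ` {0..d x y} \<subseteq> P \<and>
     (\<forall>s\<in>{0..d x y}. \<forall>t\<in>{0..d x y}. d (\<gamma> s) (\<gamma> t) = \<bar>s - t\<bar>)"

lemma is_geodesic_isog: "is_geodesic V E x y S \<longleftrightarrow> (\<exists>\<gamma>. isog x y \<gamma> \<and> S = \<gamma> ` {0..d x y})"
  by (auto simp: is_geodesic_def isog_def Let_def)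

lemma geodesic_self: "x \<in> P \<Longrightarrow> is_geodesic V E x x {x}"
  unfolding is_geodesic_isog by (intro exI[of _ "\<lambda>_. x"]) (auto simp: isog_def)

lemma geodesic_sym:
  assumes "is_geodesic V E x y S" "x \<in> P" "y \<in> P" shows "is_geodesic V E y x S"
proof -
  obtain \<gamma> where g: "isog x y \<gamma>" "S = \<gamma> ` {0..d x y}" using assms by (auto simp: is_geodesic_isog)
  have [simp]: "d y x = d x y" using d_sym assms by simp
  have "isog y x (\<lambda>t. \<gamma> (d x y - t))"
    using g(1) unfolding isog_def by auto
  moreover have "S = (\<lambda>t. \<gamma> (d x y - t)) ` {0..d y x}"
    unfolding g(2) by (auto simp: image_iff) (metis add_diff_cancel_left' atLeastAtMost_iff diff_ge_0_iff_ge diff_le_self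
        diff_diff_eq2 diff_add_cancel diff_le_eq le_add_same_cancel1)+
  ultimately show ?thesis unfolding is_geodesic_isog by blast
qed

lemma geodesic_segment:
  assumes "p \<in> P" "q \<in> P" "ce p q" shows "is_geodesic V E p q (between p q ` {0..1})"
proof (cases "d p q = 0")
  case True
  then have "p = q" using d_eq_0 assms by simp
  moreover from this have "between p q ` {0..1} = {p}"
    by (auto simp: between_def algebra_simps intro!: image_eqI[of _ _ 0])
  ultimately show ?thesis using geodesic_self assms by simp
next
  case False
  define L where "L = d p q"
  have L: "L > 0" "sg p q = L" using False d_nonneg[of p q] d_ce[of p q] assms unfolding L_def by linarith+
  have "isog p q (\<lambda>t. between p q (t / L))"
    unfolding isog_def L_def[symmetric]
  proof (intro conjI ballI)
    show "(\<lambda>t. between p q (t / L)) ` {0..L} \<subseteq> P"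
      using between_point(1)[OF assms] L by auto
  next
    fix s t assume st: "s \<in> {0..L}" "t \<in> {0..L}"
    then have 1: "s / L \<in> {0..1}" "t / L \<in> {0..1}" using L by auto
    obtain e where "e \<in> E" "supp p \<subseteq> e" "supp q \<subseteq> e" using assms by (auto simp: ce_edge)
    then have "ce (between p q (s / L)) (between p q (t / L))"
      using between_point(2)[OF assms] 1 unfolding ce_edge by meson
    then have "d (between p q (s / L)) (between p q (t / L)) = \<bar>s / L - t / L\<bar> * L"
      using d_ce between_point(1)[OF assms] 1 sg_between[OF assms 1] L by simp
    then show "d (between p q (s / L)) (between p q (t / L)) = \<bar>s - t\<bar>"
      using L by (simp add: diff_divide_distrib[symmetric])
  qed (use L in auto)
  moreover have "between p q ` {0..1} = (\<lambda>t. between p q (t / L)) ` {0..L}"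
  proof -
    have "{0..1} = (\<lambda>t. t / L) ` {0..L}"
    proof
      show "{0..1} \<subseteq> (\<lambda>t. t / L) ` {0..L}"
      proof
        fix x :: real assume "x \<in> {0..1}"
        then show "x \<in> (\<lambda>t. t / L) ` {0..L}"
          using L by (intro image_eqI[of _ _ "x * L"]) auto
      qed
    qed (use L in auto)
    then show ?thesis by (simp add: image_image)
  qed
  ultimately show ?thesis unfolding is_geodesic_isog L_def by blast
qed

lemma geodesic_concat:
  assumes A: "is_geodesic V E x m A" and B: "is_geodesic V E m y B"
    and len: "d x y = d x m + d m y" and xy: "x \<in> P" "y \<in> P" "m \<in> P"
  shows "is_geodesic V E x y (A \<union> B)"
proof -
  obtain f where f: "isog x m f" "A = f ` {0..d x m}" using A by (auto simp: is_geodesic_isog)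
  obtain g where g: "isog m y g" "B = g ` {0..d m y}" using B by (auto simp: is_geodesic_isog)
  define L where "L = d x m"
  define M where "M = d m y"
  have L0: "0 \<le> L" and M0: "0 \<le> M" using d_nonneg xy by (auto simp: L_def M_def)
  have f': "f 0 = x" "f L = m" "\<And>s. 0 \<le> s \<Longrightarrow> s \<le> L \<Longrightarrow> f s \<in> P"
    "\<And>s t. 0 \<le> s \<Longrightarrow> s \<le> L \<Longrightarrow> 0 \<le> t \<Longrightarrow> t \<le> L \<Longrightarrow> d (f s) (f t) = \<bar>s - t\<bar>"
    using f by (auto simp: isog_def L_def)
  have g': "g 0 = m" "g M = y" "\<And>s. 0 \<le> s \<Longrightarrow> s \<le> M \<Longrightarrow> g s \<in> P"
    "\<And>s t. 0 \<le> s \<Longrightarrow> s \<le> M \<Longrightarrow> 0 \<le> t \<Longrightarrow> t \<le> M \<Longrightarrow> d (g s) (g t) = \<bar>s - t\<bar>"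
    using g by (auto simp: isog_def M_def)
  define h where "h t = (if t \<le> L then f t else g (t - L))" for t
  have h: "h t = g (t - L)" if "L \<le> t" for t using that f' g' by (auto simp: h_def)
  have hP: "h t \<in> P" if "0 \<le> t" "t \<le> L + M" for t using that f'(3) g'(3) by (auto simp: h_def)
  \<comment> \<open>A shortcut between the two pieces would bring \<open>x\<close> and
    \<open>y\<close> closer than \<open>L + M\<close>.\<close>
  have cross: "d (f s) (g t) = L - s + t" if st: "0 \<le> s" "s \<le> L" "0 \<le> t" "t \<le> M" for s t
  proof (rule antisym)
    have "d (f s) m = L - s" "d m (g t) = t" using f'(4)[of s L] g'(4)[of 0 t] f' g' st L0 M0 by auto
    then show "d (f s) (g t) \<le> L - s + t"
      using d_triangle[of "f s" m "g t"] f' g' st xy by simp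
    have "d x (f s) = s" "d (g t) y = M - t" using f'(4)[of 0 s] g'(4)[of t M] f' g' st L0 M0 by auto
    then have "L + M \<le> s + d (f s) (g t) + (M - t)"
      using d_triangle[of x "f s" y] d_triangle[of "f s" "g t" y] f'(3) g'(3) st xy len
      unfolding L_def M_def by (smt (verit))
    then show "L - s + t \<le> d (f s) (g t)" by simp
  qed
  have hd': "d (h s) (h t) = t - s" if st: "0 \<le> s" "s \<le> t" "t \<le> L + M" for s t
  proof -
    consider "t \<le> L" | "L \<le> s" | "s \<le> L" "L \<le> t" by linarith
    then show ?thesis
    proof cases
      case 1
      then show ?thesis using st f'(4)[of s t] by (simp add: h_def)
    next
      case 2
      then show ?thesis using st g'(4)[of "s - L" "t - L"] by (simp add: h)
    next
      case 3
      then show ?thesis using st cross[of s "t - L"] h[of t] by (simp add: h_def)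
    qed
  qed
  have "isog x y h"
    unfolding isog_def len L_def[symmetric] M_def[symmetric]
  proof (intro conjI ballI)
    show "h 0 = x" using f' L0 by (simp add: h_def)
    show "h (L + M) = y" using h[of "L + M"] g' M0 by simp
    show "h ` {0..L + M} \<subseteq> P" using hP by auto
    fix s t assume "s \<in> {0..L + M}" "t \<in> {0..L + M}"
    then show "d (h s) (h t) = \<bar>s - t\<bar>"
      using hd'[of s t] hd'[of t s] d_sym[OF hP hP, of s t] by (cases "s \<le> t") auto
  qed
  moreover have "A \<union> B = h ` {0..d x y}"
  proof -
    have "h ` {0..L} = f ` {0..L}" by (intro image_cong) (auto simp: h_def)
    moreover have "h ` {L..L + M} = g ` {0..M}"
    proof -
      have "h ` {L..L + M} = (\<lambda>t. g (t - L)) ` {L..L + M}" by (intro image_cong) (auto simp: h)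
      also have "\<dots> = g ` ((\<lambda>t. t - L) ` {L..L + M})" by (simp only: image_image)
      also have "(\<lambda>t. t - L) ` {L..L + M} = {0..M}" by simp
      finally show ?thesis .
    qed
    moreover have "{0..L + M} = {0..L} \<union> {L..L + M}" using L0 M0 by auto
    ultimately show ?thesis using f g len by (simp add: L_def M_def image_Un)
  qed
  ultimately show ?thesis unfolding is_geodesic_isog by blast
qed

lemma geodesic_of_path:
  assumes "path_between V E x y ps" "path_length V ps = d x y"
  shows "is_geodesic V E x y (pts ps)"
  using assms
proof (induction ps arbitrary: x rule: induct_list012)
  case (2 a)
  then show ?case using geodesic_self by (auto simp: path_between_def)
next
  case (3 a b ps)
  then have b: "path_between V E b y (b # ps)" "x = a" and ab: "a \<in> P" "b \<in> P" "ce a b" "y \<in> P"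
    using last_in_set[of "b # ps"] by (auto simp: path_between_def simp del: last_in_set)
  have "d b y \<le> path_length V (b # ps)" "d x y \<le> d a b + d b y" "d a b = sg a b"
    using d_le_path b d_triangle d_ce ab by blast+
  then have *: "path_length V (b # ps) = d b y" "d a y = d a b + d b y" using 3 b by auto
  have "is_geodesic V E b y (pts (b # ps))" using 3(2) b * by blast
  from geodesic_concat[OF geodesic_segment[OF ab(1-3)] this *(2)] show ?case using ab b by simp
qed (auto simp: path_between_def)

lemma path_mem_dist:
  assumes "path_between V E p q ps" "r \<in> set ps" shows "d p r \<le> path_length V ps"
proof -
  obtain as bs where ps: "ps = as @ r # bs" using assms split_list by metis
  have "path_between V E p r (as @ [r])"
    using assms ps by (auto simp: path_between_def successively_append_iff hd_append)
  then have "d p r \<le> path_length V (as @ [r])" by (rule d_le_path)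
  then show ?thesis using path_length_append[of V as r bs] ps path_length_nonneg[of V "r # bs"]
    by (metis add.commute add_increasing)
qed

text \<open>A geodesic has no break points of its own. Sampling it at steps shorter than
  \<open>\<epsilon>\<close> and joining successive samples by shortest paths gives a list that stays
  within \<open>\<epsilon>\<close> of it.\<close>

lemma geodesic_chain:
  assumes "is_geodesic V E x y S" "\<epsilon> > 0" "x \<in> P" "y \<in> P"
  obtains ps where "path_between V E x y ps" "\<And>q. q \<in> set ps \<Longrightarrow> \<exists>s\<in>S. d s q < \<epsilon>"
proof -
  obtain \<gamma> where g: "isog x y \<gamma>" "S = \<gamma> ` {0..d x y}" using assms by (auto simp: is_geodesic_isog)
  define L where "L = d x y"
  have L0: "0 \<le> L" using d_nonneg assms by (simp add: L_def)
  have g': "\<gamma> 0 = x" "\<gamma> L = y" "\<And>s. 0 \<le> s \<Longrightarrow> s \<le> L \<Longrightarrow> \<gamma> s \<in> P" "S = \<gamma> ` {0..L}"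
    "\<And>s t. 0 \<le> s \<Longrightarrow> s \<le> L \<Longrightarrow> 0 \<le> t \<Longrightarrow> t \<le> L \<Longrightarrow> d (\<gamma> s) (\<gamma> t) = \<bar>s - t\<bar>"
    using g by (auto simp: isog_def L_def)
  obtain N :: nat where "L / \<epsilon> < N" using reals_Archimedean2 by blast
  then have N: "N > 0"
    using divide_nonneg_pos[OF L0 \<open>\<epsilon> > 0\<close>] by (intro gr0I) simp
  have "L / N < \<epsilon>" using N \<open>L / \<epsilon> < N\<close> \<open>\<epsilon> > 0\<close> by (simp add: field_simps)
  note N = N this
  have step: "0 \<le> i * (L / N)" "i * (L / N) \<le> L" if "i \<le> N" for i :: nat
    using that L0 N mult_right_mono[of "real i" "real N" "L / N"] by auto
  have "\<exists>ps. path_between V E x (\<gamma> (i * (L / N))) ps \<and> (\<forall>q\<in>set ps. \<exists>s\<in>S. d s q < \<epsilon>)" if "i \<le> N" for i :: nat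
    using that
  proof (induction i)
    case 0
    have "x \<in> S" using g' L0 by force
    then have "\<forall>q\<in>set [x]. \<exists>s\<in>S. d s q < \<epsilon>" using assms by force
    moreover have "path_between V E x (\<gamma> (real 0 * (L / N))) [x]"
      using g'(1) assms by (simp add: path_between_def)
    ultimately show ?case by blast
  next
    case (Suc i)
    let ?a = "\<gamma> (i * (L / N))" and ?b = "\<gamma> (Suc i * (L / N))"
    obtain ps where ps: "path_between V E x ?a ps" "\<forall>q\<in>set ps. \<exists>s\<in>S. d s q < \<epsilon>" using Suc by auto
    have P: "?a \<in> P" "?b \<in> P" "?a \<in> S" using step[of i] step[of "Suc i"] Suc g' by auto
    obtain qs where qs: "path_between V E ?a ?b qs" "path_length V qs = d ?a ?b" using d_path P by metis
    have "Suc i * (L / N) = i * (L / N) + L / N" by (simp add: distrib_right add_divide_distrib)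
    then have "d ?a ?b = L / N"
      using g'(5)[of "i * (L / N)" "Suc i * (L / N)"] step[of i] step[of "Suc i"] Suc L0 N
      by simp
    then have "d ?a q < \<epsilon>" if "q \<in> set qs" for q using path_mem_dist[OF qs(1) that] qs(2) N(2) by linarith
    then have "\<forall>q\<in>set qs. \<exists>s\<in>S. d s q < \<epsilon>" using P(3) by blast
    moreover obtain ps' where "ps = ps' @ [?a]" using ps path_between_snoc by metis
    moreover obtain qs' where "qs = ?a # qs'" using qs path_between_hd by metis
    ultimately have "path_between V E x ?b (ps' @ ?a # qs')"
      "\<forall>q\<in>set (ps' @ ?a # qs'). \<exists>s\<in>S. d s q < \<epsilon>" using path_between_append[of V E x ?a ps' ?b qs'] ps qs by auto
    then show ?case by blast
  qed
  from this[of N] show ?thesis using that N g' by auto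
qed

section \<open>The bottleneck criterion\<close>

lemma geodesic_point:
  assumes "is_geodesic V E x y S" "p \<in> S" shows "p \<in> P" "d x p + d p y = d x y"
proof -
  obtain \<gamma> where g: "isog x y \<gamma>" "S = \<gamma> ` {0..d x y}" using assms by (auto simp: is_geodesic_isog)
  obtain t where "t \<in> {0..d x y}" "p = \<gamma> t" using g assms by blast
  moreover from this have "0 \<in> {0..d x y}" "d x y \<in> {0..d x y}" by auto
  ultimately have "p \<in> P" "d x p = \<bar>0 - t\<bar>" "d p y = \<bar>t - d x y\<bar>"
    using g(1) unfolding isog_def by (metis image_subset_iff)+
  then show "p \<in> P" "d x p + d p y = d x y" using \<open>t \<in> _\<close> by auto
qed

text \<open>The equation says that \<open>p\<close> lies metrically between \<open>x\<close> and
  \<open>y\<close>. Testing break points asks for more than testing all points of the path; it is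
  affordable because a path cannot change its edge without a break point at a vertex.\<close>

definition bottleneck :: "real \<Rightarrow> bool" where
  "bottleneck D \<longleftrightarrow> (\<forall>x\<in>P. \<forall>y\<in>P. \<forall>p\<in>P. d x p + d p y = d x y \<longrightarrow>
     (\<forall>ps. path_between V E x y ps \<longrightarrow> (\<exists>q\<in>set ps. d p q \<le> D)))"

lemma bottleneckI:
  assumes "\<And>x y p ps. x \<in> P \<Longrightarrow> y \<in> P \<Longrightarrow> p \<in> P \<Longrightarrow> d x p + d p y = d x y \<Longrightarrow> path_between V E x y ps \<Longrightarrow>
     (\<And>q. q \<in> set ps \<Longrightarrow> D < d p q) \<Longrightarrow> False"
  shows "bottleneck D"
  unfolding bottleneck_def using assms by (meson not_less)

text \<open>The sides \<open>B\<close> and \<open>C\<close> are followed only up to the error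
  \<open>r - D\<close>. If all their points are farther than \<open>r\<close> from \<open>p\<close>,
  the approximating lists still avoid the closed \<open>D\<close>-ball, against the
  criterion.\<close>

lemma bottleneck_side:
  assumes D: "bottleneck D" "D < r"
    and geo: "is_geodesic V E x y A" "is_geodesic V E y z B" "is_geodesic V E z x C"
    and xyz: "x \<in> P" "y \<in> P" "z \<in> P"
  shows "A \<subseteq> neighbourhood V E r (B \<union> C)"
proof
  fix p assume p: "p \<in> A"
  have pP: "p \<in> P" "d x p + d p y = d x y" using geodesic_point geo p by metis+
  show "p \<in> neighbourhood V E r (B \<union> C)"
  proof (rule ccontr)
    assume "p \<notin> neighbourhood V E r (B \<union> C)"
    then have far: "\<And>q. q \<in> B \<union> C \<Longrightarrow> r < d p q" using pP by (force simp: neighbourhood_def)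
    have BC: "B \<subseteq> P" "C \<subseteq> P" using geodesic_point geo by blast+
    have *: "D < d p q" if "q \<in> P" "s \<in> B \<union> C" "d s q < r - D" for q s
    proof -
      have "d p s \<le> d p q + d q s" using d_triangle pP BC that by blast
      then show ?thesis using far[OF that(2)] that d_sym[of q s] BC by auto
    qed
    have "r - D > 0" using D by simp
    from geodesic_chain[OF geo(2) this] xyz obtain ps
      where ps: "path_between V E y z ps" "\<And>q. q \<in> set ps \<Longrightarrow> \<exists>s\<in>B. d s q < r - D" by metis
    from geodesic_chain[OF geo(3) \<open>r - D > 0\<close>] xyz obtain qs
      where qs: "path_between V E z x qs" "\<And>q. q \<in> set qs \<Longrightarrow> \<exists>s\<in>C. d s q < r - D" by metis
    obtain ps' where ps': "ps = ps' @ [z]" using ps path_between_snoc by metis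
    obtain qs' where qs': "qs = z # qs'" using qs path_between_hd by metis
    have pq: "path_between V E y x (ps' @ z # qs')" using path_between_append ps qs ps' qs' by metis
    obtain q where q: "q \<in> set (rev (ps' @ z # qs'))" "d p q \<le> D"
      using D path_between_rev[OF pq] pP xyz unfolding bottleneck_def by blast
    moreover have "q \<in> P" using pq q by (auto simp: path_between_def)
    ultimately show False using * ps(2)[of q] qs(2)[of q] ps' qs' by fastforce
  qed
qed

lemma triangle_delta_le:
  assumes "bottleneck D" "0 \<le> D" "geodesic_triangle V E A B C"
  shows "triangle_delta V E A B C \<le> D"
proof (rule dense_ge)
  \<comment> \<open>Only the radii above \<open>D\<close> are known to be admissible; the infimum
    absorbs the difference.\<close>
  fix r assume r: "D < r"
  obtain x y z where "x \<in> P" "y \<in> P" "z \<in> P" "is_geodesic V E x y A" "is_geodesic V E y z B" "is_geodesic V E z x C"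
    using assms by (auto simp: geodesic_triangle_def)
  then show "triangle_delta V E A B C \<le> r"
    unfolding triangle_delta_def using bottleneck_side[OF assms(1) r] r assms(2)
    by (intro cInf_lower) (auto intro!: bdd_belowI[of _ 0])
qed

lemma ex_point: "\<exists>x. x \<in> P"
  using ne edgeE vp_point by blast

lemma hyperbolicity_le:
  assumes "bottleneck D" "0 \<le> D" shows "hyperbolicity V E \<le> D"
  unfolding hyperbolicity_def
proof (rule cSup_least)
  obtain x where "x \<in> P" using ex_point by blast
  then have "geodesic_triangle V E {x} {x} {x}" using geodesic_self by (auto simp: geodesic_triangle_def)
  then show "{triangle_delta V E A B C | A B C. geodesic_triangle V E A B C} \<noteq> {}" by blast
qed (use triangle_delta_le assms in blast)

lemma bounded: obtains M where "0 \<le> M" "\<And>p q. p \<in> P \<Longrightarrow> q \<in> P \<Longrightarrow> d p q \<le> M"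
proof -
  define N where "N = (\<Sum>(a, b)\<in>V \<times> V. dv a b)"
  define M where "M = 2 + real N"
  have "d p q \<le> M" if pq: "p \<in> P" "q \<in> P" for p q
    using pq
  proof (cases rule: d_cases)
    case 1
    then show ?thesis using sg_le_1[of p q] pq by (simp add: M_def)
  next
    case (2 a b)
    have "dv a b \<le> N"
      unfolding N_def using member_le_sum[of "(a, b)" "V \<times> V" "\<lambda>(a, b). dv a b"] 2 by simp
    then show ?thesis
      using 2 sg_le_1[of p "vp a"] sg_le_1[of q "vp b"] pq d_ce d_vertices d_sym[of "vp b" q] unfolding M_def
      by (smt (verit) of_nat_le_iff vp_point)
  qed
  moreover have "0 \<le> M" by (simp add: M_def)
  ultimately show ?thesis using that by blast
qed

text \<open>A bigon is read as a triangle whose third side is the point \<open>y\<close>; since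
  \<open>y\<close> lies on the second side, the third contributes nothing closer to
  \<open>p\<close>. The diameter bound \<open>M\<close> ensures that the \<open>Inf\<close> ranges
  over a nonempty set and the \<open>Sup\<close> over a bounded one.\<close>

lemma bigon_lower:
  assumes ps: "path_between V E x y ps" "path_length V ps = d x y"
    and qs: "path_between V E x y qs" "path_length V qs = d x y"
    and p: "p \<in> pts ps" and far: "\<And>q. q \<in> pts qs \<Longrightarrow> D \<le> d p q"
  shows "D \<le> hyperbolicity V E"
proof -
  obtain M where M: "0 \<le> M" "\<And>p q. p \<in> P \<Longrightarrow> q \<in> P \<Longrightarrow> d p q \<le> M" using bounded by blast
  have bM: "bottleneck M"
  proof (rule bottleneckI)
    fix x y p ps assume "x \<in> P" "p \<in> P" "path_between V E x y ps" "\<And>q. q \<in> set ps \<Longrightarrow> M < d p q"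
    then show False using M(2)[of p x] by (metis path_between_hd list.set_intros(1) not_less)
  qed
  have xy: "x \<in> P" "y \<in> P" using ps by (auto simp: path_between_def)
  have A: "is_geodesic V E x y (pts ps)" and C: "is_geodesic V E y x (pts qs)"
    using geodesic_of_path ps qs geodesic_sym xy by auto
  have tri: "geodesic_triangle V E (pts ps) {y} (pts qs)"
    unfolding geodesic_triangle_def using A C geodesic_self xy by blast
  have yq: "y \<in> pts qs" using qs set_subset_pts[of qs] by (auto simp: path_between_def)
  have "D \<le> triangle_delta V E (pts ps) {y} (pts qs)"
    unfolding triangle_delta_def
  proof (rule cInf_greatest)
    have "M + 1 > M" by simp
    from bottleneck_side[OF bM this A _ C, of "{y}"] bottleneck_side[OF bM this _ C A, of "{y}"]
      bottleneck_side[OF bM this C A, of "{y}"]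
    show "{r. 0 \<le> r \<and> pts ps \<subseteq> neighbourhood V E r ({y} \<union> pts qs) \<and>
      {y} \<subseteq> neighbourhood V E r (pts qs \<union> pts ps) \<and> pts qs \<subseteq> neighbourhood V E r (pts ps \<union> {y})} \<noteq> {}"
      using geodesic_self xy M by (intro ex_in_conv[THEN iffD1] exI[of _ "M + 1"]) auto
  next
    fix r assume "r \<in> {r. 0 \<le> r \<and> pts ps \<subseteq> neighbourhood V E r ({y} \<union> pts qs) \<and>
      {y} \<subseteq> neighbourhood V E r (pts qs \<union> pts ps) \<and> pts qs \<subseteq> neighbourhood V E r (pts ps \<union> {y})}"
    then have "p \<in> neighbourhood V E r ({y} \<union> pts qs)" using p by blast
    then show "D \<le> r" using far yq by (fastforce simp: neighbourhood_def)
  qed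
  also have "\<dots> \<le> hyperbolicity V E"
    unfolding hyperbolicity_def
  proof (rule cSup_upper)
    show "bdd_above {triangle_delta V E A B C | A B C. geodesic_triangle V E A B C}"
      using triangle_delta_le[OF bM M(1)] by (intro bdd_aboveI[of _ M]) blast
  qed (use tri in blast)
  finally show ?thesis .
qed

section \<open>Midpoints of edges\<close>

definition mid :: "'a \<Rightarrow> 'a \<Rightarrow> 'a \<Rightarrow> real" where
  "mid a b = between (vp a) (vp b) (1/2)"

lemma mid_simps:
  assumes "{a, b} \<in> E"
  shows "mid a b \<in> P" "mid a b a = 1/2" "mid a b b = 1/2" "w \<noteq> a \<Longrightarrow> w \<noteq> b \<Longrightarrow> mid a b w = 0"
    "supp (mid a b) = {a, b}" "ce (mid a b) (vp a)" "ce (mid a b) (vp b)"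
    "sg (mid a b) (vp a) = 1/2" "sg (mid a b) (vp b) = 1/2"
    "sg (vp a) (mid a b) = 1/2" "sg (vp b) (mid a b) = 1/2"
proof -
  note ab = edgeD[OF assms]
  have c: "ce (vp a) (vp b)" using assms by (auto simp: ce_edge)
  show m: "mid a b \<in> P" unfolding mid_def using between_point[OF _ _ c] ab by simp
  show v: "mid a b a = 1/2" "mid a b b = 1/2" "w \<noteq> a \<Longrightarrow> w \<noteq> b \<Longrightarrow> mid a b w = 0" for w
    using ab by (simp_all add: mid_def between_def)
  show s: "supp (mid a b) = {a, b}" using v by (auto split: if_splits)
  show "ce (mid a b) (vp a)" "ce (mid a b) (vp b)" using s assms by (auto simp: ce_vertex)
  show "sg (mid a b) (vp a) = 1/2" "sg (mid a b) (vp b) = 1/2" using m v ab sg_vertex by auto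
  then show "sg (vp a) (mid a b) = 1/2" "sg (vp b) (mid a b) = 1/2" by (simp_all add: seg_length_sym)
qed

text \<open>A point with \<open>q a + q b < 1\<close> is not on the edge. Leaving the edge costs 1/2
  up to one of its ends \<open>v\<close>, and from there \<open>1 - q v \<ge> 1/2\<close> bounds the
  rest.\<close>

lemma mid_far:
  assumes "{a, b} \<in> E" "q \<in> P" "q a \<le> 1/2" "q b \<le> 1/2" "q a + q b < 1"
  shows "1 \<le> d (mid a b) q"
  using mid_simps(1)[OF assms(1)] assms(2)
proof (cases rule: d_exit)
  case 1
  then obtain e where e: "e \<in> E" "{a, b} \<subseteq> e" "supp q \<subseteq> e" using mid_simps[OF assms(1)] by (auto simp: ce_edge)
  then have "e = {a, b}" using edge_eqI[of "{a, b}" e] assms by simp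
  then show ?thesis using point_sum_edge[of q a b] assms e by simp
next
  case (2 v)
  then obtain e where e: "e \<in> E" "{a, b} \<subseteq> e" "v \<in> e" using mid_simps[OF assms(1)] by (auto simp: ce_vertex)
  then have "e = {a, b}" using edge_eqI[of "{a, b}" e] assms by simp
  then have v: "v = a \<or> v = b" using e by auto
  have "1 - q v \<le> d (vp v) q" using d_vertex_ge[of q v] d_sym[of q "vp v"] assms 2 by simp
  moreover have "d (mid a b) (vp v) = 1/2"
    using d_vertex_ce[of "mid a b" v] mid_simps[OF assms(1)] 2 v by auto
  ultimately show ?thesis using 2 v assms by auto
qed

end

section \<open>Circumference\<close>

abbreviation walk :: "'a set set \<Rightarrow> 'a list \<Rightarrow> bool" where
  "walk E \<equiv> successively (\<lambda>a b. {a, b} \<in> E)"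

lemma walk_rev: "walk E (rev xs) \<longleftrightarrow> walk E xs"
  unfolding successively_rev by (simp add: insert_commute)

text \<open>Loop erasure: a step back to an element already on the list cuts the list there.\<close>

lemma rtrancl_distinct_path:
  assumes "(u, w) \<in> r\<^sup>*"
  obtains ws where "ws \<noteq> []" "hd ws = u" "last ws = w" "distinct ws"
    "successively (\<lambda>a b. (a, b) \<in> r) ws" "set ws \<subseteq> insert u (Range r)"
  using assms
proof (induction arbitrary: thesis rule: rtrancl_induct)
  case base
  show ?case by (rule base[of "[u]"]) auto
next
  case (step y z)
  obtain ws where ws: "ws \<noteq> []" "hd ws = u" "last ws = y" "distinct ws"
    "successively (\<lambda>a b. (a, b) \<in> r) ws" "set ws \<subseteq> insert u (Range r)" using step.IH by blast
  show ?case
  proof (cases "z \<in> set ws")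
    case True
    then obtain as bs where "ws = (as @ [z]) @ bs" using split_list[of z ws] by auto
    moreover from this have "successively (\<lambda>a b. (a, b) \<in> r) (as @ [z])"
      using ws(5) by (metis successively_append_iff)
    ultimately show ?thesis
      using step.prems[of "as @ [z]"] ws by (cases as) auto
  next
    case False
    then show ?thesis
      using step.prems[of "ws @ [z]"] ws step.hyps by (auto simp: successively_append_iff hd_append)
  qed
qed

text \<open>The common ends \<open>u\<close> and \<open>v\<close> of the two arcs belong to
  \<open>ws\<close>, and \<open>mid\<close> holds only the inner vertices of the other arc, so a
  single disjointness condition is enough.\<close>

lemma is_cycle_merge:
  assumes "walk E (u # mid @ [v])" "walk E ws" "ws \<noteq> []" "hd ws = u" "last ws = v"
    "distinct mid" "distinct ws" "set mid \<inter> set ws = {}" "mid \<noteq> []" "3 \<le> length mid + length ws"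
  shows "is_cycle E (mid @ rev ws)"
proof -
  have m: "{u, hd mid} \<in> E" "walk E mid" "{last mid, v} \<in> E"
    using assms(1,9) by (auto simp: successively_append_iff successively_Cons)
  then have "walk E (mid @ rev ws)"
    using assms by (auto simp: successively_append_iff walk_rev hd_rev simp del: successively_rev)
  moreover have "{last (mid @ rev ws), hd (mid @ rev ws)} \<in> E"
    using m assms by (simp add: last_rev)
  ultimately show ?thesis using assms by (auto simp: is_cycle_def)
qed

context fgraph
begin

lemma walk_dv:
  assumes "walk E ws" "ws \<noteq> []" shows "dv (hd ws) (last ws) \<le> length ws - 1"
proof -
  have "(hd ws, last ws) \<in> adjrel E ^^ (length ws - 1)"
    using assms
  proof (induction ws rule: induct_list012)
    case (3 a b xs)
    then have "(b, last (b # xs)) \<in> adjrel E ^^ length xs" "(a, b) \<in> adjrel E" by auto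
    then show ?case using relpow_Suc_I2[of a b "adjrel E"] by simp
  qed auto
  then show ?thesis by (rule dv_le)
qed

lemma shortest_list:
  assumes "a \<in> V" "b \<in> V"
  obtains zs where "length zs = Suc (dv a b)" "hd zs = a" "last zs = b" "walk E zs" "set zs \<subseteq> V"
    "\<And>i. i < length zs \<Longrightarrow> dv a (zs ! i) = i" "\<And>i. i < length zs \<Longrightarrow> i + dv (zs ! i) b = dv a b"
  using assms
proof (induction "dv a b" arbitrary: b thesis)
  case 0
  then have "a = b" using dv_0 by metis
  then show ?case using 0(2)[of "[a]"] 0 by auto
next
  case (Suc n)
  obtain w where w: "w \<in> V" "{w, b} \<in> E" "dv a w = n" using dv_pred Suc.prems Suc.hyps(2) by metis
  obtain zs where zs: "length zs = Suc n" "hd zs = a" "last zs = w" "walk E zs" "set zs \<subseteq> V"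
    "\<And>i. i < length zs \<Longrightarrow> dv a (zs ! i) = i" "\<And>i. i < length zs \<Longrightarrow> i + dv (zs ! i) w = n"
    using Suc.hyps(1)[of w] w Suc.prems by metis
  have ne: "zs \<noteq> []" using zs by auto
  have *: "i + dv (zs ! i) b = Suc n" if i: "i < length zs" for i
  proof -
    have zi: "zs ! i \<in> V" using zs(5) i nth_mem by blast
    have "dv a b \<le> dv a (zs ! i) + dv (zs ! i) b" "dv (zs ! i) b \<le> dv (zs ! i) w + dv w b"
      using dv_triangle Suc.prems zi w by auto
    then show ?thesis using zs(6,7)[OF i] Suc.hyps(2) dv_edge[OF w(2)] by simp
  qed
  show ?case
  proof (rule Suc.prems(1)[of "zs @ [b]"])
    show "walk E (zs @ [b])" using zs w ne by (simp add: successively_append_iff)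
    show "dv a ((zs @ [b]) ! i) = i" if "i < length (zs @ [b])" for i
      using that zs Suc.hyps(2) by (cases "i = length zs") (auto simp: nth_append)
    show "i + dv ((zs @ [b]) ! i) b = dv a b" if "i < length (zs @ [b])" for i
      using that * zs Suc.hyps(2) by (cases "i = length zs") (auto simp: nth_append)
  qed (use zs ne Suc in auto)
qed

section \<open>Leaving the closed ball about a point\<close>

definition outside :: "real \<Rightarrow> ('a \<Rightarrow> real) \<Rightarrow> 'a set" where
  "outside D p = {v \<in> V. D < d p (vp v)}"

text \<open>Adjacency in the graph induced on the vertices outside the ball. A path avoiding the
  ball changes its edge only in such vertices, so it is replaced by connectivity in this
  relation.\<close>

definition outside_adj :: "real \<Rightarrow> ('a \<Rightarrow> real) \<Rightarrow> ('a \<times> 'a) set" where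
  "outside_adj D p = {(a, b). {a, b} \<in> E \<and> a \<in> outside D p \<and> b \<in> outside D p}"

text \<open>A half of the cycle: the geodesic from \<open>p\<close> to \<open>x\<close> leaves the closed \<open>D\<close>-ball about \<open>p\<close>,
  after passing the vertices \<open>as\<close>, on the way to the vertex \<open>v\<close> outside it; \<open>x'\<close> is a point
  of the geodesic between the last of \<open>as\<close> and \<open>v\<close>.\<close>

definition half :: "real \<Rightarrow> ('a \<Rightarrow> real) \<Rightarrow> ('a \<Rightarrow> real) \<Rightarrow> 'a \<Rightarrow> 'a \<Rightarrow> 'a list \<Rightarrow> 'a \<Rightarrow> ('a \<Rightarrow> real) \<Rightarrow> bool" where
  "half D p x w a as v x' \<longleftrightarrow>
     a \<in> V \<and> ce p (vp a) \<and> v \<in> outside D p \<and> (v, w) \<in> (outside_adj D p)\<^sup>* \<and>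
     x' \<in> P \<and> ce x' (vp v) \<and> D < d p x' \<and> d p x = d p x' + d x' x \<and>
     walk E (as @ [v]) \<and> hd (as @ [v]) = a \<and> distinct as \<and> set as \<subseteq> V - outside D p \<and>
     d p x' + d x' (vp v) = d p (vp a) + length as \<and>
     (\<forall>z\<in>set as. d p x' = d p (vp z) + d (vp z) x')"

lemma outside_adj_sym: "(a, b) \<in> (outside_adj D p)\<^sup>* \<Longrightarrow> (b, a) \<in> (outside_adj D p)\<^sup>*"
proof -
  have "sym (outside_adj D p)" by (auto simp: sym_def outside_adj_def insert_commute)
  then show "(a, b) \<in> (outside_adj D p)\<^sup>* \<Longrightarrow> (b, a) \<in> (outside_adj D p)\<^sup>*"
    by (meson sym_rtrancl symD)
qed

lemma edge_pair: "e \<in> E \<Longrightarrow> a \<in> e \<Longrightarrow> b \<in> e \<Longrightarrow> a \<noteq> b \<Longrightarrow> e = {a, b}"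
  by (metis edgeE insertE insert_commute singletonD)

lemma outside_edge:
  assumes "e \<in> E" "a \<in> e" "b \<in> e" "a \<in> outside D p" "b \<in> outside D p"
  shows "(a, b) \<in> (outside_adj D p)\<^sup>*"
proof (cases "a = b")
  case False
  then have "(a, b) \<in> outside_adj D p" using assms edge_pair[of e a b] by (auto simp: outside_adj_def)
  then show ?thesis by blast
qed auto

lemma outside_neighbours:
  assumes "x \<in> P" "D < d p x" "ce x (vp a)" "ce x (vp b)" "a \<in> outside D p" "b \<in> outside D p"
  shows "(a, b) \<in> (outside_adj D p)\<^sup>*"
proof -
  obtain e where e: "e \<in> E" "supp x \<subseteq> e" "a \<in> e" using assms by (auto simp: ce_vertex)
  obtain f where f: "f \<in> E" "supp x \<subseteq> f" "b \<in> f" using assms by (auto simp: ce_vertex)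
  show ?thesis
  proof (cases "e = f")
    case True
    then show ?thesis using outside_edge e f assms by blast
  next
    case False
    then obtain v where v: "v \<in> e" "v \<in> f" "x = vp v" using two_edges[of x e f] assms e f by metis
    then have "v \<in> outside D p" using assms e edge_subset by (auto simp: outside_def)
    then show ?thesis using outside_edge[of e a v] outside_edge[of f v b] e f v assms by (meson rtrancl_trans)
  qed
qed

text \<open>Distances from \<open>p\<close> grow strictly along a shortest vertex list from
  \<open>a\<close> to \<open>b\<close>, so it leaves the ball at most once. If it does, the first
  vertex outside becomes both \<open>v\<close> and \<open>x'\<close>. If it stays inside, then
  \<open>x\<close> itself is on the edge from \<open>b\<close> to an outside vertex
  \<open>v\<close>, and \<open>x' = x\<close>.\<close>

lemma half_via:
  assumes p: "p \<in> P" and x: "x \<in> P" "D < d p x" and w: "w \<in> outside D p" "ce x (vp w)"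
    and ab: "a \<in> V" "b \<in> V" "ce p (vp a)" "ce x (vp b)"
    and eq: "d p x = d p (vp a) + dv a b + d (vp b) x"
  shows "\<exists>as v x'. half D p x w a as v x'"
proof -
  obtain zs where zs: "length zs = Suc (dv a b)" "hd zs = a" "last zs = b" "walk E zs" "set zs \<subseteq> V"
    "\<And>i. i < length zs \<Longrightarrow> dv a (zs ! i) = i" "\<And>i. i < length zs \<Longrightarrow> i + dv (zs ! i) b = dv a b"
    using shortest_list[OF ab(1,2)] by metis
  have zV: "zs ! i \<in> V" if "i < length zs" for i using zs(5) that nth_mem by blast
  have b: "b = zs ! dv a b" using zs last_conv_nth[of zs] by fastforce
  \<comment> \<open>By \<open>eq\<close> the route through the list is as short as possible, so all
    triangle inequalities along it are equalities.\<close>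
  have dz: "d p (vp (zs ! i)) = d p (vp a) + i" "d p x = d p (vp (zs ! i)) + d (vp (zs ! i)) x"
    if i: "i < length zs" for i
  proof -
    have "d p (vp (zs ! i)) \<le> d p (vp a) + i"
      using d_triangle[of p "vp a" "vp (zs ! i)"] d_vertices[of a "zs ! i"] zs(6)[OF i] p ab zV[OF i] by simp
    moreover have "d (vp (zs ! i)) x \<le> dv (zs ! i) b + d (vp b) x"
      using d_triangle[of "vp (zs ! i)" "vp b" x] d_vertices[of "zs ! i" b] x ab zV[OF i] by simp
    moreover have "d p x \<le> d p (vp (zs ! i)) + d (vp (zs ! i)) x" using d_triangle p x zV[OF i] by simp
    ultimately show "d p (vp (zs ! i)) = d p (vp a) + i" "d p x = d p (vp (zs ! i)) + d (vp (zs ! i)) x"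
      using zs(7)[OF i] eq by linarith+
  qed
  have dist: "distinct zs"
    unfolding distinct_conv_nth using dz(1) by (metis zs(6))
  have adj: "{zs ! i, zs ! Suc i} \<in> E" if "Suc i < length zs" for i
    using zs(4) that by (simp add: successively_conv_nth)
  show ?thesis
  proof (cases "b \<in> outside D p")
    case True
    define k where "k = (LEAST k. zs ! k \<in> outside D p)"
    have k: "zs ! k \<in> outside D p" "k \<le> dv a b" "\<And>i. i < k \<Longrightarrow> zs ! i \<notin> outside D p"
      unfolding k_def using True b by (metis LeastI, metis Least_le, metis not_less_Least)
    have kl: "k < length zs" using k zs by simp
    have out: "zs ! i \<in> outside D p" if "k \<le> i" "i < length zs" for i
      using k(1) dz(1)[OF kl] dz(1)[OF that(2)] that zV by (auto simp: outside_def)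
    have "(zs ! k, zs ! (k + j)) \<in> (outside_adj D p)\<^sup>*" if "k + j < length zs" for j
      using that
    proof (induction j)
      case (Suc j)
      then have "(zs ! (k + j), zs ! (k + Suc j)) \<in> outside_adj D p"
        using adj[of "k + j"] out by (auto simp: outside_adj_def)
      then show ?case using Suc by (meson Suc_lessD add_Suc_right rtrancl.rtrancl_into_rtrancl Suc_leD le_less_trans less_or_eq_imp_le add_less_cancel_left lessI less_trans)
    qed auto
    from this[of "dv a b - k"] have "(zs ! k, b) \<in> (outside_adj D p)\<^sup>*" using b k zs by simp
    moreover have "(b, w) \<in> (outside_adj D p)\<^sup>*" using outside_neighbours x ab w True by blast
    ultimately have conn: "(zs ! k, w) \<in> (outside_adj D p)\<^sup>*" by simp
    have zk: "zs ! k \<in> V" "D < d p (vp (zs ! k))" using k(1) by (auto simp: outside_def)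
    have tk: "take k zs @ [zs ! k] = take (Suc k) zs" using kl by (simp add: take_Suc_conv_app_nth)
    have "half D p x w a (take k zs) (zs ! k) (vp (zs ! k))"
      unfolding half_def
    proof (intro conjI ballI)
      show "walk E (take k zs @ [zs ! k])" unfolding tk
        using zs(4) by (metis append_take_drop_id successively_append_iff)
      show "hd (take k zs @ [zs ! k]) = a" unfolding tk using zs by (metis hd_take zero_less_Suc)
      show "set (take k zs) \<subseteq> V - outside D p"
        using k(3) zV kl by (auto simp: in_set_conv_nth)
      show "d p (vp (zs ! k)) + d (vp (zs ! k)) (vp (zs ! k)) = d p (vp a) + real (length (take k zs))"
        using dz(1)[OF kl] zk kl by simp
      fix z assume "z \<in> set (take k zs)"
      then obtain i where i: "i < k" "z = zs ! i" using kl by (auto simp: in_set_conv_nth)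
      have zi: "z \<in> V" using zV[of i] i kl by simp
      have "d p (vp (zs ! k)) \<le> d p (vp z) + d (vp z) (vp (zs ! k))"
        using d_triangle p zi zk by simp
      moreover have "d (vp z) (vp (zs ! k)) \<le> k - i"
      proof -
        have "walk E (drop i (take (Suc k) zs))"
          using zs(4) by (metis append_take_drop_id successively_append_iff)
        moreover have "drop i (take (Suc k) zs) \<noteq> []" "hd (drop i (take (Suc k) zs)) = z"
          "last (drop i (take (Suc k) zs)) = zs ! k"
          using i kl by (auto simp: hd_drop_conv_nth last_drop take_Suc_conv_app_nth)
        ultimately have "dv z (zs ! k) \<le> k - i"
          using walk_dv[of "drop i (take (Suc k) zs)"] kl by simp
        then show ?thesis using d_vertices zi zk by simp
      qed
      ultimately show "d p (vp (zs ! k)) = d p (vp z) + d (vp z) (vp (zs ! k))"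
        using dz(1)[OF kl] dz(1)[of i] i kl by simp
    qed (use ab k conn zk dz(2)[OF kl] dist in \<open>auto simp: ce_refl\<close>)
    then show ?thesis by blast
  next
    case False
    have zout: "zs ! i \<notin> outside D p" if "i < length zs" for i
    proof
      assume "zs ! i \<in> outside D p"
      then have "D < d p (vp (zs ! i))" by (simp add: outside_def)
      then have "D < d p (vp (zs ! dv a b))" using dz(1)[OF that] dz(1)[of "dv a b"] that zs by simp
      then show False using False b ab by (simp add: outside_def)
    qed
    obtain e where e: "e \<in> E" "supp x \<subseteq> e" "b \<in> e" using ab by (auto simp: ce_vertex)
    obtain f where f: "f \<in> E" "supp x \<subseteq> f" "w \<in> f" using w by (auto simp: ce_vertex)
    \<comment> \<open>The edge through \<open>x\<close> and \<open>b\<close> has an outside end: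
      either \<open>w\<close> itself, or else \<open>x\<close> is a vertex, and it is
      outside.\<close>
    obtain v where v: "v \<in> e" "v \<in> outside D p" "(v, w) \<in> (outside_adj D p)\<^sup>*"
    proof (cases "e = f")
      case True
      then show ?thesis using that f w by blast
    next
      case False
      then obtain v where v: "v \<in> e" "v \<in> f" "x = vp v" using two_edges[of x e f] x e f by metis
      then have "v \<in> outside D p" using x e edge_subset by (auto simp: outside_def)
      then show ?thesis using that v outside_edge[of f v w] f w by blast
    qed
    have bv: "b \<noteq> v" using v False by blast
    have ebv: "e = {b, v}" using edge_pair e v bv by metis
    have vV: "v \<in> V" using v by (simp add: outside_def)
    have cv: "ce x (vp v)" using e v by (auto simp: ce_vertex)
    have xbv: "d (vp b) x = 1 - x b" "d x (vp v) = 1 - x v" "x b + x v = 1"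
      using d_vertex_ce[of x b] d_vertex_ce[of x v] d_sym[of x "vp b"] x ab vV cv point_sum_edge[of x b v] e ebv by auto
    have zne: "zs \<noteq> []" using zs by auto
    have "half D p x w a zs v x"
      unfolding half_def
    proof (intro conjI ballI)
      show "walk E (zs @ [v])" using zs(3,4) e(1) ebv zne by (simp add: successively_append_iff)
      show "hd (zs @ [v]) = a" using zs zne by simp
      show "set zs \<subseteq> V - outside D p" using zout zs(5) by (auto simp: in_set_conv_nth)
      show "d p x + d x (vp v) = d p (vp a) + length zs" using eq xbv zs(1) by simp
      fix z assume "z \<in> set zs"
      then show "d p x = d p (vp z) + d (vp z) x" using dz(2) by (metis in_set_conv_nth)
    qed (use ab v cv x dist in auto)
    then show ?thesis by blast
  qed
qed

text \<open>At a vertex \<open>p\<close> the start \<open>a\<close> has to be \<open>p\<close>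
  itself, so that two halves can be joined there; at an interior point the start is an end of its
  edge. If \<open>x\<close> is on the edge of \<open>p\<close>, then \<open>D \<ge> 1/2\<close>
  keeps the end behind \<open>p\<close> inside the ball.\<close>

lemma half_exists:
  assumes p: "p \<in> P" and x: "x \<in> P" "D < d p x" and w: "w \<in> outside D p" "ce x (vp w)" and D: "1/2 \<le> D"
  shows "\<exists>a as v x'. half D p x w a as v x' \<and> (\<forall>u. p = vp u \<longrightarrow> a = u)"
proof (cases "\<exists>u. p = vp u")
  case True
  then obtain u where u: "p = vp u" by blast
  have "u \<in> V" using p u point_supp_subset[of p] by simp
  obtain b where b: "b \<in> V" "ce x (vp b)" "d p x = dv u b + d (vp b) x"
    using p x(1)
  proof (cases rule: d_cases)
    case 1
    show ?thesis by (rule that[of u]) (use 1 \<open>u \<in> V\<close> u ce_sym in auto)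
  next
    case (2 a b)
    have "d p x \<le> dv u b + d (vp b) x"
      using d_triangle[of p "vp b" x] d_vertices[of u b] u 2 \<open>u \<in> V\<close> x by simp
    moreover have "dv u b \<le> d p (vp a) + d (vp a) (vp b)"
      using d_triangle[of p "vp a" "vp b"] d_vertices[of u b] u 2 \<open>u \<in> V\<close> by simp
    ultimately show ?thesis using that[of b] 2 by linarith
  qed
  then have "\<exists>as v x'. half D p x w u as v x'"
    using half_via[OF p x w, of u b] u \<open>u \<in> V\<close> by simp
  then show ?thesis using u by auto
next
  case False
  then have nv: "\<And>u. p \<noteq> vp u" by blast
  show ?thesis
    using p x(1)
  proof (cases rule: d_cases)
    case (2 a b)
    then have "\<exists>as v x'. half D p x w a as v x'"
      using half_via[OF p x w, of a b] d_vertices by simp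
    then show ?thesis using nv by auto
  next
    case 1
    then obtain e where e: "e \<in> E" "supp p \<subseteq> e" "supp x \<subseteq> e" by (auto simp: ce_edge)
    obtain u v where uv: "e = {u, v}" "p v < x v"
    proof -
      obtain s t where st: "e = {s, t}" using edgeE e by metis
      have "p s + p t = 1" "x s + x t = 1" "sg p x = \<bar>p s - x s\<bar>"
        using point_sum_edge[of _ s t] sg_edge[of p x s t] p x e st by auto
      moreover have "sg p x > 0" using 1 x D by linarith
      ultimately have "p s < x s \<or> p t < x t" by linarith
      then show ?thesis using that[of t s] that[of s t] st by (auto simp: insert_commute)
    qed
    have E: "{u, v} \<in> E" using e uv by simp
    have eqs: "p u + p v = 1" "x u + x v = 1" "sg p x = \<bar>p v - x v\<bar>"
      using point_sum_edge[of _ u v] sg_edge[of p x v u] p x e uv by (auto simp: insert_commute)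
    have uV: "u \<in> V" "v \<in> V" "u \<noteq> v" using edgeD[OF E] by auto
    have cs: "ce p (vp u)" "ce p (vp v)" "ce x (vp v)" using e uv by (auto simp: ce_vertex)
    have dpv: "d p (vp u) = 1 - p u" "d p (vp v) = 1 - p v" "d x (vp v) = 1 - x v"
      using d_vertex_ce p x uV cs by auto
    have "d p (vp u) \<le> D"
      using dpv eqs 1 x D point_le_1[OF x(1), of v] uv by linarith
    then have uo: "u \<notin> outside D p" by (simp add: outside_def)
    obtain f where f: "f \<in> E" "supp x \<subseteq> f" "w \<in> f" using w by (auto simp: ce_vertex)
    have vo: "v \<in> outside D p \<and> (v, w) \<in> (outside_adj D p)\<^sup>*"
    proof (cases "e = f")
      case True
      then have "w = v" using f uv uo w by auto
      then show ?thesis using w by simp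
    next
      case False
      then obtain z where z: "z \<in> e" "z \<in> f" "x = vp z" using two_edges[of x e f] x e f by metis
      have "x v > 0" using uv point_nonneg[OF p, of v] by linarith
      then have "z = v" using z by (metis less_irrefl vp_simps(2))
      then show ?thesis using z x uV outside_edge[of f v w] f w by (auto simp: outside_def)
    qed
    \<comment> \<open>No vertices are passed inside the ball: \<open>x\<close> lies on the way from
      \<open>p\<close> to the first vertex \<open>v\<close>, and that vertex is already
      outside.\<close>
    have "half D p x w v [] v x"
      unfolding half_def using vo uV cs x dpv eqs 1 uv by auto
    then show ?thesis using nv by blast
  qed
qed

text \<open>Where the edge changes, the break point is a vertex, and it is outside the ball because
  all break points are. The first alternative covers paths that need no change of edge.\<close>

lemma path_outside:
  assumes "path_between V E x y ps" "\<And>q. q \<in> set ps \<Longrightarrow> D < d p q"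
  shows "ce x y \<or> (\<exists>v\<in>outside D p. \<exists>w\<in>outside D p. ce x (vp v) \<and> ce y (vp w) \<and> (v, w) \<in> (outside_adj D p)\<^sup>*)"
  using assms
proof (induction ps arbitrary: x rule: induct_list012)
  case (2 a)
  then show ?case by (auto simp: path_between_def)
next
  case (3 a b ps)
  then have b: "path_between V E b y (b # ps)" "x = a" and ab: "a \<in> P" "b \<in> P" "ce x b" "y \<in> P"
    using last_in_set[of "b # ps"] by (auto simp: path_between_def simp del: last_in_set)
  obtain e where e: "e \<in> E" "supp x \<subseteq> e" "supp b \<subseteq> e" using ab by (auto simp: ce_edge)
  have bo: "v \<in> outside D p" if "b = vp v" "v \<in> V" for v
    using 3(4)[of b] that by (auto simp: outside_def)
  from 3(2)[OF b(1)] 3(4) consider "ce b y"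
    | v w where "v \<in> outside D p" "w \<in> outside D p" "ce b (vp v)" "ce y (vp w)" "(v, w) \<in> (outside_adj D p)\<^sup>*"
    by fastforce
  then show ?case
  proof cases
    case 1
    then obtain f where f: "f \<in> E" "supp b \<subseteq> f" "supp y \<subseteq> f" by (auto simp: ce_edge)
    show ?thesis
    proof (cases "e = f")
      case True
      then show ?thesis using e f by (auto simp: ce_edge)
    next
      case False
      then obtain v where v: "v \<in> e" "v \<in> f" "b = vp v" using two_edges[of b e f] ab e f by metis
      then have "v \<in> outside D p" using bo e edge_subset by blast
      moreover have "ce x (vp v)" "ce y (vp v)" using v e f ce_vertex by blast+
      ultimately show ?thesis by blast
    qed
  next
    case 2
    then obtain f where f: "f \<in> E" "supp b \<subseteq> f" "v \<in> f" by (auto simp: ce_vertex)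
    show ?thesis
    proof (cases "v \<in> e")
      case True
      then show ?thesis using 2 e ce_vertex by blast
    next
      case False
      then obtain u where u: "u \<in> e" "u \<in> f" "b = vp u" using two_edges[of b e f] ab e f by metis
      have uo: "u \<in> outside D p" using bo u e edge_subset by blast
      moreover have "ce x (vp u)" using u e ce_vertex by blast
      moreover have "(u, v) \<in> (outside_adj D p)\<^sup>*" using outside_edge[of f u v] f u uo 2 by simp
      then have "(u, w) \<in> (outside_adj D p)\<^sup>*" using 2 by (meson rtrancl_trans)
      ultimately show ?thesis using 2 by blast
    qed
  qed
qed (auto simp: path_between_def)

text \<open>The two arcs between \<open>x'\<close> and \<open>y'\<close> have total length the length of the cycle, and neither is
  shorter than \<open>d x' y' > 2 * D\<close>.\<close>

lemma half_merge:
  assumes x': "x' \<in> P" "ce x' (vp v)" and y': "y' \<in> P" "ce y' (vp w)"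
    and vw: "v \<in> outside D p" "w \<in> outside D p" "(v, w) \<in> (outside_adj D p)\<^sup>*"
    and xy: "d x' y' = d p x' + d p y'" "2 * D < d x' y'"
    and walks: "walk E (as @ [v])" "walk E (bs @ [w])" "{hd (as @ [v]), hd (bs @ [w])} \<in> E"
    and dist: "distinct as" "distinct bs" "set as \<inter> set bs = {}" "as @ bs \<noteq> []"
    and ins: "set as \<inter> outside D p = {}" "set bs \<inter> outside D p = {}"
    and len: "d p x' + d x' (vp v) + d p y' + d y' (vp w) = 1 + length as + length bs"
    and D: "3 \<le> 4 * D"
  shows "\<exists>cs. is_cycle E cs \<and> 4 * D < length cs"
proof -
  obtain ws where ws: "ws \<noteq> []" "hd ws = v" "last ws = w" "distinct ws"
    "successively (\<lambda>a b. (a, b) \<in> outside_adj D p) ws" "set ws \<subseteq> insert v (Range (outside_adj D p))"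
    using rtrancl_distinct_path[OF vw(3)] by metis
  have wsE: "walk E ws" using ws(5) by (rule successively_mono) (simp add: outside_adj_def)
  have wso: "set ws \<subseteq> outside D p" using ws(6) vw(1) by (auto simp: outside_adj_def)
  have vV: "v \<in> V" "w \<in> V" using vw by (auto simp: outside_def)
  \<comment> \<open>This is the arc through the outside vertices. When it is added to the arc
    through \<open>p\<close>, the partial edges at \<open>x'\<close> and \<open>y'\<close> complete
    each other to whole edges, and the sum is the number of vertices of the cycle.\<close>
  have "d x' y' \<le> d x' (vp v) + dv v w + d (vp w) y'"
    using d_triangle[of x' "vp v" y'] d_triangle[of "vp v" "vp w" y'] d_vertices[of v w] vV x' y' by simp
  moreover have "dv v w \<le> length ws - 1" using walk_dv[OF wsE ws(1)] ws by simp
  moreover have "length ws \<ge> 1" using ws(1) by (cases ws) auto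
  ultimately have "2 * d x' y' \<le> length as + length bs + length ws"
    using len xy(1) d_sym[of "vp w" y'] y' vV by simp
  then have L: "4 * D < length as + length bs + length ws" using xy(2) by linarith
  have big: "3 < length as + length bs + length ws" using L D by linarith
  have "rev (as @ [v]) \<noteq> []" "bs @ [w] \<noteq> []" by auto
  then have "walk E (rev (as @ [v]) @ (bs @ [w]))"
    using walks by (auto simp: successively_append_iff walk_rev last_rev simp del: rev_append successively_rev)
  then have w1: "walk E (v # (rev as @ bs) @ [w])" by simp
  have "is_cycle E ((rev as @ bs) @ rev ws)"
    by (rule is_cycle_merge[OF w1 wsE ws(1-3)]) (use ws dist ins wso big in auto)
  then show ?thesis using L by (intro exI[of _ "(rev as @ bs) @ rev ws"]) simp
qed

text \<open>With \<open>D = c / 4\<close>, the two halves of the geodesic and a connection outside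
  the ball are closed by \<open>half_merge\<close> to a cycle longer than \<open>c\<close>. The
  remaining work is to show that the halves meet at most in \<open>p\<close>.\<close>

lemma bottleneck_circumference:
  assumes c: "\<And>cs. is_cycle E cs \<Longrightarrow> length cs \<le> c" and c3: "3 \<le> c"
  shows "bottleneck (c / 4)"
proof (rule bottleneckI)
  define D where "D = c / 4"
  have D: "3 \<le> 4 * D" "1/2 \<le> D" using c3 by (auto simp: D_def)
  fix x y p ps
  assume xyp: "x \<in> P" "y \<in> P" "p \<in> P" "d x p + d p y = d x y" and pb: "path_between V E x y ps"
    and far: "\<And>q. q \<in> set ps \<Longrightarrow> real c / 4 < d p q"
  have xyf: "D < d p x" "D < d p y"
    using far pb by (auto simp: D_def path_between_def)
  have sx: "d x p = d p x" using d_sym xyp by simp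
  have "\<not> ce x y"
  proof
    assume "ce x y"
    then have "d x y \<le> 1" using d_ce sg_le_1 xyp by simp
    then show False using xyf xyp(4) sx D by linarith
  qed
  then obtain v0 w0 where vw0: "v0 \<in> outside D p" "w0 \<in> outside D p" "ce x (vp v0)" "ce y (vp w0)"
    "(v0, w0) \<in> (outside_adj D p)\<^sup>*"
    using path_outside[OF pb] far unfolding D_def by blast
  obtain a as v x' where hx: "half D p x v0 a as v x'" "\<And>u. p = vp u \<Longrightarrow> a = u"
    using half_exists[OF xyp(3,1) xyf(1) vw0(1,3) D(2)] by blast
  obtain b bs w y' where hy: "half D p y w0 b bs w y'" "\<And>u. p = vp u \<Longrightarrow> b = u"
    using half_exists[OF xyp(3,2) xyf(2) vw0(2,4) D(2)] by blast
  note hx' = hx(1)[unfolded half_def] and hy' = hy(1)[unfolded half_def]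
  have P': "x' \<in> P" "y' \<in> P" using hx' hy' by auto
  have vwc: "(v, w) \<in> (outside_adj D p)\<^sup>*"
    using hx' hy' vw0(5) outside_adj_sym by (meson rtrancl_trans)
  have xy': "d x' y' = d p x' + d p y'"
  proof (rule antisym)
    show "d x' y' \<le> d p x' + d p y'" using d_triangle[of x' p y'] d_sym[of x' p] P' xyp by simp
    have "d x y \<le> d x x' + d x' y' + d y' y"
      using d_triangle[of x x' y] d_triangle[of x' y' y] P' xyp by simp
    then show "d p x' + d p y' \<le> d x' y'" using hx' hy' xyp(4) sx d_sym[of x x'] P' xyp by simp
  qed
  have big: "2 * D < d x' y'" using xy' hx' hy' by simp
  \<comment> \<open>A common vertex \<open>z\<close> gives a route from \<open>x'\<close> to
    \<open>y'\<close> that is shorter than the one through \<open>p\<close> by twice the distance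
    from \<open>p\<close> to \<open>z\<close>.\<close>
  have disj: "p = vp z" if "z \<in> set as" "z \<in> set bs" for z
  proof -
    have zV: "z \<in> V" using that hx' by auto
    have "d x' y' \<le> d (vp z) x' + d (vp z) y'"
      using d_triangle[of x' "vp z" y'] d_sym[of x' "vp z"] zV P' by simp
    then have "d p (vp z) \<le> 0" using hx' hy' that xy' by auto
    then show ?thesis using d_eq_0 xyp zV by simp
  qed
  have "\<exists>cs. is_cycle E cs \<and> 4 * D < length cs"
  proof (cases "\<exists>u. p = vp u")
    case True
    then obtain u where u: "p = vp u" by blast
    have au: "a = u" "b = u" using hx(2) hy(2) u by auto
    have uV: "u \<in> V" using au hx' by simp
    have uo: "u \<notin> outside D p" using u uV D by (simp add: outside_def)
    then have "as \<noteq> []" "bs \<noteq> []" using hx' hy' au by auto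
    \<comment> \<open>Both halves start at \<open>u\<close>. It is dropped from the second list, and
      its edge to the next vertex joins the two lists.\<close>
    then obtain bs' where bs: "bs = u # bs'" using hy' au by (cases bs) auto
    have dpu: "d p (vp a) = 0" "d p (vp b) = 0" using u au uV by auto
    show ?thesis
    proof (rule half_merge[of x' v y' w D p as bs'])
      show "walk E (bs' @ [w])" using hy' bs by (auto simp: successively_Cons)
      have "{u, hd (bs' @ [w])} \<in> E" using hy' bs by (cases bs') (auto simp: successively_Cons)
      then show "{hd (as @ [v]), hd (bs' @ [w])} \<in> E" using hx' au by simp
      show "set as \<inter> set bs' = {}"
      proof (rule ccontr)
        assume "set as \<inter> set bs' \<noteq> {}"
        then obtain z where z: "z \<in> set as" "z \<in> set bs'" by blast
        then have "p = vp z" using disj bs by simp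
        then show False using u z bs hy' by simp
      qed
      show "as @ bs' \<noteq> []" using \<open>as \<noteq> []\<close> by simp
      show "d p x' + d x' (vp v) + d p y' + d y' (vp w) = 1 + length as + length bs'"
      proof -
        have "d p x' + d x' (vp v) = length as" "d p y' + d y' (vp w) = length bs"
          using hx' hy' dpu by simp_all
        then show ?thesis using bs by simp
      qed
      show "3 \<le> 4 * D" by (rule D)
    qed (use hx' hy' bs vwc xy' big in auto)
  next
    case False
    have "supp p \<in> E" using point_supp[OF xyp(3)] False point_supp_single[OF xyp(3)] by fastforce
    then obtain s t where st: "supp p = {s, t}" "s \<noteq> t" "{s, t} \<in> E" using edgeE by metis
    have in_st: "z \<in> {s, t}" if z: "ce p (vp z)" for z
    proof -
      obtain e where "e \<in> E" "supp p \<subseteq> e" "z \<in> e" using z by (auto simp: ce_vertex)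
      then show ?thesis using edge_eqI[of "{s, t}" e] st by auto
    qed
    have a_st: "a \<in> {s, t}" "b \<in> {s, t}" using in_st hx' hy' by auto
    have cst: "ce p (vp s)" "ce p (vp t)" using st by (auto simp: ce_vertex)
    have dst: "d p (vp s) = 1 - p s" "d p (vp t) = 1 - p t" "p s + p t = 1"
      using d_vertex_ce xyp(3) cst edgeD[OF st(3)] point_sum_edge[of p s t] st by auto
    \<comment> \<open>The two halves leave an interior point through different ends of its edge.
      With a common end, either that end is a vertex of both halves inside the ball, or
      \<open>x'\<close> and \<open>y'\<close> both lie between \<open>p\<close> and it and are at
      most 1 apart, less than \<open>2 * D\<close>.\<close>
    have ab: "a \<noteq> b"
    proof
      assume eq: "a = b"
      show False
      proof (cases "a \<in> outside D p")
        case True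
        then have as: "as = []" "bs = []" using hx' hy' eq by (cases as; cases bs; auto)+
        then have "v = a" "w = a" using hx' hy' eq by auto
        then have "d p x' + d x' (vp a) = d p (vp a)" "d p y' + d y' (vp a) = d p (vp a)"
          "d p (vp a) \<le> 1" using hx' hy' as eq dst a_st point_nonneg[OF xyp(3)] by auto
        moreover have "d x' (vp a) \<ge> 0" "d y' (vp a) \<ge> 0" using d_nonneg P' hx' by auto
        moreover have "d x' y' \<le> d x' (vp a) + d y' (vp a)"
          using d_triangle[of x' "vp a" y'] d_sym[of y' "vp a"] P' hx' by simp
        ultimately show False using big xy' D by linarith
      next
        case False
        then have "a \<in> set as" "a \<in> set bs" using hx' hy' eq by (cases as; cases bs; auto)+
        then have "p = vp a" using disj by simp
        then show False using \<open>\<nexists>u. p = vp u\<close> by blast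
      qed
    qed
    have abE: "{a, b} \<in> E" using st a_st ab by (auto simp: insert_commute)
    have dab: "d p (vp a) + d p (vp b) = 1" using a_st ab dst by auto
    show ?thesis
    proof (rule half_merge[of x' v y' w D p as bs])
      show "{hd (as @ [v]), hd (bs @ [w])} \<in> E" using hx' hy' abE by simp
      show "set as \<inter> set bs = {}" using disj False by blast
      show "as @ bs \<noteq> []"
      proof
        assume "as @ bs = []"
        then have "a \<in> outside D p" "b \<in> outside D p" using hx' hy' by auto
        then show False using dab D by (auto simp: outside_def)
      qed
      show "d p x' + d x' (vp v) + d p y' + d y' (vp w) = 1 + length as + length bs"
        using hx' hy' dab by simp
      show "3 \<le> 4 * D" by (rule D)
    qed (use hx' hy' vwc xy' big in auto)
  qed
  then obtain cs where "is_cycle E cs" "c < length cs" by (auto simp: D_def)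
  then show False using c by fastforce
qed

end

section \<open>Graphs with a cycle longer than a triangle\<close>

lemma pts_sum_le:
  assumes "q \<in> pts ps" "\<And>p. p \<in> set ps \<Longrightarrow> p a + p b \<le> m" shows "q a + q b \<le> m"
proof -
  have *: "between p r t a + between p r t b = (1 - t) * (p a + p b) + t * (r a + r b)" for p r :: "'a \<Rightarrow> real" and t
    by (simp add: between_def algebra_simps)
  show ?thesis using assms
  proof (induction ps rule: pts.induct)
    case (3 p r ps)
    then consider t where "t \<in> {0..1}" "q = between p r t" | "q \<in> pts (r # ps)" by auto
    then show ?case
    proof cases
      case 1
      have "p a + p b \<le> m" "r a + r b \<le> m" using 3(3) by simp_all
      then show ?thesis unfolding 1(2) * using 1(1) by (intro convex_bound_le) auto
    qed (use 3 in simp)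
  qed auto
qed

lemma is_cycle_nth:
  assumes "is_cycle E cs" shows "{cs ! (i mod length cs), cs ! (Suc i mod length cs)} \<in> E"
proof -
  let ?n = "length cs"
  have n: "3 \<le> ?n" "walk E cs" "{last cs, hd cs} \<in> E" using assms by (auto simp: is_cycle_def)
  have "cs \<noteq> []" using n by auto
  show ?thesis
  proof (cases "Suc (i mod ?n) = ?n")
    case True
    then have "i mod ?n = ?n - 1" by simp
    then have "cs ! (i mod ?n) = last cs" using \<open>cs \<noteq> []\<close> by (simp add: last_conv_nth)
    moreover have "Suc i mod ?n = 0" using True by (simp add: mod_Suc)
    ultimately show ?thesis using n \<open>cs \<noteq> []\<close> by (simp add: hd_conv_nth)
  next
    case False
    then have "Suc i mod ?n = Suc (i mod ?n)" by (simp add: mod_Suc)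
    moreover have "Suc (i mod ?n) < ?n" using False \<open>cs \<noteq> []\<close> by (simp add: Suc_lessI)
    ultimately show ?thesis using n(2) by (simp add: successively_conv_nth)
  qed
qed

lemma is_cycle_nth_inj:
  assumes "is_cycle E cs" "cs ! (i mod length cs) = cs ! (j mod length cs)"
  shows "i mod length cs = j mod length cs"
proof -
  have "0 < length cs" "distinct cs" using assms by (auto simp: is_cycle_def)
  then show ?thesis using assms(2) by (simp add: nth_eq_iff_index_eq)
qed

context fgraph
begin

section \<open>Bigons with a far midpoint\<close>

lemma vp_path:
  assumes "walk E zs" "zs \<noteq> []" "set zs \<subseteq> V"
  shows "path_between V E (vp (hd zs)) (vp (last zs)) (map vp zs)"
    "path_length V (map vp zs) = length zs - 1"
proof -
  have "successively ce (map vp zs)"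
    unfolding successively_map using assms(1) by (rule successively_mono) (auto simp: ce_edge)
  then show "path_between V E (vp (hd zs)) (vp (last zs)) (map vp zs)"
    using assms by (auto simp: path_between_def hd_map last_map)
  show "path_length V (map vp zs) = length zs - 1"
    using assms
  proof (induction zs rule: induct_list012)
    case (3 a b zs)
    then show ?case using sg_vertex[of "vp a" b] edgeD[of a b] by simp
  qed auto
qed

lemma path_pts_subset: "path_between V E x y ps \<Longrightarrow> pts ps \<subseteq> P"
  using pts_subset by (auto simp only: path_between_def)

lemma path_cons:
  assumes "path_between V E y z ps" "x \<in> P" "ce x y"
  shows "path_between V E x z (x # ps)" "path_length V (x # ps) = sg x y + path_length V ps"
  using assms by (cases ps; auto simp: path_between_def)+

text \<open>The sum of two coordinates is affine along segments, so the bound at the break points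
  holds on the whole second side, and \<open>mid_far\<close> applies.\<close>

lemma bigon_mid:
  assumes "path_between V E x y ps" "path_length V ps = d x y"
    and qs: "path_between V E x y qs" "path_length V qs = d x y"
    and ab: "{a, b} \<in> E" "mid a b \<in> pts ps" and far: "\<And>q. q \<in> set qs \<Longrightarrow> q a + q b \<le> 1/2"
  shows "1 \<le> hyperbolicity V E"
proof (rule bigon_lower[OF assms(1-4) ab(2)])
  fix q assume q: "q \<in> pts qs"
  have "q \<in> P" using path_pts_subset[OF qs(1)] q by (rule subsetD)
  moreover have "q a + q b \<le> 1/2" using pts_sum_le q far by metis
  ultimately show "1 \<le> d (mid a b) q"
    using mid_far[OF ab(1), of q] point_nonneg[of q a] point_nonneg[of q b] by linarith
qed

lemma mid_in_pts: "mid a b \<in> pts (x # vp a # vp b # ps)"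
  by (auto simp: mid_def intro: image_eqI)

lemma mid_ce_vertex:
  assumes "{a, b} \<in> E" "ce (mid a b) (vp v)" shows "v = a \<or> v = b"
proof -
  obtain e where "e \<in> E" "{a, b} \<subseteq> e" "v \<in> e" using assms mid_simps by (auto simp: ce_vertex)
  then show ?thesis using edge_eqI[of "{a, b}" e] assms by auto
qed

lemma d_mid_vertex:
  assumes "{a, b} \<in> E" "v \<in> V" "v \<noteq> a" "v \<noteq> b"
  shows "d (mid a b) (vp v) = 1/2 + dv a v \<or> d (mid a b) (vp v) = 1/2 + dv b v"
  using mid_simps(1)[OF assms(1)] vp_point[OF assms(2)]
proof (cases rule: d_exit)
  case 1
  then show ?thesis using mid_ce_vertex assms by blast
next
  case (2 u)
  then have "u = a \<or> u = b" using mid_ce_vertex assms by blast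
  then show ?thesis using 2 d_vertices assms mid_simps[OF assms(1)] d_vertex_ce[of "mid a b" u] by auto
qed

text \<open>The sides run along \<open>{a, e}\<close> and \<open>{b, c}\<close> between the
  midpoints of the other two edges. Diagonals do no harm: every route between those midpoints spends
  1/2 at each end and at least 1 between distinct vertices.\<close>

lemma four_cycle:
  assumes "{a, b} \<in> E" "{b, c} \<in> E" "{c, e} \<in> E" "{e, a} \<in> E" "a \<noteq> c" "b \<noteq> e"
  shows "1 \<le> hyperbolicity V E"
proof (rule bigon_mid)
  note es = edgeD[OF assms(1)] edgeD[OF assms(2)] edgeD[OF assms(3)] edgeD[OF assms(4)]
  have ae: "{a, e} \<in> E" using assms by (simp add: insert_commute)
  let ?x = "mid a b" and ?y = "mid c e"
  have m: "?x \<in> P" "?y \<in> P" using mid_simps assms by auto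
  have "2 \<le> d ?x ?y"
    using m
  proof (cases rule: d_cases)
    case 1
    then obtain f where "f \<in> E" "{a, b} \<subseteq> f" "{c, e} \<subseteq> f"
      using mid_simps(5)[OF assms(1)] mid_simps(5)[OF assms(3)] by (auto simp: ce_edge)
    then show ?thesis using edge_eqI[of "{a, b}" f] edge_eqI[of "{c, e}" f] assms es by blast
  next
    case (2 u v)
    then have uv: "u = a \<or> u = b" "v = c \<or> v = e" using mid_ce_vertex assms by blast+
    then have "u \<noteq> v" using assms es by auto
    then have "1 \<le> d (vp u) (vp v)" using d_vertices dv_0[of u v] 2 by simp
    moreover have "d ?x (vp u) = 1/2"
      using uv(1) mid_simps(8,9)[OF assms(1)] d_ce[OF m(1) _ 2(3)] 2(1) by auto
    moreover have "d (vp v) ?y = 1/2"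
      using uv(2) mid_simps(10,11)[OF assms(3)] d_ce[OF _ m(2) ce_sym[OF 2(4)]] 2(2) by auto
    ultimately show ?thesis using 2 by linarith
  qed
  moreover
  have ps: "path_between V E ?x ?y [?x, vp a, vp e, ?y]"
    using m es mid_simps[OF assms(1)] mid_simps[OF assms(3)] ce_sym ae
    by (auto simp: path_between_def ce_vertex)
  have qs: "path_between V E ?x ?y [?x, vp b, vp c, ?y]"
    using m es mid_simps[OF assms(1)] mid_simps[OF assms(3)] ce_sym assms(2)
    by (auto simp: path_between_def ce_vertex)
  have L: "path_length V [?x, vp a, vp e, ?y] = 2" "path_length V [?x, vp b, vp c, ?y] = 2"
    using mid_simps[OF assms(1)] mid_simps[OF assms(3)] sg_vertex[of "vp a" e] sg_vertex[of "vp b" c] es by auto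
  ultimately have dxy: "d ?x ?y = 2" using d_le_path[OF ps] by simp
  show "path_between V E ?x ?y [?x, vp a, vp e, ?y]" "path_between V E ?x ?y [?x, vp b, vp c, ?y]"
    by (fact ps qs)+
  show "path_length V [?x, vp a, vp e, ?y] = d ?x ?y" "path_length V [?x, vp b, vp c, ?y] = d ?x ?y"
    using L dxy by simp_all
  show "mid a e \<in> pts [?x, vp a, vp e, ?y]" by (rule mid_in_pts)
  show "{a, e} \<in> E" by (rule ae)
  show "q a + q e \<le> 1/2" if "q \<in> set [?x, vp b, vp c, ?y]" for q
    using that mid_simps[OF assms(1)] mid_simps[OF assms(3)] es assms by auto
qed

text \<open>Two geodesics from \<open>x\<close> to \<open>c0\<close> that are disjoint next to the edge \<open>{p, p2}\<close>: the midpoint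
  of that edge is at distance 1 from the other side.\<close>

lemma branch:
  assumes V: "c0 \<in> V" and pq: "p \<noteq> q" "dv c0 p = Suc n" "dv c0 q = Suc n"
    and p2: "{p2, p} \<in> E" "dv c0 p2 = n" and q2: "{q2, q} \<in> E" "dv c0 q2 = n" and ne: "p2 \<noteq> q2"
    and x: "x \<in> P" "ce x (vp p)" "ce x (vp q)" "sg x (vp p) = s" "sg x (vp q) = s"
      "d x (vp c0) = s + Suc n" "x p \<le> 1/2" "x p2 = 0"
  shows "1 \<le> hyperbolicity V E"
proof -
  have lists: "\<exists>zs. path_between V E x (vp c0) (x # vp r # vp r2 # zs) \<and>
      path_length V (x # vp r # vp r2 # zs) = d x (vp c0) \<and>
      (\<forall>z\<in>set zs. \<exists>w. z = vp w \<and> dv c0 w < n)"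
    if r: "{r2, r} \<in> E" "dv c0 r2 = n" "ce x (vp r)" "sg x (vp r) = s" "dv c0 r = Suc n" for r r2
  proof -
    have rV: "r \<in> V" "r2 \<in> V" using edgeD r by blast+
    obtain zs where zs: "length zs = Suc (dv r2 c0)" "hd zs = r2" "last zs = c0" "walk E zs" "set zs \<subseteq> V"
      "\<And>i. i < length zs \<Longrightarrow> i + dv (zs ! i) c0 = dv r2 c0"
      using shortest_list[of r2 c0] rV V by metis
    obtain ys where ys: "zs = r2 # ys" using zs by (cases zs) auto
    note vz = vp_path[OF zs(4) _ zs(5)]
    have 1: "path_between V E (vp r2) (vp c0) (vp r2 # map vp ys)" "path_length V (vp r2 # map vp ys) = n"
      using vz ys zs r dv_sym[of r2 c0] by auto
    have c: "ce (vp r) (vp r2)" using r by (auto simp: ce_vertex)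
    have "sg (vp r) (vp r2) = 1" using sg_vertex[of "vp r" r2] rV edgeD[OF r(1)] by simp
    then have 2: "path_between V E (vp r) (vp c0) (vp r # vp r2 # map vp ys)"
      "path_length V (vp r # vp r2 # map vp ys) = Suc n"
      using path_cons[OF 1(1) _ c] 1(2) rV by auto
    have 3: "path_between V E x (vp c0) (x # vp r # vp r2 # map vp ys)"
      "path_length V (x # vp r # vp r2 # map vp ys) = d x (vp c0)"
      using path_cons[OF 2(1) x(1) r(3)] 2(2) r(4) x(6) by auto
    moreover have "\<exists>w. z = vp w \<and> dv c0 w < n" if "z \<in> set (map vp ys)" for z
    proof -
      obtain i where i: "i < length ys" "z = vp (ys ! i)" using \<open>z \<in> _\<close> by (auto simp: in_set_conv_nth)
      then show ?thesis using zs(6)[of "Suc i"] ys r(2) dv_sym[of r2 c0] dv_sym[of "ys ! i" c0] by auto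
    qed
    ultimately show ?thesis by blast
  qed
  obtain ps where ps: "path_between V E x (vp c0) (x # vp p # vp p2 # ps)"
     "path_length V (x # vp p # vp p2 # ps) = d x (vp c0)"
    using lists[of p2 p] p2 x pq by blast
  obtain qs where qs: "path_between V E x (vp c0) (x # vp q # vp q2 # qs)"
     "path_length V (x # vp q # vp q2 # qs) = d x (vp c0)" "\<forall>z\<in>set qs. \<exists>w. z = vp w \<and> dv c0 w < n"
    using lists[of q2 q] q2 x pq by blast
  show ?thesis
  proof (rule bigon_mid[OF ps qs(1,2)])
    show "{p, p2} \<in> E" using p2 by (simp add: insert_commute)
    show "mid p p2 \<in> pts (x # vp p # vp p2 # ps)" by (rule mid_in_pts)
    fix z assume "z \<in> set (x # vp q # vp q2 # qs)"
    then consider "z = x" | w where "z = vp w" "w \<noteq> p" "w \<noteq> p2"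
    proof -
      have "q \<noteq> p2" "q2 \<noteq> p" using pq p2 q2 by auto
      then show ?thesis using that \<open>z \<in> _\<close> qs(3) pq ne p2 q2 by fastforce
    qed
    then show "z p + z p2 \<le> 1/2" by cases (use x in auto)
  qed
qed

section \<open>Breadth-first layers when the constant is below 1\<close>

lemma dv_edge_le: "{u, w} \<in> E \<Longrightarrow> c0 \<in> V \<Longrightarrow> dv c0 w \<le> Suc (dv c0 u)"
  using dv_triangle[of c0 u w] dv_edge[of u w] edgeD[of u w] by simp

text \<open>Two parents of \<open>w\<close> with a common parent close a four-cycle with
  \<open>w\<close>; with different parents they begin two geodesics from \<open>w\<close> to
  \<open>c0\<close> as in \<open>branch\<close>.\<close>

lemma parents_unique:
  assumes hyp: "hyperbolicity V E < 1" and "c0 \<in> V"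
    and p: "{p, w} \<in> E" "dv c0 p = n" and q: "{q, w} \<in> E" "dv c0 q = n" and w: "dv c0 w = Suc n"
  shows "p = q"
proof (rule ccontr)
  assume ne: "p \<noteq> q"
  have vs: "p \<in> V" "q \<in> V" "w \<in> V" using edgeD p q by blast+
  have "n \<noteq> 0" using dv_0[of c0 p] dv_0[of c0 q] p q ne assms(2) vs by auto
  then obtain m where m: "n = Suc m" by (cases n) auto
  obtain p2 where p2: "{p2, p} \<in> E" "dv c0 p2 = m" using dv_pred[of c0 p m] assms(2) vs p m by metis
  obtain q2 where q2: "{q2, q} \<in> E" "dv c0 q2 = m" using dv_pred[of c0 q m] assms(2) vs q m by metis
  have "1 \<le> hyperbolicity V E"
  proof (cases "p2 = q2")
    case True
    show ?thesis
      by (rule four_cycle[of w p p2 q]) (use p q p2 q2 True ne w m in \<open>auto simp: insert_commute\<close>)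
  next
    case False
    have "w \<noteq> p" "w \<noteq> q" "w \<noteq> p2" using w p q p2 m by auto
    note wne = this
    show ?thesis
    proof (rule branch[OF assms(2) ne _ _ p2 q2 False])
      show "dv c0 p = Suc m" "dv c0 q = Suc m" using p q m by simp_all
      show "ce (vp w) (vp p)" using p(1) by (auto simp: ce_vertex)
      show "ce (vp w) (vp q)" using q(1) by (auto simp: ce_vertex)
      show "sg (vp w) (vp p) = 1" "sg (vp w) (vp q) = 1"
        using sg_vertex[of "vp w" p] sg_vertex[of "vp w" q] vs wne by simp_all
      show "d (vp w) (vp c0) = 1 + real (Suc m)"
        using d_vertices[of w c0] dv_sym[of w c0] w m vs assms(2) by simp
    qed (use wne vs in auto)
  qed
  then show False using hyp by simp
qed

text \<open>The midpoint of \<open>{p, q}\<close> is equally far from \<open>c0\<close> through both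
  ends, so different parents give the bigon of \<open>branch\<close> with
  \<open>s = 1/2\<close>.\<close>

lemma siblings_parent:
  assumes hyp: "hyperbolicity V E < 1" and "c0 \<in> V"
    and pq: "{p, q} \<in> E" "dv c0 p = Suc n" "dv c0 q = Suc n"
    and p2: "{p2, p} \<in> E" "dv c0 p2 = n" and q2: "{q2, q} \<in> E" "dv c0 q2 = n"
  shows "p2 = q2"
proof (rule ccontr)
  assume ne: "p2 \<noteq> q2"
  note m = mid_simps[OF pq(1)]
  have vs: "p \<in> V" "q \<in> V" "p \<noteq> q" using edgeD[OF pq(1)] by auto
  have "p \<noteq> c0" "q \<noteq> c0" using pq by auto
  then have "d (mid p q) (vp c0) = 1/2 + Suc n"
    using d_mid_vertex[OF pq(1) assms(2)] pq dv_sym[of _ c0] by auto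
  moreover have "p2 \<noteq> p" "p2 \<noteq> q" using p2 pq by auto
  ultimately have "1 \<le> hyperbolicity V E"
    using branch[of c0 p q n p2 q2 "mid p q" "1/2"] pq p2 q2 vs ne m assms(2) by auto
  then show False using hyp by simp
qed

text \<open>Where the cycle first reaches its farthest layer from \<open>v 0\<close>, the preceding
  vertex \<open>v t\<close> is a parent, and it remains the parent of the following vertices. Three
  such vertices in a row close a four-cycle with \<open>v t\<close>.\<close>

lemma hyperbolicity_ge_1:
  assumes cyc: "is_cycle E cs" and n4: "4 \<le> length cs"
  shows "1 \<le> hyperbolicity V E"
proof (rule ccontr)
  assume "\<not> 1 \<le> hyperbolicity V E"
  then have hyp: "hyperbolicity V E < 1" by simp
  define v where "v i = cs ! (i mod length cs)" for i
  have vE: "{v i, v (Suc i)} \<in> E" for i using is_cycle_nth[OF cyc] by (simp add: v_def)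
  have vV: "v i \<in> V" for i using edgeD[OF vE] by blast
  \<comment> \<open>Four successive vertices are distinct because the cycle has length at least
    4.\<close>
  have vne: "v (i + j) \<noteq> v i" if "0 < j" "j < 4" for i j
  proof
    assume "v (i + j) = v i"
    then have "(i + j) mod length cs = i mod length cs" using is_cycle_nth_inj[OF cyc] by (simp add: v_def)
    then have "length cs dvd j" by (metis add_diff_cancel_left' mod_eq_dvd_iff_nat le_add1)
    then show False using that n4 by (auto dest: dvd_imp_le)
  qed
  let ?l = "\<lambda>i. dv (v 0) (v i)"
  define k where "k = Max (range ?l)"
  have fin: "finite (range ?l)"
    by (rule finite_subset[of _ "dv (v 0) ` V"]) (use vV in auto)
  have kmax: "?l i \<le> k" for i unfolding k_def using fin by simp
  have "k \<in> range ?l" unfolding k_def using fin by (intro Max_in) auto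
  then have ex: "\<exists>i. ?l i = k" by auto
  define i0 where "i0 = (LEAST i. ?l i = k)"
  have i0: "?l i0 = k" "\<And>i. i < i0 \<Longrightarrow> ?l i \<noteq> k" unfolding i0_def using ex by (metis (mono_tags, lifting) LeastI, metis (mono_tags, lifting) not_less_Least)
  have "?l 1 \<noteq> 0" using dv_0 vV vne[of 1 0] by auto
  then have "k \<noteq> 0" using kmax[of 1] by simp
  then obtain m where m: "k = Suc m" by (cases k) auto
  have "i0 \<noteq> 0" using i0(1) \<open>k \<noteq> 0\<close> by (cases i0) auto
  then obtain t where t: "i0 = Suc t" by (cases i0) auto
  have "Suc (?l t) \<ge> ?l i0" using dv_edge_le[of "v t" "v i0" "v 0"] vE vV t by simp
  then have lt: "?l t = m" using kmax[of t] i0(1) i0(2)[of t] t m by simp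
  \<comment> \<open>The next vertex cannot drop to layer \<open>m\<close>, where it would be a
    second parent of \<open>v j\<close> besides \<open>v t\<close>. So it stays in layer
    \<open>k\<close> and shares the parent \<open>v t\<close>.\<close>
  have step: "dv (v 0) (v (Suc j)) = k \<and> {v t, v (Suc j)} \<in> E"
    if j: "dv (v 0) (v j) = k" "{v t, v j} \<in> E" "v (Suc j) \<noteq> v t" for j
  proof -
    have e: "{v (Suc j), v j} \<in> E" using vE[of j] by (simp add: insert_commute)
    have "?l j \<le> Suc (?l (Suc j))" using dv_edge_le[OF e] vV by simp
    then consider "?l (Suc j) = m" | "?l (Suc j) = k" using kmax[of "Suc j"] j m by linarith
    then show ?thesis
    proof cases
      case 1
      then show ?thesis using parents_unique[OF hyp vV j(2) lt e] j m by simp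
    next
      case 2
      obtain z where z: "{z, v (Suc j)} \<in> E" "dv (v 0) z = m" using dv_pred[of "v 0" "v (Suc j)" m] vV 2 m by metis
      have "v t = z" using siblings_parent[OF hyp vV vE _ _ j(2) lt z] j 2 m by simp
      then show ?thesis using z 2 by simp
    qed
  qed
  have c1: "dv (v 0) (v (t + 1)) = k" "{v t, v (t + 1)} \<in> E" using i0 t vE by auto
  have c2: "dv (v 0) (v (t + 2)) = k" "{v t, v (t + 2)} \<in> E" using step[of "t + 1"] c1 vne[of 2 t] by auto
  have c3: "dv (v 0) (v (t + 3)) = k" "{v t, v (t + 3)} \<in> E"
    using step[of "t + 2"] c2 vne[of 3 t] by (auto simp: eval_nat_numeral)
  have "1 \<le> hyperbolicity V E"
  proof (rule four_cycle)
    show "{v t, v (t + 1)} \<in> E" by (fact c1)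
    show "{v (t + 1), v (t + 2)} \<in> E" "{v (t + 2), v (t + 3)} \<in> E"
      using vE[of "t + 1"] vE[of "t + 2"] by (auto simp: eval_nat_numeral)
    show "{v (t + 3), v t} \<in> E" using c3 by (simp add: insert_commute)
    show "v t \<noteq> v (t + 2)" "v (t + 1) \<noteq> v (t + 3)" using vne[of 2 t] vne[of 2 "t + 1"] by (auto simp: eval_nat_numeral)
  qed
  then show False using hyp by simp
qed

text \<open>The bigon joins \<open>u\<close> to the midpoint of the opposite edge by sides of length
  3/2, and the tested point is the middle of one side. Through \<open>v\<close> it costs 1/4 and
  then at least 1/2, through \<open>u\<close> already 3/4.\<close>

lemma hyperbolicity_triangle:
  assumes "{u, v} \<in> E" "{v, w} \<in> E" "{u, w} \<in> E"
  shows "3/4 \<le> hyperbolicity V E"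
proof -
  note es = edgeD[OF assms(1)] edgeD[OF assms(2)] edgeD[OF assms(3)]
  note m = mid_simps[OF assms(2)]
  let ?y = "mid v w" and ?p = "between (vp u) (vp v) (3/4)"
  have "d ?y (vp u) = 3/2"
    using d_mid_vertex[OF assms(2), of u] es dv_edge[of v u] dv_edge[of w u] assms by (auto simp: insert_commute)
  then have dxy: "d (vp u) ?y = 3/2" using d_sym m es by simp
  have c: "ce (vp u) (vp v)" "ce (vp u) (vp w)" using assms by (auto simp: ce_vertex)
  have ps: "path_between V E (vp u) ?y [vp u, vp v, ?y]" "path_between V E (vp u) ?y [vp u, vp w, ?y]"
    using m es c ce_sym by (auto simp: path_between_def)
  have L: "path_length V [vp u, vp v, ?y] = d (vp u) ?y" "path_length V [vp u, vp w, ?y] = d (vp u) ?y"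
    using m dxy sg_vertex[of "vp u" v] sg_vertex[of "vp u" w] es by auto
  have "?p \<in> pts [vp u, vp v, ?y]" by auto
  then show ?thesis
  proof (rule bigon_lower[OF ps(1) L(1) ps(2) L(2)])
    fix q assume q: "q \<in> pts [vp u, vp w, ?y]"
    have qP: "q \<in> P" using path_pts_subset[OF ps(2)] q by (rule subsetD)
    have qv: "q v \<le> 1/2" using q by (rule pts_le) (use es(1,4) in \<open>auto simp: m(2) vp_def\<close>)
    \<comment> \<open>Together with \<open>qv\<close> this leaves \<open>vp u\<close> as the only
      point of the edge \<open>{u, v}\<close> on the second side.\<close>
    have qvu: "q v = 0 \<or> q u = 0"
    proof -
      have "q \<in> between (vp u) (vp w) ` {0..1} \<or> q \<in> pts [vp w, ?y]"
        using q unfolding pts.simps by blast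
      then show ?thesis
      proof
        assume "q \<in> between (vp u) (vp w) ` {0..1}"
        then have "q v = 0" using es by (auto simp: between_def)
        then show ?thesis ..
      next
        assume "q \<in> pts [vp w, ?y]"
        then have "q u \<le> 0" by (rule pts_le) (use m(4)[of u] es(1,7) in \<open>auto simp: vp_def\<close>)
        then show ?thesis using point_nonneg[OF qP, of u] by simp
      qed
    qed
    have pP: "?p \<in> P" using between_point(1)[OF _ _ c(1)] es by simp
    have pv: "?p v = 3/4" "?p u = 1/4" using es by (auto simp: between_def)
    have sp: "supp ?p = {u, v}" using es by (auto simp: between_def vp_def)
    have cev: "a = u \<or> a = v" if a: "ce ?p (vp a)" for a
    proof -
      obtain e where "e \<in> E" "{u, v} \<subseteq> e" "a \<in> e" using a sp by (auto simp: ce_vertex)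
      then show ?thesis using edge_eqI[of "{u, v}" e] assms by auto
    qed
    show "3/4 \<le> d ?p q"
      using pP qP
    proof (cases rule: d_exit)
      case 1
      then obtain e where "e \<in> E" "{u, v} \<subseteq> e" "supp q \<subseteq> e" using sp by (auto simp: ce_edge)
      then have sq: "supp q \<subseteq> {u, v}" using edge_eqI[of "{u, v}" e] assms by auto
      have "q u + q v = 1" using point_sum_edge qP sq assms by metis
      then have "q v = 0" using qvu qv by auto
      then have "\<bar>?p v - q v\<bar> = 3/4" using pv by simp
      then show ?thesis using sg_coord[OF pP qP, of v] 1 by simp
    next
      case (2 a)
      have "d ?p (vp a) = 1 - ?p a" using d_vertex_ce pP 2 by simp
      moreover have "1 - q a \<le> d (vp a) q" using d_vertex_ge[OF qP, of a] d_sym[of q "vp a"] qP 2 by simp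
      moreover have "0 \<le> d (vp a) q" using d_nonneg qP 2 by simp
      ultimately show ?thesis using cev[OF 2(2)] 2 pv qv by auto
    qed
  qed
qed

end

section \<open>A cycle with a chord\<close>

context fgraph
begin

lemma d_potential:
  assumes "\<And>a b. {a, b} \<in> E \<Longrightarrow> \<bar>g a - g b\<bar> \<le> 1" "p \<in> P" "q \<in> P"
  shows "lin V g p - lin V g q \<le> d p q"
  using lin_lipschitz[of g 1 p q] assms by simp

text \<open>The bigon joins the apex \<open>v 1\<close> of the triangle to its antipode on the cycle of length \<open>n\<close>; the
  chord \<open>{v 0, v 2}\<close> is not a shortcut there. The potential \<open>H\<close> is the distance to the side through \<open>v 0\<close>.\<close>

lemma chorded_cycle_lower:
  fixes v :: "nat \<Rightarrow> 'a"
  assumes n4: "4 \<le> n" and inj: "inj_on v {..<n}" and V: "V = v ` {..<n}"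
    and cyc: "\<And>i. Suc i < n \<Longrightarrow> {v i, v (Suc i)} \<in> E" "{v (n - 1), v 0} \<in> E"
    and E: "\<And>e. e \<in> E \<Longrightarrow> (\<exists>i. Suc i < n \<and> e = {v i, v (Suc i)}) \<or> e = {v (n - 1), v 0} \<or> e = {v 0, v 2}"
  shows "real n / 4 \<le> hyperbolicity V E"
proof -
  define h where "h = n div 2"
  define f where "f = n div 4"
  define r where "r = n mod 2"
  define idx where "idx = the_inv_into {..<n} v"
  have idx: "idx (v i) = i" if "i < n" for i
    unfolding idx_def using the_inv_into_f_f[OF inj] that by simp
  have nh: "n = 2 * h + r" "r = 0 \<or> r = 1" "h \<ge> 2" using n4 by (auto simp: h_def r_def)
  have f: "1 \<le> f" "f + 1 \<le> h" "real f \<le> n / 4" "n / 4 < real f + 1" using n4 by (auto simp: f_def h_def)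
  have vV: "v i \<in> V" if "i < n" for i using V that by auto
  have lip: "\<bar>g (idx a) - g (idx b)\<bar> \<le> 1"
    if e: "{a, b} \<in> E" and g: "\<And>i. Suc i < n \<Longrightarrow> \<bar>g i - g (Suc i)\<bar> \<le> 1" "\<bar>g (n - 1) - g 0\<bar> \<le> 1" "\<bar>g 0 - g 2\<bar> \<le> 1"
    for a b and g :: "nat \<Rightarrow> real"
  proof -
    consider i where "Suc i < n" "{a, b} = {v i, v (Suc i)}" | "{a, b} = {v (n - 1), v 0}" | "{a, b} = {v 0, v 2}"
      using E[OF e] by blast
    then show ?thesis
      by cases (use idx g n4 in \<open>auto simp: doubleton_eq_iff abs_minus_commute\<close>)
  qed
  \<comment> \<open>\<open>G\<close> is the distance to the apex \<open>v 1\<close> along the cycle.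
    Both ends of the chord have the value 1, so the chord does not spoil the Lipschitz
    bound.\<close>
  define G :: "nat \<Rightarrow> real" where "G j = (if j = 0 then 1 else min (real j - 1) (real n + 1 - real j))" for j
  \<comment> \<open>On the first side this is the distance along that side to its nearer end. For
    odd \<open>n\<close> the value -1/2 makes \<open>H\<close> vanish at \<open>y\<close>, which is
    then the midpoint of an edge.\<close>
  define H :: "nat \<Rightarrow> real" where
    "H j = (if 2 \<le> j \<and> j \<le> h + 1 then min (real j - 1) (real n / 2 - (real j - 1))
            else if r = 1 \<and> j = h + 2 then - 1/2 else 0)" for j
  have lipG: "\<bar>G (idx a) - G (idx b)\<bar> \<le> 1" if "{a, b} \<in> E" for a b
    by (rule lip[OF that]) (use n4 in \<open>auto simp: G_def min_def\<close>)
  have lipH: "\<bar>H (idx a) - H (idx b)\<bar> \<le> 1" if "{a, b} \<in> E" for a b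
  proof (rule lip[OF that])
    have n2: "real n / 2 = real h + real r / 2" using nh(1) by simp
    show "\<bar>H i - H (Suc i)\<bar> \<le> 1" for i
      using nh(2,3) unfolding H_def n2 by (auto simp: min_def)
    show "\<bar>H (n - 1) - H 0\<bar> \<le> 1" "\<bar>H 0 - H 2\<bar> \<le> 1"
      using nh unfolding H_def n2 by (auto simp: min_def)
  qed
  define x where "x = vp (v 1)"
  define y where "y = (if r = 0 then vp (v (h + 1)) else mid (v (h + 1)) (v (h + 2)))"
  have xP: "x \<in> P" using vV n4 by (simp add: x_def)
  have oddE: "{v (h + 1), v (h + 2)} \<in> E" "h + 2 < n" if "r = 1" using cyc(1)[of "h + 1"] nh that by auto
  have yP: "y \<in> P" using vV[of "h + 1"] nh mid_simps(1)[OF oddE(1)] by (auto simp: y_def)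
  have linv: "lin V (\<lambda>a. g (idx a)) (vp (v i)) = g i" if "i < n" for g :: "nat \<Rightarrow> real" and i
    using lin_vp vV idx that by simp
  have dG: "G i \<le> d (vp (v i)) x" if "i < n" for i
    using d_potential[where g="\<lambda>a. G (idx a)" and p="vp (v i)" and q=x, OF lipG] linv[OF that, of G] linv[of 1 G] vV[OF that] xP n4
    by (simp add: x_def G_def)
  have dyx: "real n / 2 \<le> d y x"
  proof (cases "r = 0")
    case True
    then show ?thesis using dG[of "h + 1"] nh by (simp add: y_def G_def)
  next
    case False
    then have r: "r = 1" using nh by simp
    note m = mid_simps[OF oddE(1)[OF r]]
    have vneq: "v i \<noteq> v j" if "i < n" "j < n" "i \<noteq> j" for i j using idx that by metis
    have "v 1 \<noteq> v (h + 1)" "v 1 \<noteq> v (h + 2)" by (rule vneq; use oddE(2)[OF r] nh in linarith)+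
    then consider "d y x = 1/2 + dv (v (h + 1)) (v 1)" | "d y x = 1/2 + dv (v (h + 2)) (v 1)"
      using d_mid_vertex[OF oddE(1)[OF r], of "v 1"] vV[of 1] n4 r by (auto simp: y_def x_def)
    moreover have "real h \<le> dv (v (h + 1)) (v 1)" "real h \<le> dv (v (h + 2)) (v 1)"
      using dG[of "h + 1"] dG[of "h + 2"] d_vertices[OF vV vV, of "h + 1" 1] d_vertices[OF vV vV, of "h + 2" 1] nh r n4
      by (auto simp: x_def G_def)
    ultimately show ?thesis using nh r by cases auto
  qed
  \<comment> \<open>Both vertex lists have \<open>h + 1\<close> entries; for odd \<open>n\<close>
    the half edge to \<open>y\<close> is still missing and is supplied by \<open>tl\<close>.\<close>
  define tl where "tl = (if r = 0 then [] else [y])"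
  define A where "A = map v [1..<h + 2]"
  define C where "C = v 1 # v 0 # rev (map v [h + 1 + r..<n])"
  have upt: "walk E (map v [a..<b])" if "b \<le> n" for a b
    using cyc(1) that by (auto simp: successively_conv_nth simp del: upt_Suc)
  have walkA: "walk E A" unfolding A_def by (rule upt) (use nh in linarith)
  have walkC: "walk E C"
  proof -
    have "walk E (rev C)"
    proof -
      have "walk E (map v [h + 1 + r..<n])" by (rule upt) simp
      moreover have "last (map v [h + 1 + r..<n]) = v (n - 1)" "map v [h + 1 + r..<n] \<noteq> []"
        using nh by (auto simp: last_map)
      ultimately show ?thesis
        using cyc(1)[of 0] cyc(2) n4 by (auto simp: C_def successively_append_iff insert_commute)
    qed
    then show ?thesis by (simp only: walk_rev)
  qed
  have ends: "hd A = v 1" "last A = v (h + 1)" "A \<noteq> []" "set A \<subseteq> V" "length A = h + 1"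
    using nh vV by (auto simp: A_def hd_map last_map)
  have endsC: "hd C = v 1" "last C = v (h + 1 + r)" "C \<noteq> []" "set C \<subseteq> V" "length C = h + 1"
    using nh vV n4 by (auto simp: C_def last_rev hd_map)
  have ext: "path_between V E x y (map vp B @ tl) \<and> path_length V (map vp B @ tl) = d x y \<and> d x y = real n / 2"
    if B: "walk E B" "hd B = v 1" "B \<noteq> []" "set B \<subseteq> V" "length B = h + 1"
      "r = 0 \<Longrightarrow> last B = v (h + 1)" "r = 1 \<Longrightarrow> last B = v (h + 1) \<or> last B = v (h + 2)" for B
  proof -
    note b = vp_path[OF B(1,3,4)]
    have *: "path_between V E x y (map vp B @ tl) \<and> path_length V (map vp B @ tl) = real n / 2"
    proof (cases "r = 0")
      case True
      then show ?thesis using b B nh by (simp add: tl_def x_def y_def)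
    next
      case False
      then have r: "r = 1" using nh by simp
      note m = mid_simps[OF oddE(1)[OF r]]
      have c: "ce (vp (last B)) y" "sg (vp (last B)) y = 1/2"
        using B(7)[OF r] m r ce_sym by (auto simp: y_def)
      obtain B' where B': "map vp B = B' @ [vp (last B)]" using B(3) by (metis append_butlast_last_id last_map map_is_Nil_conv)
      have "last B \<in> V" using B(3,4) last_in_set by blast
      then have 1: "path_between V E (vp (last B)) y [vp (last B), y]"
        using c yP by (auto simp: path_between_def)
      have 2: "path_between V E x y (B' @ vp (last B) # [y])"
        using path_between_append[OF _ 1] b(1) B(2) B' by (simp add: x_def)
      have 3: "path_length V (B' @ vp (last B) # [y]) = real n / 2"
        using path_length_append[of V B' "vp (last B)" "[y]"] b(2) B' c B(5) nh r by simp
      have "map vp B @ tl = B' @ vp (last B) # [y]" using B' r by (simp add: tl_def)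
      then show ?thesis using 2 3 by simp
    qed
    moreover from * have "d x y \<le> real n / 2" using d_le_path by metis
    ultimately show ?thesis using dyx d_sym[OF xP yP] by simp
  qed
  have pA: "path_between V E x y (map vp A @ tl)" "path_length V (map vp A @ tl) = d x y"
    using ext[of A] walkA ends by auto
  have pC: "path_between V E x y (map vp C @ tl)" "path_length V (map vp C @ tl) = d x y"
    using ext[of C] walkC endsC by auto
  \<comment> \<open>The tested point is the middle of the first side, at distance
    \<open>n / 4\<close> from \<open>v 1\<close>: \<open>f\<close> whole edges and the fraction
    \<open>s - f\<close> of the next one.\<close>
  define s where "s = real n / 4"
  let ?a = "v (f + 1)" and ?b = "v (f + 2)"
  define p where "p = between (vp ?a) (vp ?b) (s - f)"
  have fn: "f + 2 < n" using f nh by linarith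
  have s01: "s - f \<in> {0..1}" using f by (auto simp: s_def)
  have abE: "{?a, ?b} \<in> E" using cyc(1)[of "f + 1"] fn by simp
  note ab = edgeD[OF abE]
  have cab: "ce (vp ?a) (vp ?b)" using abE by (auto simp: ce_vertex)
  have pP: "p \<in> P" unfolding p_def using between_point(1)[OF _ _ cab s01] ab by simp
  have pab: "p ?a = 1 - (s - f)" "p ?b = s - f" using ab by (auto simp: p_def between_def)
  have psub: "supp p \<subseteq> {?a, ?b}" unfolding p_def by (rule between_point(2)[OF _ _ cab s01]) (use ab in auto)
  have pin: "p \<in> pts (map vp A @ tl)"
  proof -
    have "A = map v [1..<f + 1] @ ?a # ?b # map v [f + 3..<h + 2]"
    proof -
      have "[1..<h + 2] = [1..<f + 1] @ [f + 1..<h + 2]" using f upt_add_eq_append[of 1 "f + 1" "h + 1 - f"] by simp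
      also have "[f + 1..<h + 2] = (f + 1) # (f + 2) # [f + 3..<h + 2]"
        using f by (simp add: upt_conv_Cons eval_nat_numeral)
      finally show ?thesis by (simp add: A_def)
    qed
    moreover have "q \<in> pts (ps @ a # b # qs)" if "q \<in> between a b ` {0..1}" for q a b and ps qs :: "('a \<Rightarrow> real) list"
      using that
    proof (induction ps)
      case (Cons c ps)
      then show ?case by (cases ps) auto
    qed auto
    ultimately show ?thesis using s01 by (simp add: p_def)
  qed
  show ?thesis
  proof (rule bigon_lower[OF pA pC pin])
    fix q assume q: "q \<in> pts (map vp C @ tl)"
    have qP: "q \<in> P" using path_pts_subset[OF pC(1)] q by (rule subsetD)
    have Hq: "lin V (\<lambda>a. H (idx a)) q \<le> 0"
      using q
    proof (rule pts_lin_le)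
      fix z assume "z \<in> set (map vp C @ tl)"
      then consider i where "z = vp (v i)" "i < n" "i = 0 \<or> i = 1 \<or> h + 1 + r \<le> i" | "z = y" "r = 1"
        using n4 nh by (auto simp: C_def tl_def split: if_splits)
      then show "lin V (\<lambda>a. H (idx a)) z \<le> 0"
      proof cases
        case 1
        then show ?thesis using linv[of i H] nh by (auto simp: H_def)
      next
        case 2
        have "lin V (\<lambda>a. H (idx a)) y = 1/2 * H (h + 1) + 1/2 * H (h + 2)"
          using linv[of "h + 1" H] linv[of "h + 2" H] oddE(2)[OF 2(2)] 2(2) by (simp add: y_def mid_def lin_between)
        moreover have "real n / 2 = real h + 1/2" using nh(1) 2 by (simp add: add_divide_distrib)
        then have "H (h + 1) = 1/2" "H (h + 2) = -1/2" using 2 nh(3) by (auto simp: H_def add_divide_distrib)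
        ultimately show ?thesis using 2 by simp
      qed
    qed
    have dH: "H i \<le> d (vp (v i)) q" if "i < n" for i
      using d_potential[where g="\<lambda>a. H (idx a)" and p="vp (v i)" and q=q, OF lipH] linv[OF that, of H] vV[OF that] qP Hq by simp
    \<comment> \<open>As \<open>f\<close> is \<open>n / 4\<close> rounded down, the nearer end of
      the side is \<open>v 1\<close> for \<open>v (f + 1)\<close> and \<open>y\<close> for
      \<open>v (f + 2)\<close>. Adding the part of the edge between \<open>p\<close> and the exit
      vertex gives \<open>n / 4\<close> for both exits.\<close>
    have Hab: "H (f + 1) = f" "H (f + 2) = n / 2 - (f + 1)"
      using f nh by (auto simp: H_def s_def min_def)
    show "real n / 4 \<le> d p q"
      using pP qP
    proof (cases rule: d_exit)
      case (2 c)
      show ?thesis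
      proof (cases "p = vp ?a \<or> c = ?a")
        case True
        have "ce p (vp ?a)" using psub abE by (auto simp: ce_vertex)
        show ?thesis
        proof (cases "p = vp ?a")
          case True
          then have "s - f = 0" using pab(1) by simp
          then show ?thesis using dH[of "f + 1"] Hab True fn by (simp add: s_def)
        next
          case False
          then have "c = ?a" using True by simp
          moreover have "d p (vp ?a) = s - f" using d_vertex_ce[OF pP _ \<open>ce p (vp ?a)\<close>] ab pab by simp
          ultimately show ?thesis using 2 dH[of "f + 1"] Hab fn by (simp add: s_def)
        qed
      next
        case False
        have "supp p = {?a, ?b}"
        proof (rule ccontr)
          assume "supp p \<noteq> {?a, ?b}"
          then have "supp p \<subseteq> {?a} \<or> supp p \<subseteq> {?b}" using psub by blast
          then have "p = vp ?b" using point_supp_single[OF pP] False by blast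
          then have "s - f = 1" using pab by simp
          then show False using f by (simp add: s_def)
        qed
        moreover obtain e where "e \<in> E" "supp p \<subseteq> e" "c \<in> e" using 2 by (auto simp: ce_vertex)
        ultimately have c: "c = ?b" using edge_eqI[of "{?a, ?b}" e] abE False by auto
        have "d p (vp ?b) = 1 - (s - f)" using d_vertex_ce[OF pP _ 2(2)] c ab pab by simp
        then show ?thesis using 2 c dH[of "f + 2"] Hab fn by (simp add: s_def)
      qed
    next
      case 1
      show ?thesis
      proof (cases "s = f")
        case True
        then have "p = vp ?a" using point_vertexI[OF pP] pab by simp
        then show ?thesis using dH[of "f + 1"] Hab True fn by (simp add: s_def)
      next
        case False
        \<comment> \<open>Here \<open>p\<close> is an interior point, so \<open>q\<close> would be
          on the same edge. But \<open>H\<close> is positive at both ends of that edge and at most 0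
          on the second side.\<close>
        then have "0 < s - f" "s - f < 1" using s01 f by (auto simp: s_def)
        then have "?a \<in> supp p" "?b \<in> supp p" using pab by auto
        moreover obtain e where e: "e \<in> E" "supp p \<subseteq> e" "supp q \<subseteq> e" using 1 by (auto simp: ce_edge)
        ultimately have sq: "supp q \<subseteq> {?a, ?b}" using edge_eqI[of "{?a, ?b}" e] abE by auto
        have "lin V (\<lambda>a. H (idx a)) q = q ?a * H (f + 1) + q ?b * H (f + 2)"
          using lin_edge[OF abE sq, of "\<lambda>a. H (idx a)"] idx fn by simp
        moreover have "q ?a + q ?b = 1" using point_sum_edge[OF qP abE sq] .
        moreover have "H (f + 1) > 0" "H (f + 2) > 0"
        proof -
          show "H (f + 1) > 0" using Hab f by simp
          have "n \<noteq> 4" using False by (auto simp: s_def f_def)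
          then show "H (f + 2) > 0" using Hab(2) f n4 by simp
        qed
        moreover have "0 \<le> q ?a" "0 \<le> q ?b" using point_nonneg[OF qP] by auto
        ultimately have "lin V (\<lambda>a. H (idx a)) q > 0"
          by (metis add_nonneg_pos add_pos_nonneg less_eq_real_def mult_nonneg_nonneg mult_pos_pos add.right_neutral zero_neq_one)
        then show ?thesis using Hq by simp
      qed
    qed
  qed
qed

end

section \<open>Girth, circumference and the two exact values\<close>

lemma is_cycle3_iff: "length cs = 3 \<Longrightarrow> is_cycle E cs \<longleftrightarrow>
   (\<exists>a b c. cs = [a, b, c] \<and> distinct cs \<and> {a, b} \<in> E \<and> {b, c} \<in> E \<and> {a, c} \<in> E)"
  by (auto simp: is_cycle_def length_Suc_conv eval_nat_numeral insert_commute)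

context fgraph
begin

lemma is_cycle_subset:
  assumes "is_cycle E cs" shows "set cs \<subseteq> V"
proof
  fix x assume "x \<in> set cs"
  then obtain i where "i < length cs" "x = cs ! i" by (auto simp: in_set_conv_nth)
  then show "x \<in> V" using edgeD(2)[OF is_cycle_nth[OF assms, of i]] by simp
qed

lemma is_cycle_length: "is_cycle E cs \<Longrightarrow> length cs \<le> card V"
  using is_cycle_subset[of cs] card_mono[of V "set cs"] by (auto simp: is_cycle_def distinct_card)

lemma finite_cycle_lengths: "finite {length cs | cs. is_cycle E cs}"
  by (rule finite_subset[of _ "{..card V}"]) (auto dest: is_cycle_length)

lemma circumferenceD:
  assumes "circumference E = c" "0 < c"
  obtains cs where "is_cycle E cs" "length cs = c" "\<And>cs. is_cycle E cs \<Longrightarrow> length cs \<le> c"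
proof -
  let ?L = "{length cs | cs. is_cycle E cs}"
  have ne: "?L \<noteq> {}" using assms by (auto simp: circumference_def Sup_nat_def split: if_splits)
  then have "Sup ?L = Max ?L" by (simp only: Sup_nat_def if_False)
  then have c: "c = Max ?L" using assms by (simp add: circumference_def)
  then have "c \<in> ?L" using Max_in[OF finite_cycle_lengths ne] by simp
  then obtain cs where "is_cycle E cs" "length cs = c" by auto
  moreover have "length cs \<le> c" if "is_cycle E cs" for cs
    unfolding c by (rule Max_ge[OF finite_cycle_lengths]) (use that in blast)
  ultimately show ?thesis using that by blast
qed

lemma circumferenceI:
  assumes "is_cycle E cs" "length cs = c" "\<And>cs. is_cycle E cs \<Longrightarrow> length cs \<le> c"
  shows "circumference E = c"
proof -
  let ?L = "{length cs | cs. is_cycle E cs}"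
  have "?L \<noteq> {}" using assms by blast
  then have "Sup ?L = Max ?L" by (simp only: Sup_nat_def if_False)
  also have "Max ?L = c" by (rule Max_eqI[OF finite_cycle_lengths]) (use assms in auto)
  finally show ?thesis by (simp add: circumference_def)
qed

lemma girth_3D:
  assumes "girth E = 3" "is_cycle E cs"
  obtains a b c where "distinct [a, b, c]" "{a, b} \<in> E" "{b, c} \<in> E" "{a, c} \<in> E"
proof -
  let ?L = "{length cs | cs. is_cycle E cs}"
  have "?L \<noteq> {}" using assms(2) by blast
  then have "3 \<in> ?L" using Inf_nat_def1[of ?L] assms by (simp add: girth_def)
  then obtain cs where "is_cycle E cs" "length cs = 3" by auto
  then show ?thesis using that is_cycle3_iff by metis
qed

lemma girth_3I:
  assumes "distinct [a, b, c]" "{a, b} \<in> E" "{b, c} \<in> E" "{a, c} \<in> E"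
  shows "girth E = 3"
proof -
  have "is_cycle E [a, b, c]" using assms by (subst is_cycle3_iff) auto
  then have "(3::nat) \<in> {length cs | cs. is_cycle E cs}" by force
  then show ?thesis unfolding girth_def
    by (intro cInf_eq_minimum) (auto simp: is_cycle_def)
qed

lemma hyperbolicity_le_circumference:
  assumes "circumference E = c" "3 \<le> c" shows "hyperbolicity V E \<le> c / 4"
proof -
  have "\<And>cs. is_cycle E cs \<Longrightarrow> length cs \<le> c" using circumferenceD[of c] assms by auto
  then have "bottleneck (c / 4)" using bottleneck_circumference assms(2) by blast
  then show ?thesis by (rule hyperbolicity_le) simp
qed

lemma hyperbolicity_circumference_3:
  assumes "circumference E = 3" "girth E = 3" shows "hyperbolicity V E = 3 / 4"
proof (rule antisym)
  show "hyperbolicity V E \<le> 3 / 4" using hyperbolicity_le_circumference[of 3] assms by simp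
  obtain cs where "is_cycle E cs" using circumferenceD[OF assms(1)] by auto
  then obtain a b c where "{a, b} \<in> E" "{b, c} \<in> E" "{a, c} \<in> E" using girth_3D assms(2) by metis
  then show "3 / 4 \<le> hyperbolicity V E" using hyperbolicity_triangle by blast
qed

text \<open>There is exactly one edge besides those of a longest cycle. A cycle of length at least 4
  has no triangle among its own edges, so the triangle given by the girth consists of two
  consecutive cycle edges and this extra edge, as in \<open>chorded_cycle_lower\<close>.\<close>

lemma hyperbolicity_one_chord:
  assumes g: "girth E = 3" and c: "circumference E = c" "4 \<le> c" and m: "card E = c + 1"
  shows "hyperbolicity V E = c / 4"
proof (rule antisym)
  show "hyperbolicity V E \<le> c / 4" using hyperbolicity_le_circumference c by simp
  obtain cs where cs: "is_cycle E cs" "length cs = c" using circumferenceD[of c] c by auto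
  define w where "w i = cs ! (i mod c)" for i
  have wE: "{w i, w (Suc i)} \<in> E" for i using is_cycle_nth[OF cs(1)] cs by (simp add: w_def)
  have winj: "w i = w j \<longleftrightarrow> i mod c = j mod c" for i j
    using is_cycle_nth_inj[OF cs(1), of i j] cs by (auto simp: w_def)
  have wc: "w (i + c) = w i" for i by (simp add: w_def)
  define CE where "CE = (\<lambda>i. {w i, w (Suc i)}) ` {..<c}"
  \<comment> \<open>The predecessor of \<open>w i\<close> has the index \<open>i + c - 1\<close>
    rather than \<open>i - 1\<close>, to stay within the natural numbers.\<close>
  have nbr: "z = w (Suc i) \<or> z = w (i + c - 1)" if wz: "{w i, z} \<in> CE" for i z
  proof -
    obtain j where "{w i, z} = {w j, w (Suc j)}" using wz by (auto simp: CE_def)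
    then consider "w i = w j" "z = w (Suc j)" | "w i = w (Suc j)" "z = w j"
      by (auto simp: doubleton_eq_iff)
    then show ?thesis
    proof cases
      case 1
      then have "w (Suc i) = w (Suc j)" by (metis winj mod_Suc_eq)
      then show ?thesis using 1 by simp
    next
      case 2
      then have "i mod c = Suc j mod c" by (simp add: winj)
      then have "(i + (c - 1)) mod c = (Suc j + (c - 1)) mod c" by (metis mod_add_left_eq)
      then have "w (i + c - 1) = w j" using c by (simp add: winj)
      then show ?thesis using 2 by simp
    qed
  qed
  have wne: "w (i + k) \<noteq> w i" if "0 < k" "k < c" for i k
  proof
    assume "w (i + k) = w i"
    then have "c dvd k" by (metis winj add_diff_cancel_left' mod_eq_dvd_iff_nat le_add1)
    then show False using that by (auto dest: dvd_imp_le)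
  qed
  have "inj_on (\<lambda>i. {w i, w (Suc i)}) {..<c}"
  proof (rule inj_onI)
    fix i j assume ij: "i \<in> {..<c}" "j \<in> {..<c}" "{w i, w (Suc i)} = {w j, w (Suc j)}"
    then consider "w i = w j" | "w i = w (Suc j)" "w (Suc i) = w j" by (auto simp: doubleton_eq_iff)
    then show "i = j"
    proof cases
      case 1
      then show ?thesis using ij by (simp add: winj)
    next
      case 2
      then have "w (Suc (Suc j)) = w (Suc i)" by (metis winj mod_Suc_eq)
      then have "w (j + 2) = w j" using 2 by simp
      then show ?thesis using wne[of 2 j] c by simp
    qed
  qed
  then have cardCE: "card CE = c" by (simp add: CE_def card_image)
  have CEE: "CE \<subseteq> E" using wE by (auto simp: CE_def)
  have finE: "finite E" using m by (metis Suc_eq_plus1 card.infinite nat.distinct(1))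
  have "card (E - CE) = 1" using card_Diff_subset[of CE E] finite_subset[OF CEE finE] CEE cardCE m by simp
  then obtain e where e: "E - CE = {e}" by (auto simp: card_1_singleton_iff)
  obtain a b f where abf: "distinct [a, b, f]" "{a, b} \<in> E" "{b, f} \<in> E" "{a, f} \<in> E" using girth_3D g cs(1) by metis
  \<comment> \<open>The two cycle neighbours of \<open>w i\<close> would have to be cycle neighbours
    of each other, which forces length 3.\<close>
  have not_all: "\<not> ({x, y} \<in> CE \<and> {y, z} \<in> CE \<and> {x, z} \<in> CE)" if "distinct [x, y, z]" for x y z
  proof
    assume ce: "{x, y} \<in> CE \<and> {y, z} \<in> CE \<and> {x, z} \<in> CE"
    then obtain i where "x = w i \<or> x = w (Suc i)" by (auto simp: CE_def)
    then obtain i where x: "x = w i" by blast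
    have "y = w (Suc i) \<or> y = w (i + c - 1)" "z = w (Suc i) \<or> z = w (i + c - 1)"
      using nbr[of i y] nbr[of i z] ce x by auto
    then have "{w (Suc i), w (i + c - 1)} \<in> CE" using ce that by (auto simp: insert_commute)
    then have "w (i + c - 1) = w (Suc (Suc i)) \<or> w (i + c - 1) = w (Suc i + c - 1)" using nbr by blast
    then show False
    proof
      assume "w (i + c - 1) = w (Suc (Suc i))"
      moreover have "i + c - 1 = (i + 2) + (c - 3)" "Suc (Suc i) = i + 2" using c by simp_all
      ultimately have "w ((i + 2) + (c - 3)) = w (i + 2)" by metis
      then show False using wne[of "c - 3" "i + 2"] c by simp
    next
      assume "w (i + c - 1) = w (Suc i + c - 1)"
      then have "w ((i + c - 1) + 1) = w (i + c - 1)" using c by simp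
      then show False using wne[of 1 "i + c - 1"] c by simp
    qed
  qed
  have apex: "\<exists>x y z. {x, y} \<in> CE \<and> {x, z} \<in> CE \<and> y \<noteq> z \<and> e = {y, z}"
  proof -
    have ne: "{a, b} \<noteq> {b, f}" "{b, f} \<noteq> {a, f}" "{a, b} \<noteq> {a, f}"
      using abf(1) by (auto simp: doubleton_eq_iff)
    have inE: "g \<in> CE \<or> g = e" if "g \<in> E" for g using e that by (metis DiffI singletonD)
    have "{a, b} = e \<or> {b, f} = e \<or> {a, f} = e"
      using not_all[OF abf(1)] inE[OF abf(2)] inE[OF abf(3)] inE[OF abf(4)] by metis
    then show ?thesis
    proof (elim disjE)
      assume "{a, b} = e"
      then have "{a, f} \<in> CE" "{b, f} \<in> CE" using inE[OF abf(4)] inE[OF abf(3)] ne by metis+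
      then have "{f, a} \<in> CE" "{f, b} \<in> CE" by (simp_all add: insert_commute)
      moreover have "a \<noteq> b" using abf(1) by simp
      ultimately show ?thesis using \<open>{a, b} = e\<close>[symmetric] by blast
    next
      assume "{b, f} = e"
      then have "{a, b} \<in> CE" "{a, f} \<in> CE" using inE[OF abf(2)] inE[OF abf(4)] ne by metis+
      moreover have "b \<noteq> f" using abf(1) by simp
      ultimately show ?thesis using \<open>{b, f} = e\<close>[symmetric] by blast
    next
      assume "{a, f} = e"
      then have "{a, b} \<in> CE" "{b, f} \<in> CE" using inE[OF abf(2)] inE[OF abf(3)] ne by metis+
      then have "{b, a} \<in> CE" "{b, f} \<in> CE" by (simp_all add: insert_commute)
      moreover have "a \<noteq> f" using abf(1) by simp
      ultimately show ?thesis using \<open>{a, f} = e\<close>[symmetric] by blast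
    qed
  qed
  then obtain x y z where xyz: "{x, y} \<in> CE" "{x, z} \<in> CE" "y \<noteq> z" "e = {y, z}" by blast
  obtain i where "x = w i \<or> x = w (Suc i)" using xyz by (auto simp: CE_def doubleton_eq_iff)
  then obtain i where i: "x = w i" by blast
  \<comment> \<open>Counting from the predecessor of the apex makes the apex \<open>v 1\<close> and
    the chord \<open>{v 0, v 2}\<close>.\<close>
  define v where "v j = w (j + (i + c - 1))" for j
  have v1: "v 1 = w i" "v 2 = w (Suc i)" "v 0 = w (i + c - 1)" "v (j + c) = v j" for j
    using wc[of i] wc[of "Suc i"] wc[of "j + (i + c - 1)"] c by (auto simp: v_def eval_nat_numeral ac_simps)
  have "e = {v 0, v 2}" using nbr[of i y] nbr[of i z] xyz i v1 by (auto simp: insert_commute)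
  have vne: "v k \<noteq> v j" if "j < k" "k < j + c" for j k
    using wne[of "k - j" "j + (i + c - 1)"] that by (auto simp: v_def ac_simps)
  have vinj: "inj_on v {..<c}"
  proof (rule inj_onI, rule ccontr)
    fix i j assume "i \<in> {..<c}" "j \<in> {..<c}" "v i = v j" "i \<noteq> j"
    then show False using vne[of i j] vne[of j i] by (cases i j rule: linorder_cases) auto
  qed
  have vE: "{v j, v (Suc j)} \<in> E" for j unfolding v_def using wE[of "j + (i + c - 1)"] by simp
  have CEv: "\<exists>j. f = {v j, v (Suc j)}" if f: "f \<in> CE" for f
  proof -
    obtain j where j: "f = {w j, w (Suc j)}" using f by (auto simp: CE_def)
    \<comment> \<open>A multiple of \<open>c\<close> is added so that undoing the shift of the index
      does not become negative.\<close>
    define j' where "j' = j + (c * Suc i - (i + c - 1))"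
    have le: "i + c - 1 \<le> c * Suc i" using c by (cases c) auto
    have "j' + (i + c - 1) = j + c * Suc i" "Suc j' + (i + c - 1) = Suc j + c * Suc i" unfolding j'_def using le by auto
    then have "v j' = w j" "v (Suc j') = w (Suc j)" unfolding v_def by (simp_all only: winj mod_mult_self2)
    then show ?thesis using j by (intro exI[of _ j']) simp
  qed
  have vmod: "v (j mod c) = v j" for j
    unfolding v_def winj by (rule mod_add_left_eq)
  have vlast: "{v (c - 1), v 0} \<in> E" using vE[of "c - 1"] v1(4)[of 0] c by simp
  have edges: "(\<exists>j. Suc j < c \<and> f = {v j, v (Suc j)}) \<or> f = {v (c - 1), v 0} \<or> f = {v 0, v 2}" if f: "f \<in> E" for f
  proof (cases "f \<in> CE")
    case True
    then obtain j where j: "f = {v j, v (Suc j)}" using CEv by blast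
    have "v j = v (j mod c)" "v (Suc j) = v (Suc (j mod c))" using vmod[of j] vmod[of "Suc j"] vmod[of "Suc (j mod c)"]
      by (simp_all add: mod_Suc_eq)
    then have f: "f = {v (j mod c), v (Suc (j mod c))}" using j by simp
    have "j mod c < c" using c by simp
    then consider "Suc (j mod c) < c" | "j mod c = c - 1" by linarith
    then show ?thesis
    proof cases
      case 2
      then show ?thesis using f v1(4)[of 0] c by simp
    qed (use f in blast)
  next
    case False
    then show ?thesis using f e \<open>e = {v 0, v 2}\<close> by blast
  qed
  have VV: "V = v ` {..<c}"
  proof
    show "v ` {..<c} \<subseteq> V" using vE edgeD by blast
    show "V \<subseteq> v ` {..<c}"
    proof
      fix u assume "u \<in> V"
      then obtain f where "f \<in> E" "u \<in> f" by (rule vertex_in_edge)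
      then show "u \<in> v ` {..<c}" using edges[of f] c by fastforce
    qed
  qed
  show "c / 4 \<le> hyperbolicity V E"
    by (rule chorded_cycle_lower[OF c(2) vinj VV _ vlast edges]) (use vE in auto)
qed

text \<open>Every vertex other than the root is charged to the edge to a chosen parent. The parent
  is one layer closer to the root, so no edge is charged from both ends.\<close>

lemma card_vertices: "finite E \<Longrightarrow> card V \<le> card E + 1"
proof -
  assume fin: "finite E"
  obtain r where r: "r \<in> V" using ne edgeE by blast
  have "\<exists>w. {w, v} \<in> E \<and> dv r v = Suc (dv r w)" if v: "v \<in> V - {r}" for v
  proof -
    have "dv r v \<noteq> 0" using dv_0 r v by auto
    then obtain n where "dv r v = Suc n" by (cases "dv r v") auto
    then show ?thesis using dv_pred[of r v n] r v by auto
  qed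
  then obtain par where par: "\<And>v. v \<in> V - {r} \<Longrightarrow> {par v, v} \<in> E \<and> dv r v = Suc (dv r (par v))" by metis
  have "inj_on (\<lambda>v. {par v, v}) (V - {r})"
  proof (rule inj_onI)
    fix u v assume uv: "u \<in> V - {r}" "v \<in> V - {r}" "{par u, u} = {par v, v}"
    then have "u = v \<or> u = par v \<and> v = par u" by (auto simp: doubleton_eq_iff)
    then show "u = v" using par[OF uv(1)] par[OF uv(2)] by auto
  qed
  then have "card (V - {r}) \<le> card E" by (rule card_inj_on_le) (use par fin in auto)
  then show ?thesis using r by simp
qed

end

lemma graph_class_fgraph:
  assumes "(V, E) \<in> graph_class g c m" "0 < m" shows "fgraph V E"
  using assms by unfold_locales (auto simp: graph_class_def)

section \<open>Invariance under relabelling\<close>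

text \<open>Push-forward of a point: the weight at \<open>v\<close> moves to \<open>\<pi> v\<close>.
  The inverse appears because points are functions of the vertices.\<close>

definition relabel :: "('a \<Rightarrow> 'a) \<Rightarrow> ('a \<Rightarrow> real) \<Rightarrow> 'a \<Rightarrow> real" where
  "relabel \<pi> p = p \<circ> inv \<pi>"

locale relabelling =
  fixes \<pi> :: "'a \<Rightarrow> 'a" and V :: "'a set" and E :: "'a set set"
  assumes bij: "bij \<pi>"
begin

abbreviation "V' \<equiv> \<pi> ` V"
abbreviation "E' \<equiv> (`) \<pi> ` E"
abbreviation "T \<equiv> relabel \<pi>"

lemma T_apply [simp]: "T p (\<pi> w) = p w"
  using bij by (simp add: relabel_def bij_is_inj)

lemma bij_T: "bij T"
proof (rule o_bij)
  show "(\<lambda>p. p \<circ> \<pi>) \<circ> T = id" by (rule ext)+ simp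
  show "T \<circ> (\<lambda>p. p \<circ> \<pi>) = id"
    using bij by (auto simp: fun_eq_iff relabel_def bij_is_surj surj_f_inv_f)
qed

lemma inj_T: "inj T" and surj_T: "surj T"
  using bij_T by (auto simp: bij_def)

lemma supp_T: "supp (T p) = \<pi> ` supp p"
proof
  show "supp (T p) \<subseteq> \<pi> ` supp p"
  proof
    fix w assume "w \<in> supp (T p)"
    moreover have "w = \<pi> (inv \<pi> w)" using bij by (simp add: bij_is_surj surj_f_inv_f)
    ultimately show "w \<in> \<pi> ` supp p" by (metis (mono_tags, lifting) T_apply image_eqI mem_Collect_eq)
  qed
qed auto

lemma inj_img [simp]: "\<pi> ` A \<subseteq> \<pi> ` B \<longleftrightarrow> A \<subseteq> B"
  using bij by (simp add: bij_is_inj inj_image_subset_iff)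

lemma inj_img_eq [simp]: "\<pi> ` A = \<pi> ` B \<longleftrightarrow> A = B"
  using bij by (simp add: bij_is_inj inj_image_eq_iff)

lemma on_common_edge_T: "on_common_edge E' (T p) (T q) \<longleftrightarrow> on_common_edge E p q"
  by (simp add: on_common_edge_def supp_T)

lemma sum_T: "(\<Sum>w\<in>V'. f w) = (\<Sum>w\<in>V. f (\<pi> w))" for f :: "'a \<Rightarrow> real"
  using bij by (simp add: sum.reindex bij_is_inj inj_on_subset[OF _ subset_UNIV])

lemma seg_length_T: "seg_length V' (T p) (T q) = seg_length V p q"
  by (simp add: seg_length_def sum_T)

lemma points_T: "T p \<in> graph_points V' E' \<longleftrightarrow> p \<in> graph_points V E"
proof -
  have "(\<forall>w. 0 \<le> T p w) \<longleftrightarrow> (\<forall>w. 0 \<le> p w)"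
    by (metis T_apply bij bij_is_surj surj_f_inv_f)
  moreover have "supp (T p) \<in> E' \<union> {{v} | v. v \<in> V'} \<longleftrightarrow> supp p \<in> E \<union> {{v} | v. v \<in> V}"
  proof -
    have "{{v} | v. v \<in> V'} = (`) \<pi> ` {{v} | v. v \<in> V}" by auto
    then have "E' \<union> {{v} | v. v \<in> V'} = (`) \<pi> ` (E \<union> {{v} | v. v \<in> V})" by (simp only: image_Un)
    moreover have "inj ((`) \<pi>)" by (rule injI) simp
    ultimately show ?thesis by (simp only: supp_T inj_image_mem_iff)
  qed
  ultimately show ?thesis by (simp add: graph_points_def sum_T)
qed

lemma path_between_T:
  "path_between V' E' (T p) (T q) (map T ps) \<longleftrightarrow> path_between V E p q ps"
proof -
  have "ps \<noteq> [] \<Longrightarrow> hd (map T ps) = T p \<longleftrightarrow> hd ps = p" "ps \<noteq> [] \<Longrightarrow> last (map T ps) = T q \<longleftrightarrow> last ps = q"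
    using inj_T by (simp_all add: hd_map last_map inj_eq)
  then show ?thesis
    by (auto simp: path_between_def successively_map on_common_edge_T points_T subset_iff)
qed

lemma path_length_T: "path_length V' (map T ps) = path_length V ps"
  by (simp add: path_length_def seg_length_T)

lemma graph_dist_T: "graph_dist V' E' (T p) (T q) = graph_dist V E p q"
proof -
  have "\<exists>qs. ps = map T qs" for ps using surj_T by (metis ex_map_conv surjD)
  then have "{path_length V' ps | ps. path_between V' E' (T p) (T q) ps} =
        {path_length V ps | ps. path_between V E p q ps}"
    by (metis (no_types, opaque_lifting) path_between_T path_length_T)
  then show ?thesis by (simp add: graph_dist_def)
qed

lemma is_geodesic_T:
  "is_geodesic V E x y S \<Longrightarrow> is_geodesic V' E' (T x) (T y) (T ` S)"
proof -
  assume "is_geodesic V E x y S"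
  then obtain \<gamma> where g: "\<gamma> 0 = x" "\<gamma> (graph_dist V E x y) = y"
    "\<gamma> ` {0..graph_dist V E x y} \<subseteq> graph_points V E"
    "\<forall>s\<in>{0..graph_dist V E x y}. \<forall>t\<in>{0..graph_dist V E x y}. graph_dist V E (\<gamma> s) (\<gamma> t) = \<bar>s - t\<bar>"
    "S = \<gamma> ` {0..graph_dist V E x y}"
    unfolding is_geodesic_def Let_def by auto
  show ?thesis
    unfolding is_geodesic_def Let_def graph_dist_T
    by (rule exI[of _ "T \<circ> \<gamma>"]) (use g in \<open>auto simp: graph_dist_T points_T\<close>)
qed

lemma triangle_T:
  "geodesic_triangle V E A B C \<Longrightarrow> geodesic_triangle V' E' (T ` A) (T ` B) (T ` C)"
  unfolding geodesic_triangle_def using is_geodesic_T points_T by meson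

lemma neighbourhood_T: "neighbourhood V' E' r (T ` S) = T ` neighbourhood V E r S"
proof
  show "neighbourhood V' E' r (T ` S) \<subseteq> T ` neighbourhood V E r S"
  proof
    fix p assume p: "p \<in> neighbourhood V' E' r (T ` S)"
    obtain q where q: "p = T q" using surj_T by (metis surjD)
    show "p \<in> T ` neighbourhood V E r S"
      using p unfolding q by (auto simp: neighbourhood_def points_T graph_dist_T)
  qed
qed (auto simp: neighbourhood_def points_T graph_dist_T)

lemma triangle_delta_T:
  "triangle_delta V' E' (T ` A) (T ` B) (T ` C) = triangle_delta V E A B C"
  unfolding triangle_delta_def image_Un[symmetric] neighbourhood_T
  by (simp add: inj_image_subset_iff[OF inj_T])

lemma deltas_T: "{triangle_delta V E A B C | A B C. geodesic_triangle V E A B C} \<subseteq>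
    {triangle_delta V' E' A B C | A B C. geodesic_triangle V' E' A B C}"
  using triangle_T triangle_delta_T by (smt (verit, best) Collect_mono_iff)

end

text \<open>\<open>deltas_T\<close> gives one inclusion; the other is the same statement for
  \<open>inv \<pi>\<close>.\<close>

lemma hyperbolicity_relabel:
  fixes \<pi> :: "'a \<Rightarrow> 'a"
  assumes "bij \<pi>" shows "hyperbolicity (\<pi> ` V) ((`) \<pi> ` E) = hyperbolicity V E"
proof -
  interpret A: relabelling \<pi> V E by unfold_locales (rule assms)
  interpret B: relabelling "inv \<pi>" "\<pi> ` V" "(`) \<pi> ` E" by unfold_locales (simp add: assms bij_imp_bij_inv)
  have "inv \<pi> ` \<pi> ` V = V" "(`) (inv \<pi>) ` (`) \<pi> ` E = E"
    using assms by (auto simp: image_image bij_is_inj image_inv_f_f)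
  then show ?thesis using A.deltas_T B.deltas_T unfolding hyperbolicity_def
    by (intro arg_cong[where f = Sup] equalityI) simp_all
qed

text \<open>\<open>relabelling\<close> asks for a bijection of the whole type. The complements of
  \<open>A\<close> and \<open>B\<close> in their union have equal size, so a bijection from
  \<open>A\<close> to \<open>B\<close> extends to a permutation that fixes everything else.\<close>

lemma finite_bij_extend:
  assumes "finite A" "finite B" "card A = card B"
  obtains \<pi> :: "'a \<Rightarrow> 'a" where "bij \<pi>" "\<pi> ` A = B"
proof -
  let ?S = "A \<union> B"
  obtain f where f: "bij_betw f A B" using finite_same_card_bij assms by blast
  have "card (?S - A) = card (?S - B)"
    using assms card_Diff_subset[of A ?S] card_Diff_subset[of B ?S] by simp
  then obtain g where g: "bij_betw g (?S - A) (?S - B)"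
    using finite_same_card_bij[of "?S - A" "?S - B"] assms(1,2) by auto
  define \<pi> where "\<pi> x = (if x \<in> A then f x else if x \<in> ?S then g x else x)" for x
  have "bij_betw \<pi> A B" using f bij_betw_cong[of A \<pi> f B] by (simp add: \<pi>_def)
  moreover have "bij_betw \<pi> (?S - A) (?S - B)"
    by (rule bij_betw_cong[THEN iffD2, OF _ g]) (auto simp: \<pi>_def)
  moreover have "bij_betw \<pi> (- ?S) (- ?S)"
    using bij_betw_id[of "- ?S"] bij_betw_cong[of "- ?S" \<pi> id "- ?S"] by (simp add: \<pi>_def)
  ultimately have "bij_betw \<pi> (A \<union> (?S - A) \<union> - ?S) (B \<union> (?S - B) \<union> - ?S)"
    by (intro bij_betw_combine) auto
  moreover have "A \<union> (?S - A) \<union> - ?S = UNIV" "B \<union> (?S - B) \<union> - ?S = UNIV" by auto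
  ultimately have "bij \<pi>" by simp
  moreover have "\<pi> ` A = B" using \<open>bij_betw \<pi> A B\<close> by (simp add: bij_betw_def)
  ultimately show ?thesis using that by blast
qed

text \<open>A connected graph with \<open>m\<close> edges has at most \<open>m + 1\<close> vertices,
  so after relabelling every value occurs for one of the finitely many graphs within
  \<open>{..m}\<close>.\<close>

lemma finite_hyperbolicities:
  assumes "0 < m" shows "finite {r. \<exists>(V, E)\<in>graph_class g c m. r = hyperbolicity V E}"
proof -
  have "{r. \<exists>(V, E)\<in>graph_class g c m. r = hyperbolicity V E} \<subseteq>
      (\<lambda>(V, E). hyperbolicity V E) ` (Pow {..m} \<times> Pow (Pow {..m}))"
  proof
    fix r assume "r \<in> {r. \<exists>(V, E)\<in>graph_class g c m. r = hyperbolicity V E}"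
    then obtain V E where VE: "(V, E) \<in> graph_class g c m" "r = hyperbolicity V E" by auto
    interpret fgraph V E using graph_class_fgraph VE assms by blast
    have cE: "card E = m" using VE by (simp add: graph_class_def)
    then have "card V \<le> m + 1" using card_vertices card_ge_0_finite[of E] assms by simp
    moreover obtain \<pi> where p: "bij \<pi>" "\<pi> ` V = {..<card V}"
      using finite_bij_extend[of V "{..<card V}"] by auto
    ultimately have "\<pi> ` V \<subseteq> {..m}" by auto
    moreover from this have "(`) \<pi> ` E \<subseteq> Pow {..m}" using edge_subset by blast
    moreover have "r = hyperbolicity (\<pi> ` V) ((`) \<pi> ` E)" using VE hyperbolicity_relabel p by metis
    ultimately show "r \<in> (\<lambda>(V, E). hyperbolicity V E) ` (Pow {..m} \<times> Pow (Pow {..m}))"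
      by (intro image_eqI[of _ _ "(\<pi> ` V, (`) \<pi> ` E)"]) auto
  qed
  then show ?thesis by (rule finite_subset) auto
qed

text \<open>\<open>LEAST\<close> on the reals is meaningful only where a smallest value exists; here
  it is the \<open>Min\<close> of a finite set.\<close>

lemma alpha_attained:
  assumes "0 < m" "graph_class g c m \<noteq> {}"
  shows "\<exists>(V, E)\<in>graph_class g c m. alpha g c m = hyperbolicity V E"
    and "\<And>V E. (V, E) \<in> graph_class g c m \<Longrightarrow> alpha g c m \<le> hyperbolicity V E"
proof -
  let ?R = "{r. \<exists>(V, E)\<in>graph_class g c m. r = hyperbolicity V E}"
  have fin: "finite ?R" using finite_hyperbolicities assms by blast
  have ne: "?R \<noteq> {}" using assms by auto
  have a: "alpha g c m = Min ?R" unfolding alpha_def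
    using Min_in[OF fin ne] Min_le[OF fin] by (intro Least_equality) auto
  show "\<exists>(V, E)\<in>graph_class g c m. alpha g c m = hyperbolicity V E"
    using Min_in[OF fin ne] unfolding a by simp
  show "alpha g c m \<le> hyperbolicity V E" if "(V, E) \<in> graph_class g c m" for V E
    unfolding a by (rule Min_le[OF fin]) (use that in auto)
qed

lemma alpha_beta_const:
  assumes "graph_class g c m \<noteq> {}" "\<And>V E. (V, E) \<in> graph_class g c m \<Longrightarrow> hyperbolicity V E = r"
  shows "alpha g c m = r" "beta g c m = r"
proof -
  have "(\<exists>(V, E)\<in>graph_class g c m. x = hyperbolicity V E) \<longleftrightarrow> x = r" for x
    using assms by fast
  then show "alpha g c m = r" "beta g c m = r"
    unfolding alpha_def beta_def by (auto intro: Least_equality Greatest_equality)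
qed

section \<open>Separators\<close>

context fgraph
begin

lemma near_vertex:
  assumes "p \<in> P" obtains a where "a \<in> supp p" "a \<in> V" "ce p (vp a)" "d p (vp a) \<le> 1/2"
proof -
  obtain e where e: "e \<in> E" "supp p \<subseteq> e" using point_edge assms by blast
  then obtain a b where ab: "e = {a, b}" "a \<in> V" "b \<in> V" using edgeE by metis
  have "p a + p b = 1" using point_sum_edge[of p a b] assms e ab by simp
  then have "1/2 \<le> p a \<or> 1/2 \<le> p b" by linarith
  moreover have "ce p (vp a)" "ce p (vp b)" using e ab by (auto simp: ce_vertex)
  ultimately show ?thesis
    using that[of a] that[of b] d_vertex_ce[of p a] d_vertex_ce[of p b] assms ab by auto
qed

lemma vertices_d_le_1: "a \<in> V \<Longrightarrow> b \<in> V \<Longrightarrow> a = b \<or> {a, b} \<in> E \<Longrightarrow> d (vp a) (vp b) \<le> 1"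
  using d_vertices dv_edge by auto

lemma dominating_d:
  assumes "r \<in> V" "\<And>v. v \<in> V \<Longrightarrow> v \<noteq> r \<Longrightarrow> {r, v} \<in> E" "p \<in> P"
  shows "d p (vp r) \<le> 3/2"
proof -
  obtain a where a: "a \<in> V" "d p (vp a) \<le> 1/2" using near_vertex assms(3) by metis
  have "d (vp a) (vp r) \<le> 1" using vertices_d_le_1[of a r] assms(1,2) a by (auto simp: insert_commute)
  then show ?thesis using d_triangle[of p "vp a" "vp r"] a assms by simp
qed

text \<open>The diameter is at most 3, so every point of a geodesic is within 3/2 of one of its
  ends, and the ends are break points of every path.\<close>

lemma bottleneck_dominating:
  assumes "r \<in> V" "\<And>v. v \<in> V \<Longrightarrow> v \<noteq> r \<Longrightarrow> {r, v} \<in> E"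
  shows "bottleneck (3/2)"
proof (rule bottleneckI)
  fix x y p ps assume *: "x \<in> P" "y \<in> P" "p \<in> P" "d x p + d p y = d x y" "path_between V E x y ps"
    "\<And>q. q \<in> set ps \<Longrightarrow> 3/2 < d p q"
  have "3/2 < d p x" "3/2 < d p y" using *(5,6) by (auto simp: path_between_def)
  moreover have "d x y \<le> 3"
    using dominating_d[OF assms *(1)] dominating_d[OF assms *(2)] d_triangle[of x "vp r" y] d_sym[of y "vp r"] * assms(1)
    by simp
  ultimately show False using *(4) d_sym[of x p] * by simp
qed

text \<open>As long as no break point lies in \<open>R\<close>, the edges used lie in
  \<open>L\<close>; hence the first break point in \<open>R\<close> lies in both.\<close>

lemma path_separator:
  assumes "\<And>e. e \<in> E \<Longrightarrow> e \<subseteq> L \<or> e \<subseteq> R" "path_between V E x y ps" "supp x \<subseteq> L" "supp y \<subseteq> R"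
  shows "\<exists>q\<in>set ps. supp q \<subseteq> L \<inter> R"
  using assms(2,3)
proof (induction ps arbitrary: x rule: induct_list012)
  case (3 a b ps)
  then have b: "path_between V E b y (b # ps)" "x = a" "ce a b" by (auto simp: path_between_def)
  obtain e where e: "e \<in> E" "supp a \<subseteq> e" "supp b \<subseteq> e" using b by (auto simp: ce_edge)
  show ?case
  proof (cases "supp a \<subseteq> R")
    case False
    then have "supp b \<subseteq> L" using assms(1)[OF e(1)] e by blast
    then show ?thesis using 3(2)[OF b(1)] by auto
  qed (use 3 b in auto)
qed (use assms(4) in \<open>auto simp: path_between_def\<close>)

lemma dv_separator:
  assumes LR: "\<And>e. e \<in> E \<Longrightarrow> e \<subseteq> L \<or> e \<subseteq> R" and "(a, b) \<in> adjrel E ^^ n" "a \<in> L" "b \<in> R"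
  shows "\<exists>s\<in>L \<inter> R. \<exists>i j. i + j = n \<and> (a, s) \<in> adjrel E ^^ i \<and> (s, b) \<in> adjrel E ^^ j"
  using assms(2,3)
proof (induction n arbitrary: a)
  case 0
  then have "a \<in> L \<inter> R" using assms(4) by auto
  then show ?case using 0 by (intro bexI[of _ a] exI[of _ 0]) auto
next
  case (Suc n)
  show ?case
  proof (cases "a \<in> R")
    case True
    then show ?thesis using Suc by (intro bexI[of _ a] exI[of _ 0] exI[of _ "Suc n"]) auto
  next
    case False
    obtain a' where a': "{a, a'} \<in> E" "(a', b) \<in> adjrel E ^^ n" using Suc.prems(1) relpow_Suc_D2 by (metis adjrel_iff)
    then have "a' \<in> L" using LR[OF a'(1)] False by auto
    then obtain s i j where "s \<in> L \<inter> R" "i + j = n" "(a', s) \<in> adjrel E ^^ i" "(s, b) \<in> adjrel E ^^ j"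
      using Suc.IH a' by blast
    then show ?thesis using a' relpow_Suc_I2[of a a' "adjrel E" s i]
      by (intro bexI[of _ s] exI[of _ "Suc i"] exI[of _ j]) auto
  qed
qed

text \<open>A shortest vertex route from one part to the other meets the common part in a vertex.
  The second alternative is needed for two points on an edge inside the common part, which may have
  no vertex between them.\<close>

lemma separator:
  assumes LR: "\<And>e. e \<in> E \<Longrightarrow> e \<subseteq> L \<or> e \<subseteq> R" and pq: "p \<in> P" "q \<in> P" "supp p \<subseteq> L" "supp q \<subseteq> R"
  shows "(\<exists>s\<in>L \<inter> R \<inter> V. d p q = d p (vp s) + d (vp s) q) \<or> (\<exists>e\<in>E. supp p \<union> supp q \<subseteq> e \<and> e \<subseteq> L \<inter> R)"
proof -
  have vp: "\<exists>s. r = vp s \<and> s \<in> V" if r: "r \<in> P" "supp r \<notin> E" for r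
  proof -
    obtain s where "supp r = {s}" "s \<in> V" using point_supp[OF r(1)] r(2) by auto
    then show ?thesis using point_supp_single[of r s] r by auto
  qed
  have triv: "?thesis" if "p = vp s \<or> q = vp s" "s \<in> L \<inter> R \<inter> V" for s
    using that pq by (intro disjI1 bexI[of _ s]) auto
  show ?thesis
    using pq(1,2)
  proof (cases rule: d_cases)
    case 1
    then obtain e where e: "e \<in> E" "supp p \<subseteq> e" "supp q \<subseteq> e" by (auto simp: ce_edge)
    consider "supp q \<in> E" "e \<subseteq> L" | "supp p \<in> E" "e \<subseteq> R" | s where "q = vp s" "e \<subseteq> L" "s \<in> V" | s where "p = vp s" "e \<subseteq> R" "s \<in> V"
      using LR[OF e(1)] vp pq by metis
    then show ?thesis
    proof cases
      case 1
      then have "supp q = e" using edge_eqI[of "supp q" e] e by simp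
      then have "e \<subseteq> L \<inter> R" using 1 pq(4) by simp
      then show ?thesis using e by (intro disjI2 bexI[of _ e]) simp_all
    next
      case 2
      then have "supp p = e" using edge_eqI[of "supp p" e] e by simp
      then have "e \<subseteq> L \<inter> R" using 2 pq(3) by simp
      then show ?thesis using e by (intro disjI2 bexI[of _ e]) simp_all
    next
      case 3
      then show ?thesis using triv[of s] e pq by auto
    next
      case 4
      then show ?thesis using triv[of s] e pq by auto
    qed
  next
    case (2 a b)
    obtain e where e: "e \<in> E" "supp p \<subseteq> e" "a \<in> e" using 2 by (auto simp: ce_vertex)
    obtain f where f: "f \<in> E" "supp q \<subseteq> f" "b \<in> f" using 2 by (auto simp: ce_vertex)
    have aL: "a \<in> L \<or> (\<exists>s. p = vp s \<and> s \<in> L \<inter> R \<inter> V)"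
    proof (cases "e \<subseteq> L")
      case False
      then have "e \<subseteq> R" using LR e by blast
      show ?thesis
      proof (cases "supp p \<in> E")
        case True
        then have "supp p = e" using edge_eqI e by blast
        then show ?thesis using e pq by blast
      next
        case False
        then obtain s where "p = vp s" "s \<in> V" using vp pq by blast
        then show ?thesis using e pq \<open>e \<subseteq> R\<close> by auto
      qed
    qed (use e in auto)
    have bR: "b \<in> R \<or> (\<exists>s. q = vp s \<and> s \<in> L \<inter> R \<inter> V)"
    proof (cases "f \<subseteq> R")
      case False
      then have "f \<subseteq> L" using LR f by blast
      show ?thesis
      proof (cases "supp q \<in> E")
        case True
        then have "supp q = f" using edge_eqI f by blast
        then show ?thesis using f pq by blast
      next
        case False
        then obtain s where "q = vp s" "s \<in> V" using vp pq by blast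
        then show ?thesis using f pq \<open>f \<subseteq> L\<close> by auto
      qed
    qed (use f in auto)
    show ?thesis
    proof (cases "a \<in> L \<and> b \<in> R")
      case True
      obtain s i j where s: "s \<in> L \<inter> R" "i + j = dv a b" "(a, s) \<in> adjrel E ^^ i" "(s, b) \<in> adjrel E ^^ j"
        using dv_separator[OF LR dv_relpow[OF 2(1,2)]] True by metis
      have "s \<in> V"
      proof (cases i)
        case 0
        then show ?thesis using s 2 by simp
      next
        case (Suc n)
        then show ?thesis using s edgeD by auto
      qed
      then have "d p (vp s) \<le> d p (vp a) + i" "d (vp s) q \<le> j + d (vp b) q"
        using d_triangle[of p "vp a" "vp s"] d_triangle[of "vp s" "vp b" q] d_vertices[of a s] d_vertices[of s b]
          dv_le s 2 pq by fastforce+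
      then have "d p q = d p (vp s) + d (vp s) q"
        using d_triangle[of p "vp s" q] 2 d_vertices s(2) \<open>s \<in> V\<close> pq by simp
      then show ?thesis using s \<open>s \<in> V\<close> by blast
    qed (use aL bR triv in blast)
  qed
qed

text \<open>From \<open>p\<close> the ends \<open>x\<close> and \<open>y\<close> are reached through
  vertices \<open>s\<close> and \<open>t\<close> of the separating edge, and then \<open>p\<close>
  lies metrically between \<open>s\<close> and \<open>t\<close>. These are equal or adjacent, which
  leaves only points of the edge.\<close>

lemma edge_separator_convex:
  assumes LR: "\<And>e. e \<in> E \<Longrightarrow> e \<subseteq> L \<or> e \<subseteq> R" "L \<inter> R = {u, v}" "{u, v} \<in> E"
    and P: "x \<in> P" "y \<in> P" "p \<in> P" "supp x \<subseteq> R" "supp y \<subseteq> R" "supp p \<subseteq> L"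
    and eq: "d x p + d p y = d x y"
  shows "supp p \<subseteq> {u, v}"
proof (rule ccontr)
  assume np: "\<not> supp p \<subseteq> {u, v}"
  note uv = edgeD[OF LR(3)]
  have sep: "\<exists>s\<in>{u, v}. d p z = d p (vp s) + d (vp s) z" if "z \<in> P" "supp z \<subseteq> R" for z
    using separator[OF LR(1) P(3) that(1) P(6) that(2)] np LR(2) by blast
  obtain s where s: "s \<in> {u, v}" "d p x = d p (vp s) + d (vp s) x" using sep P by blast
  obtain t where t: "t \<in> {u, v}" "d p y = d p (vp t) + d (vp t) y" using sep P by blast
  have V: "s \<in> V" "t \<in> V" using s t uv by auto
  have "d x y \<le> d (vp s) x + d (vp s) (vp t) + d (vp t) y"
    using d_triangle[of x "vp s" y] d_triangle[of "vp s" "vp t" y] d_sym[of x "vp s"] P V by simp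
  then have le: "d p (vp s) + d p (vp t) \<le> d (vp s) (vp t)" using s t eq d_sym[of x p] P by simp
  show False
  proof (cases "s = t")
    case True
    then have "d p (vp s) \<le> 0" using le V by simp
    then have "p = vp s" using d_eq_0 P V by simp
    then show False using np s by auto
  next
    case False
    then have "d (vp s) (vp t) = 1" using s t d_vertices dv_edge LR(3) V by (auto simp: insert_commute)
    then have "d p (vp u) + d p (vp v) \<le> 1" using le s t False by auto
    then have ge: "1 \<le> p u + p v" using d_vertex_ge[OF P(3), of u] d_vertex_ge[OF P(3), of v] uv by simp
    obtain w where w: "w \<in> supp p" "w \<noteq> u" "w \<noteq> v" using np by blast
    have "p u + p v + p w = (\<Sum>z\<in>{u, v, w}. p z)" using uv w by simp
    also have "\<dots> \<le> (\<Sum>z\<in>V. p z)"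
      by (rule sum_mono2) (use uv w point_supp_subset[OF P(3)] point_nonneg[OF P(3)] in auto)
    finally have "p u + p v + p w \<le> 1" using point_sum[OF P(3)] by simp
    then show False using ge w point_nonneg[OF P(3), of w] by auto
  qed
qed

text \<open>Two ends beyond the edge contradict its convexity, and for two ends in \<open>Z\<close>
  the diameter of \<open>Z\<close> suffices. In the mixed case the end in \<open>Z\<close> is at
  most \<open>1 + g / 2\<close> away from the vertex where the geodesic crosses the edge, and at
  least \<open>(g - h) / 2\<close> of this lies behind \<open>p\<close>.\<close>

lemma cell_near_end:
  assumes LR: "\<And>e. e \<in> E \<Longrightarrow> e \<subseteq> L \<or> e \<subseteq> R" "L \<inter> R = {u, v}" "{u, v} \<in> E"
    and Z: "\<And>z z'. z \<in> Z \<Longrightarrow> z' \<in> Z \<Longrightarrow> d z z' \<le> 1 + g / 2" "vp u \<in> Z" "vp v \<in> Z"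
    and P: "x \<in> P" "y \<in> P" "p \<in> P" "supp p \<subseteq> L" "\<not> supp p \<subseteq> {u, v}" "x \<in> Z \<or> supp x \<subseteq> R" "y \<in> Z \<or> supp y \<subseteq> R"
    and eq: "d x p + d p y = d x y"
    and far: "(g - h) / 2 \<le> d p (vp u)" "(g - h) / 2 \<le> d p (vp v)" and gh: "g \<le> 2 * h"
  shows "d p x \<le> 1 + h / 2 \<or> d p y \<le> 1 + h / 2"
proof -
  have mixed: "d p a \<le> 1 + h / 2" if ab: "a \<in> P" "b \<in> P" "d a p + d p b = d a b" "a \<in> Z" "supp b \<subseteq> R" for a b
  proof -
    obtain s where s: "s \<in> {u, v}" "d p b = d p (vp s) + d (vp s) b"
      using separator[OF LR(1) P(3) ab(2) P(4) ab(5)] P(5) LR(2) by blast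
    have "s \<in> V" using s edgeD[OF LR(3)] by auto
    then have "d a b \<le> d a (vp s) + d (vp s) b" using d_triangle ab by simp
    moreover have "d a (vp s) \<le> 1 + g / 2" "(g - h) / 2 \<le> d p (vp s)" using Z far ab s by auto
    ultimately have "d a p \<le> 1 + g / 2 - (g - h) / 2" using ab(3) s by linarith
    moreover have "1 + g / 2 - (g - h) / 2 = 1 + h / 2" by (simp add: field_simps)
    ultimately show ?thesis using d_sym[of a p] ab P by simp
  qed
  consider "supp x \<subseteq> R" "supp y \<subseteq> R" | "x \<in> Z" "y \<in> Z" | "x \<in> Z" "supp y \<subseteq> R" | "y \<in> Z" "supp x \<subseteq> R"
    using P by blast
  then show ?thesis
  proof cases
    case 1
    then show ?thesis using edge_separator_convex[OF LR P(1-3) _ _ P(4) eq] P(5) by blast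
  next
    case 2
    then have "d p x + d p y \<le> 1 + g / 2" using Z(1) eq d_sym[of x p] P by fastforce
    then show ?thesis using gh by linarith
  next
    case 3
    then show ?thesis using mixed[of x y] P eq by blast
  next
    case 4
    then show ?thesis using mixed[of y x] P eq d_sym[of x p] d_sym[of y p] d_sym[of y x] by simp
  qed
qed

text \<open>Points of the complete part are at most 2 apart, so an end is within 1 of
  \<open>p\<close>. If \<open>x\<close> is on a pendant edge, \<open>r\<close> is a cut vertex: the
  path meets it, so \<open>p\<close> is more than 1 away from \<open>r\<close>, and the geodesic
  passes \<open>r\<close> before \<open>p\<close>. Then \<open>y\<close> is more than 2 away from
  \<open>r\<close>, although \<open>r\<close> dominates the graph.\<close>

lemma bottleneck_pendants:
  assumes K: "K \<subseteq> V" "r \<in> K" "\<And>a b. a \<in> K \<Longrightarrow> b \<in> K \<Longrightarrow> a \<noteq> b \<Longrightarrow> {a, b} \<in> E"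
    and pend: "\<And>e. e \<in> E \<Longrightarrow> e \<subseteq> K \<or> (\<exists>v. v \<notin> K \<and> e = {r, v})"
  shows "bottleneck 1"
proof (rule bottleneckI)
  fix x y p ps assume *: "x \<in> P" "y \<in> P" "p \<in> P" "d x p + d p y = d x y" "path_between V E x y ps"
    "\<And>q. q \<in> set ps \<Longrightarrow> 1 < d p q"
  have far: "1 < d p x" "1 < d p y" using *(5,6) by (auto simp: path_between_def)
  have rV: "r \<in> V" using K by blast
  have dom: "{r, v} \<in> E" if "v \<in> V" "v \<noteq> r" for v
  proof (cases "v \<in> K")
    case False
    obtain e where "e \<in> E" "v \<in> e" using vertex_in_edge \<open>v \<in> V\<close> by blast
    then show ?thesis using pend[of e] False that by auto
  qed (use K that in auto)
  have diam: "\<not> (supp x \<subseteq> K \<and> supp y \<subseteq> K)"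
  proof
    assume s: "supp x \<subseteq> K \<and> supp y \<subseteq> K"
    obtain a where a: "a \<in> supp x" "a \<in> V" "d x (vp a) \<le> 1/2" using near_vertex[OF *(1)] by metis
    obtain b where b: "b \<in> supp y" "b \<in> V" "d y (vp b) \<le> 1/2" using near_vertex[OF *(2)] by metis
    have "d (vp a) (vp b) \<le> 1" using vertices_d_le_1 K(3)[of a b] a b s by blast
    then have "d x y \<le> 2"
      using a b d_triangle[of x "vp a" y] d_triangle[of "vp a" "vp b" y] d_sym[of y "vp b"] * by simp
    then show False using far *(4) d_sym[of x p] * by simp
  qed
  have main: False if xy: "x \<in> P" "y \<in> P" "d x p + d p y = d x y" "path_between V E x y ps"
    "\<And>q. q \<in> set ps \<Longrightarrow> 1 < d p q" "\<not> supp x \<subseteq> K" for x y ps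
  proof -
    have far: "1 < d p x" "1 < d p y" using xy by (auto simp: path_between_def)
    obtain v where v: "x v \<noteq> 0" "v \<notin> K" using xy by auto
    have ev: "e = {r, v}" if "e \<in> E" "v \<in> e" for e using pend[OF that(1)] that(2) v K(2) by blast
    have on: "supp z \<subseteq> {r, v}" if z: "z \<in> P" "z v \<noteq> 0" for z
    proof -
      obtain e where "e \<in> E" "supp z \<subseteq> e" using point_edge z by blast
      then show ?thesis using ev z(2) by auto
    qed
    have "v \<in> V" using v point_supp_subset[OF xy(1)] by auto
    then have rvE: "{r, v} \<in> E" using dom v K(2) by metis
    define L where "L = {r, v}"
    define R where "R = V - {v}"
    have LR: "\<And>e. e \<in> E \<Longrightarrow> e \<subseteq> L \<or> e \<subseteq> R" using ev edge_subset unfolding L_def R_def by blast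
    have LRi: "L \<inter> R = {r}" using v K rV by (auto simp: L_def R_def)
    have yR: "supp y \<subseteq> R"
    proof (rule ccontr)
      assume "\<not> supp y \<subseteq> R"
      then have "y v \<noteq> 0" using point_supp_subset[OF xy(2)] by (auto simp: R_def)
      then have "supp y \<subseteq> {r, v}" "supp x \<subseteq> {r, v}" using on[OF xy(1)] on[OF xy(2)] v by simp_all
      then have "ce x y" using rvE ce_edge by blast
      then have "d x y \<le> 1" using d_ce sg_le_1 xy by simp
      then show False using far xy(3) d_sym[of x p] xy * by simp
    qed
    have xL: "supp x \<subseteq> L" using on xy v by (simp add: L_def)
    obtain q where q: "q \<in> set ps" "supp q \<subseteq> {r}" using path_separator[OF LR xy(4) xL yR] LRi by auto
    moreover have "q \<in> P" using q xy(4) by (auto simp: path_between_def)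
    ultimately have "q = vp r" using point_supp_single by blast
    then have pr: "1 < d p (vp r)" using xy(5) q by blast
    have "supp p \<subseteq> R"
    proof (rule ccontr)
      assume "\<not> supp p \<subseteq> R"
      then have "p v \<noteq> 0" using point_supp_subset[OF *(3)] by (auto simp: R_def)
      then have "supp p \<subseteq> {r, v}" using on[OF *(3)] by simp
      then have "ce p (vp r)" using rvE ce_vertex by blast
      then have "d p (vp r) \<le> 1" using d_ce sg_le_1 * rV by simp
      then show False using pr by simp
    qed
    then have "(\<exists>s\<in>{r} \<inter> V. d x p = d x (vp s) + d (vp s) p) \<or> (\<exists>e\<in>E. supp x \<union> supp p \<subseteq> e \<and> e \<subseteq> {r})"
      using separator[OF LR xy(1) *(3) xL] unfolding LRi by blast
    moreover have "\<not> e \<subseteq> {r}" if "e \<in> E" for e using edgeE[OF that] by (metis insert_subset singletonD)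
    ultimately have "d x p = d x (vp r) + d (vp r) p" by blast
    then have "d (vp r) p + d p y \<le> d (vp r) y" using xy(3) d_triangle[of x "vp r" y] xy rV by simp
    moreover have "d (vp r) y \<le> 3/2" using dominating_d[OF rV dom xy(2)] d_sym[of y "vp r"] xy rV by simp
    ultimately show False using pr far d_sym[of p "vp r"] * rV by simp
  qed
  show False
  proof (cases "supp x \<subseteq> K")
    case False
    then show ?thesis using main[of x y ps] * by blast
  next
    case True
    then have "\<not> supp y \<subseteq> K" using diam by blast
    moreover have "d y p + d p x = d y x" using * d_sym[of x p] d_sym[of y p] d_sym[of x y] by simp
    ultimately show ?thesis using main[of y x "rev ps"] * path_between_rev[OF *(5)] by simp
  qed
qed

end

section \<open>Ladders\<close>

lemma is_cycle_mapI:
  assumes "3 \<le> n" "inj_on w {..<n}" "\<And>i. Suc i < n \<Longrightarrow> {w i, w (Suc i)} \<in> E" "{w (n - 1), w 0} \<in> E"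
  shows "is_cycle E (map w [0..<n])"
proof -
  have "last (map w [0..<n]) = w (n - 1)" "hd (map w [0..<n]) = w 0" using assms(1) by (simp_all add: last_map hd_map)
  moreover have "walk E (map w [0..<n])" using assms(3) by (auto simp: successively_conv_nth simp del: upt_Suc)
  ultimately show ?thesis using assms by (auto simp: is_cycle_def distinct_map atLeast0LessThan)
qed

text \<open>The square of the path \<open>0, ..., c - 1\<close> with only the path edges \<open>{s, s + 1}\<close>, \<open>s \<in> S\<close>, kept. The even
  and the odd vertices are the two rails of a ladder and the path edges are its rungs, so every
  \<open>{s, s + 1}\<close> separates the graph, and the cell between consecutive rungs \<open>s < t\<close> is a cycle of
  length \<open>t - s + 2\<close>.\<close>

locale strip =
  fixes c h :: nat and S :: "nat set"
  assumes c4: "4 \<le> c" and h1: "1 \<le> h" and S: "S \<subseteq> {..c - 2}" "0 \<in> S" "1 \<in> S" "c - 2 \<in> S"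
    and gap: "\<And>s. s \<in> S \<Longrightarrow> s < c - 2 \<Longrightarrow> \<exists>t\<in>S. s < t \<and> t \<le> s + 2 * h"
begin

definition SV :: "nat set" where "SV = {..<c}"
definition SE :: "nat set set" where
  "SE = (\<lambda>n. {n, n + 2}) ` {..<c - 2} \<union> (\<lambda>s. {s, s + 1}) ` S"

lemma rail: "n + 2 < c \<Longrightarrow> {n, n + 2} \<in> SE"
  by (auto simp: SE_def)

lemma rung: "s \<in> S \<Longrightarrow> {s, s + 1} \<in> SE"
  by (auto simp: SE_def)

lemma SE_cases:
  assumes "e \<in> SE"
  obtains n where "n + 2 < c" "e = {n, n + 2}" | s where "s \<in> S" "s + 1 < c" "e = {s, s + 1}"
proof -
  have "s + 1 < c" if "s \<in> S" for s using that S(1) c4 by force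
  moreover have "n + 2 < c" if "n \<in> {..<c - 2}" for n using that by simp
  moreover have "(\<exists>n\<in>{..<c - 2}. e = {n, n + 2}) \<or> (\<exists>s\<in>S. e = {s, s + 1})"
    using assms unfolding SE_def by blast
  ultimately show ?thesis using that by blast
qed

lemma simple_SE: "simple_graph SV SE"
  unfolding simple_graph_def
proof (intro conjI ballI)
  fix e assume "e \<in> SE"
  then show "e \<subseteq> SV" "card e = 2" by (cases rule: SE_cases; auto simp: SV_def)+
qed (simp add: SV_def)

lemma conn_SE: "connected_graph SV SE"
proof -
  let ?r = "{(a, b). {a, b} \<in> SE}"
  have to0: "(v, 0) \<in> ?r\<^sup>*" if "v < c" for v
    using that
  proof (induction v rule: less_induct)
    case (less v)
    consider "v = 0" | "v = 1" | n where "v = n + 2" by (metis One_nat_def add_2_eq_Suc' not0_implies_Suc)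
    then show ?case
    proof cases
      case 2
      then have "(v, 0) \<in> ?r" using rung[OF S(2)] by (simp add: insert_commute)
      then show ?thesis by blast
    next
      case 3
      then have "(v, n) \<in> ?r" using rail[of n] less by (simp add: insert_commute)
      moreover have "(n, 0) \<in> ?r\<^sup>*" using less 3 by simp
      ultimately show ?thesis by (rule converse_rtrancl_into_rtrancl)
    qed simp
  qed
  have "sym ?r" by (auto simp: sym_def insert_commute)
  then have "sym (?r\<^sup>*)" by (rule sym_rtrancl)
  then have "(u, v) \<in> ?r\<^sup>*" if "u < c" "v < c" for u v
    using to0[OF that(1)] to0[OF that(2)] by (meson rtrancl_trans symD)
  moreover have "0 \<in> SV" using c4 by (simp add: SV_def)
  then have "SV \<noteq> {}" by blast
  ultimately show ?thesis by (simp add: connected_graph_def SV_def)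
qed

sublocale fgraph SV SE
  by unfold_locales (use simple_SE conn_SE rung[OF S(2)] in auto)

lemma card_SE: "card SE = c - 2 + card S"
proof -
  have "finite S" using S(1) finite_subset by blast
  moreover have "inj_on (\<lambda>n. {n, n + 2 :: nat}) {..<c - 2}" "inj_on (\<lambda>n. {n, n + 1 :: nat}) S"
    by (auto simp: inj_on_def doubleton_eq_iff)
  moreover have "(\<lambda>n. {n, n + 2}) ` {..<c - 2} \<inter> (\<lambda>s. {s, s + 1}) ` S = {}"
    by (auto simp: doubleton_eq_iff)
  ultimately show ?thesis unfolding SE_def by (simp add: card_Un_disjoint card_image)
qed

lemma girth_SE: "girth SE = 3"
  using girth_3I[of 0 1 2] rung[OF S(2)] rung[OF S(3)] rail[of 0] c4 by (simp add: numeral_2_eq_2)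

lemma circumference_SE: "circumference SE = c"
proof -
  \<comment> \<open>Up the even rail, over the last rung, down the odd rail and back over the rung
    \<open>{0, 1}\<close>: a Hamiltonian cycle that uses only the two outer rungs.\<close>
  define w where "w i = (if 2 * i < c then 2 * i else 2 * (c - 1 - i) + 1)" for i
  have "is_cycle SE (map w [0..<c])"
  proof (rule is_cycle_mapI)
    show "inj_on w {..<c}"
    proof (rule inj_onI)
      fix i j assume "i \<in> {..<c}" "j \<in> {..<c}" "w i = w j"
      then show "i = j" unfolding w_def by (auto split: if_splits) presburger+
    qed
    show "{w (c - 1), w 0} \<in> SE"
    proof -
      have "\<not> 2 * (c - 1) < c" using c4 by linarith
      then show ?thesis using rung[OF S(2)] c4 by (simp add: w_def insert_commute)
    qed
    fix i assume i: "Suc i < c"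
    consider "2 * i + 2 < c" | "2 * i < c" "c \<le> 2 * i + 2" | "c \<le> 2 * i" by linarith
    then show "{w i, w (Suc i)} \<in> SE"
    proof cases
      case 1
      then show ?thesis using rail[of "2 * i"] by (simp add: w_def)
    next
      case 2
      then consider "c = 2 * i + 1" | "c = 2 * i + 2" by linarith
      then show ?thesis
      proof cases
        case 1
        then have "w i = c - 2 + 1" "w (Suc i) = c - 2" using i by (auto simp: w_def)
        then show ?thesis using rung[OF S(4)] by (simp add: insert_commute)
      next
        case 2
        then have "w i = c - 2" "w (Suc i) = c - 2 + 1" using i by (auto simp: w_def)
        then show ?thesis using rung[OF S(4)] by simp
      qed
    next
      case 3
      define n where "n = 2 * (c - 1 - Suc i) + 1"
      have "w i = n + 2" "w (Suc i) = n" "n + 2 < c" using 3 i by (auto simp: w_def n_def)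
      then show ?thesis using rail[of n] by (simp add: insert_commute)
    qed
  qed (use c4 in simp)
  then show ?thesis
    by (rule circumferenceI) (use is_cycle_length in \<open>auto simp: SV_def\<close>)
qed

lemma in_graph_class: "(SV, SE) \<in> graph_class 3 c (c - 2 + card S)"
  using simple_SE conn_SE girth_SE circumference_SE card_SE by (simp add: graph_class_def)

section \<open>Positions and distances along the rails\<close>

lemma SV_iff [simp]: "v \<in> SV \<longleftrightarrow> v < c"
  by (simp add: SV_def)

text \<open>Position along the underlying path of vertices. An edge changes it by at most 2, so half
  of its variation bounds distances from below, and along a rail this bound is exact.\<close>

definition pos :: "(nat \<Rightarrow> real) \<Rightarrow> real" where
  "pos = lin SV real"

lemma pos_lipschitz: "p \<in> P \<Longrightarrow> q \<in> P \<Longrightarrow> \<bar>pos p - pos q\<bar> \<le> 2 * d p q"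
  unfolding pos_def by (rule lin_lipschitz) (auto elim!: SE_cases simp: doubleton_eq_iff)

lemma pos_vp [simp]: "v < c \<Longrightarrow> pos (vp v) = v"
  by (simp add: pos_def)

lemma pos_ge: assumes "q \<in> P" "supp q \<subseteq> {l..}" shows "real l \<le> pos q"
proof -
  have "(\<Sum>w\<in>SV. q w * real l) \<le> (\<Sum>w\<in>SV. q w * real w)"
  proof (rule sum_mono)
    fix w show "q w * real l \<le> q w * real w"
      using assms(2) point_nonneg[OF assms(1), of w] by (cases "q w = 0") (auto intro: mult_left_mono)
  qed
  then show ?thesis using point_sum[OF assms(1)] by (simp add: pos_def lin_def flip: sum_distrib_right)
qed

lemma pos_le: assumes "q \<in> P" "supp q \<subseteq> {..l}" shows "pos q \<le> real l"
proof -
  have "(\<Sum>w\<in>SV. q w * real w) \<le> (\<Sum>w\<in>SV. q w * real l)"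
  proof (rule sum_mono)
    fix w show "q w * real w \<le> q w * real l"
      using assms(2) point_nonneg[OF assms(1), of w] by (cases "q w = 0") (auto intro: mult_left_mono)
  qed
  then show ?thesis using point_sum[OF assms(1)] by (simp add: pos_def lin_def flip: sum_distrib_right)
qed

text \<open>Only the parity of \<open>i\<close> matters. A vertex is on the rail of its own parity,
  and interior points of rungs are on no rail.\<close>

definition on_rail :: "nat \<Rightarrow> (nat \<Rightarrow> real) \<Rightarrow> bool" where
  "on_rail i q \<longleftrightarrow> (\<forall>w\<in>supp q. even (w + i))"

lemma on_rail_cases:
  assumes "q \<in> P" "on_rail i q"
  obtains w where "q = vp w" "w < c" "even (w + i)"
  | n where "n + 2 < c" "{n, n + 2} \<in> SE" "supp q = {n, n + 2}" "even (n + i)"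
      "d q (vp n) = (pos q - n) / 2" "d q (vp (n + 2)) = (real n + 2 - pos q) / 2" "n \<le> pos q" "pos q \<le> real n + 2"
proof -
  consider "supp q \<in> SE" | w where "w \<in> SV" "supp q = {w}" using point_supp[OF assms(1)] by auto
  then show ?thesis
  proof cases
    case 1
    then show ?thesis
    proof (cases rule: SE_cases)
      case (1 n)
      then have E: "{n, n + 2} \<in> SE" using rail by simp
      have s: "supp q \<subseteq> {n, n + 2}" using 1 by simp
      have "pos q = q n * n + q (n + 2) * (n + 2)" unfolding pos_def using lin_edge[OF E s] by simp
      moreover have q1: "q n + q (n + 2) = 1" using point_sum_edge[OF assms(1) E s] .
      ultimately have "pos q = q n * n + (1 - q n) * (n + 2)" by (simp add: eq_diff_eq add.commute)
      then have pq: "pos q = n + 2 * (1 - q n)" by (simp add: algebra_simps)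
      have ce: "ce q (vp n)" "ce q (vp (n + 2))" using E s ce_vertex by blast+
      then have "d q (vp n) = (pos q - n) / 2" "d q (vp (n + 2)) = (real n + 2 - pos q) / 2"
        using d_vertex_ce[of q] assms(1) 1 pq q1 by auto
      moreover have "n \<le> pos q" "pos q \<le> real n + 2"
        using pq point_nonneg[OF assms(1), of n] point_le_1[OF assms(1), of n] by auto
      moreover have "even (n + i)" using assms(2) 1 by (simp add: on_rail_def)
      ultimately show ?thesis using that(2)[of n] 1 E by blast
    next
      case (2 s)
      then have "s \<in> supp q" "s + 1 \<in> supp q" by auto
      then have "even (s + i)" "even (s + 1 + i)" using assms(2) unfolding on_rail_def by blast+
      then show ?thesis by simp
    qed
  next
    case 2
    then have "q = vp w" using point_supp_single assms by simp
    then show ?thesis using that(1)[of w] 2 assms(2) by (auto simp: on_rail_def)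
  qed
qed

lemma rail_dv: "a + 2 * j < c \<Longrightarrow> d (vp a) (vp (a + 2 * j)) \<le> j"
proof (induction j)
  case (Suc j)
  have "d (vp (a + 2 * j)) (vp (a + 2 * j + 2)) \<le> 1"
    using vertices_d_le_1[of "a + 2 * j" "a + 2 * j + 2"] rail[of "a + 2 * j"] Suc.prems by simp
  then show ?case
    using Suc d_triangle[of "vp a" "vp (a + 2 * j)" "vp (a + 2 * j + 2)"] by simp
qed simp

lemma rail_dv': "a < c \<Longrightarrow> b < c \<Longrightarrow> even (a + b) \<Longrightarrow> d (vp a) (vp b) \<le> \<bar>real a - real b\<bar> / 2"
proof -
  have *: "d (vp a) (vp b) \<le> \<bar>real a - real b\<bar> / 2" if "a \<le> b" "b < c" "even (a + b)" for a b
  proof -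
    have "even (b - a)" using that by simp
    then obtain j where "b - a = 2 * j" by (rule evenE)
    then have "b = a + 2 * j" using that(1) by simp
    then show ?thesis using rail_dv[of a j] that by simp
  qed
  assume ab: "a < c" "b < c" "even (a + b)"
  then have "even (b + a)" "vp a \<in> P" "vp b \<in> P" by simp_all
  then show ?thesis
    using *[of a b] *[of b a] d_sym[of "vp a" "vp b"] ab abs_minus_commute[of "real a" "real b"]
    by (cases "a \<le> b") simp_all
qed

lemma rail_vertex:
  assumes q: "q \<in> P" "on_rail u q" and u: "u < c"
  shows "d q (vp u) = \<bar>pos q - u\<bar> / 2"
proof (rule antisym)
  show "\<bar>pos q - u\<bar> / 2 \<le> d q (vp u)" using pos_lipschitz[of q "vp u"] q u by simp
  show "d q (vp u) \<le> \<bar>pos q - u\<bar> / 2"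
    using q
  proof (cases rule: on_rail_cases)
    case (1 w)
    then show ?thesis using rail_dv'[of w u] u by simp
  next
    case (2 n)
    then have "u \<le> n \<or> n + 2 \<le> u" by presburger
    then show ?thesis
    proof
      assume "u \<le> n"
      then show ?thesis using rail_dv'[of n u] 2 u d_triangle[of q "vp n" "vp u"] q by simp
    next
      assume "n + 2 \<le> u"
      then show ?thesis using rail_dv'[of "n + 2" u] 2 u d_triangle[of q "vp (n + 2)" "vp u"] q
        by simp
    qed
  qed
qed

lemma rail_rail:
  assumes "p \<in> P" "q \<in> P" "on_rail i p" "on_rail i q" shows "d p q \<le> \<bar>pos p - pos q\<bar> / 2"
proof -
  have par: "on_rail w q" if "on_rail i q" "even (w + i)" for w q
    using that unfolding on_rail_def by (metis even_add)
  show ?thesis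
    using assms(1,3)
  proof (cases rule: on_rail_cases)
    case (1 w)
    then show ?thesis using rail_vertex[of q w] par assms d_sym[of p q] by (simp add: abs_minus_commute)
  next
    case p: (2 n)
    show ?thesis
      using assms(2,4)
    proof (cases rule: on_rail_cases)
      case (1 w)
      then show ?thesis using rail_vertex[of p w] par assms by simp
    next
      case q: (2 m)
      have via: "2 * d p q \<le> \<bar>pos p - u\<bar> + \<bar>pos q - u\<bar>" if "u < c" "even (u + i)" for u
        using rail_vertex[of p u] rail_vertex[of q u] d_sym[of q "vp u"] d_triangle[of p "vp u" q] par assms that
        by simp
      have "n = m \<or> n + 2 \<le> m \<or> m + 2 \<le> n" using p(4) q(4) by presburger
      then consider "n = m" | "n + 2 \<le> m" | "m + 2 \<le> n" by blast
      then show ?thesis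
      proof cases
        case 1
        then have "ce p q" using p q by (auto simp: ce_edge)
        moreover have "sg p q = \<bar>p n - q n\<bar>" using sg_edge[of p q n "n + 2"] p q 1 assms by simp
        moreover have "d p (vp n) = 1 - p n" "d q (vp n) = 1 - q n"
          using d_vertex_ce[of _ n] p q 1 assms ce_vertex by auto
        ultimately have "2 * p n = 2 + real n - pos p" "2 * q n = 2 + real n - pos q" "d p q = \<bar>p n - q n\<bar>"
          using p(5) q(5) 1 d_ce[OF assms(1,2)] by (simp_all add: field_simps)
        then have "2 * d p q \<le> \<bar>pos p - pos q\<bar>" by linarith
        then show ?thesis by simp
      next
        case 2
        then have "2 * d p q \<le> \<bar>pos p - pos q\<bar>" using via[of m] p q by simp
        then show ?thesis by simp
      next
        case 3
        then have "2 * d p q \<le> \<bar>pos p - pos q\<bar>" using via[of n] p q by simp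
        then show ?thesis by simp
      qed
    qed
  qed
qed

text \<open>The difference of two vertices on opposite rails is odd, while twice their distance is
  even and at least as large; this gains one unit over the bound by positions.\<close>

lemma cross_vertex:
  assumes q: "q \<in> P" "on_rail i q" and u: "u < c" "odd (u + i)"
  shows "(\<bar>pos q - u\<bar> + 1) / 2 \<le> d q (vp u)"
proof -
  have vert: "(\<bar>real w - real u\<bar> + 1) / 2 \<le> d (vp w) (vp u)" if "w < c" "even (w + i)" for w
  proof -
    have "\<bar>real w - real u\<bar> \<le> 2 * d (vp w) (vp u)" using pos_lipschitz[of "vp w" "vp u"] that u by simp
    then have "\<bar>real w - real u\<bar> \<le> real (2 * dv w u)" using d_vertices that u by simp
    then have "\<bar>int w - int u\<bar> \<le> int (2 * dv w u)" by linarith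
    moreover have "odd (\<bar>int w - int u\<bar>)" using that(2) u(2) by (simp add: even_diff_iff)
    ultimately have "\<bar>int w - int u\<bar> + 1 \<le> int (2 * dv w u)" by presburger
    then have "\<bar>real w - real u\<bar> + 1 \<le> real (2 * dv w u)" by linarith
    then show ?thesis using d_vertices that u by simp
  qed
  show ?thesis
    using q
  proof (cases rule: on_rail_cases)
    case (1 w)
    then show ?thesis using vert[of w] by simp
  next
    case (2 n)
    have e: "e = {n, n + 2}" if "e \<in> SE" "supp q \<subseteq> e" for e using that edge_eqI[of "{n, n + 2}" e] 2 by auto
    have uP: "vp u \<in> P" using u by simp
    show ?thesis
      using q(1) uP
    proof (cases rule: d_exit)
      case 1
      then obtain e where "e \<in> SE" "supp q \<subseteq> e" "u \<in> e" by (auto simp: ce_vertex)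
      then have "u = n \<or> u = n + 2" using e by auto
      then show ?thesis using 2(4) u by auto
    next
      case (2 a)
      then obtain f where "f \<in> SE" "supp q \<subseteq> f" "a \<in> f" by (auto simp: ce_vertex)
      then have a: "a = n \<or> a = n + 2" using e by auto
      then have "even (a + i)" "a < c" using \<open>even (n + i)\<close> \<open>n + 2 < c\<close> by auto
      then have "(\<bar>real a - real u\<bar> + 1) / 2 \<le> d (vp a) (vp u)" using vert by blast
      moreover have "\<bar>pos q - a\<bar> \<le> 2 * d q (vp a)" using pos_lipschitz[of q "vp a"] q \<open>a < c\<close> by simp
      ultimately show ?thesis using 2(3) by (simp add: field_simps)
    qed
  qed
qed

section \<open>Rungs as separators and the cells between them\<close>

lemma left_right: "e \<in> SE \<Longrightarrow> e \<subseteq> {..s + 1} \<or> e \<subseteq> {s..}"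
  by (erule SE_cases) (cases "s"; fastforce)+

lemma left_right_point:
  assumes "q \<in> P" shows "supp q \<subseteq> {..s + 1} \<or> supp q \<subseteq> {s..}"
proof -
  obtain e where "e \<in> SE" "supp q \<subseteq> e" using point_edge assms by blast
  then show ?thesis using left_right[of e s] by blast
qed

lemma last_rung:
  assumes "q \<in> P" "supp q \<subseteq> {c - 2..}" shows "supp q \<subseteq> {c - 2, c - 2 + 1}"
proof
  fix w assume w: "w \<in> supp q"
  have "c - 2 \<le> w" using assms(2) w by blast
  moreover have "w < c" using point_supp_subset[OF assms(1)] w by (metis SV_iff subsetD)
  ultimately show "w \<in> {c - 2, c - 2 + 1}" using c4 by auto
qed

lemma left_Int_right: "{..s + 1} \<inter> {s..} = {s, s + 1 :: nat}"
  by auto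

lemma S_less: "s \<in> S \<Longrightarrow> s + 1 < c"
  using S(1) c4 by force

text \<open>Interior points of rungs are left out, because on a rail the distances to the ends are
  explicit; points of the rungs are treated as belonging to the neighbouring parts.\<close>

definition cell :: "nat \<Rightarrow> nat \<Rightarrow> (nat \<Rightarrow> real) set" where
  "cell s t = {z \<in> P. supp z \<subseteq> {s..t + 1} \<and> (\<exists>i. on_rail i z)}"

lemma cell_vertex: "s \<le> v \<Longrightarrow> v \<le> t + 1 \<Longrightarrow> v < c \<Longrightarrow> vp v \<in> cell s t"
proof -
  assume v: "s \<le> v" "v \<le> t + 1" "v < c"
  have "on_rail v (vp v)" by (simp add: on_rail_def)
  then show ?thesis using v unfolding cell_def by auto
qed

text \<open>Here \<open>e\<close> and \<open>e'\<close> are the ends of the rungs at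
  \<open>s\<close> and \<open>t\<close> that lie on the rail of \<open>z\<close>.\<close>

lemma rail_ends:
  assumes st: "s < t" "t + 1 < c" and z: "z \<in> P" "on_rail i z" "supp z \<subseteq> {s..t + 1}"
  obtains e e' where "e \<in> {s, s + 1}" "e' \<in> {t, t + 1}" "even (e + i)" "even (e' + i)"
    "d z (vp e) = (pos z - e) / 2" "d z (vp e') = (e' - pos z) / 2" "e \<le> pos z" "pos z \<le> e'"
proof -
  define e where "e = (if even (s + i) then s else s + 1)"
  define e' where "e' = (if even (t + i) then t else t + 1)"
  have e: "e \<in> {s, s + 1}" "e' \<in> {t, t + 1}" "even (e + i)" "even (e' + i)" by (auto simp: e_def e'_def)
  have "e \<le> w \<and> w \<le> e'" if "w \<in> supp z" for w
  proof -
    have "s \<le> w" "w \<le> t + 1" "even (w + i)" using that z by (auto simp: on_rail_def)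
    then show ?thesis using e by auto presburger+
  qed
  then have "supp z \<subseteq> {e..}" "supp z \<subseteq> {..e'}" by auto
  then have "e \<le> pos z" "pos z \<le> e'" using pos_ge pos_le z by auto
  moreover have "on_rail e z" "on_rail e' z" using z(2) e by (auto simp: on_rail_def)
  ultimately show ?thesis using that[of e e'] e rail_vertex[of z e] rail_vertex[of z e'] st z by auto
qed

lemma rung_d: "s \<in> S \<Longrightarrow> e \<in> {s, s + 1} \<Longrightarrow> q \<in> P \<Longrightarrow> supp q \<subseteq> {s, s + 1} \<Longrightarrow> d (vp e) q \<le> 1"
proof -
  assume a: "s \<in> S" "e \<in> {s, s + 1}" "q \<in> P" "supp q \<subseteq> {s, s + 1}"
  then have "ce (vp e) q" "vp e \<in> P" using rung[of s] S_less[of s] by (auto simp: ce_edge)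
  then show ?thesis using d_ce sg_le_1 a by simp
qed

text \<open>For points on different rails there are two routes, one over each rung. Their lengths
  add up to the length \<open>t - s + 2\<close> of the cell, so the shorter one has at most half of
  it.\<close>

lemma cell_diam:
  assumes st: "s \<in> S" "t \<in> S" "s < t" and z: "z \<in> cell s t" "z' \<in> cell s t"
  shows "d z z' \<le> 1 + (real t - real s) / 2"
proof -
  have tc: "t + 1 < c" using S_less st by simp
  obtain i where i: "z \<in> P" "supp z \<subseteq> {s..t + 1}" "on_rail i z" using z by (auto simp: cell_def)
  obtain j where j: "z' \<in> P" "supp z' \<subseteq> {s..t + 1}" "on_rail j z'" using z by (auto simp: cell_def)
  obtain e e' where e: "e \<in> {s, s + 1}" "e' \<in> {t, t + 1}" "even (e + i)" "even (e' + i)"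
    "d z (vp e) = (pos z - e) / 2" "d z (vp e') = (e' - pos z) / 2" "e \<le> pos z" "pos z \<le> e'"
    by (rule rail_ends[OF st(3) tc i(1,3,2)])
  obtain f f' where f: "f \<in> {s, s + 1}" "f' \<in> {t, t + 1}" "even (f + j)" "even (f' + j)"
    "d z' (vp f) = (pos z' - f) / 2" "d z' (vp f') = (f' - pos z') / 2" "f \<le> pos z'" "pos z' \<le> f'"
    by (rule rail_ends[OF st(3) tc j(1,3,2)])
  have c: "e < c" "e' < c" "f < c" "f' < c" using e(1,2) f(1,2) tc st(3) by auto
  show ?thesis
  proof (cases "even (i + j)")
    case True
    then have "on_rail i z'" using j by (auto simp: on_rail_def)
    then have "d z z' \<le> \<bar>pos z - pos z'\<bar> / 2" using rail_rail i j by simp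
    moreover have "s \<le> pos z" "pos z \<le> t + 1" using e(1,2,7,8) by auto
    moreover have "s \<le> pos z'" "pos z' \<le> t + 1" using f(1,2,7,8) by auto
    ultimately show ?thesis by (simp add: field_simps)
  next
    case False
    then have ef: "e \<noteq> f" "e' \<noteq> f'" using e f by auto
    have "d (vp e) (vp f) \<le> 1" using rung_d[OF st(1) e(1), of "vp f"] f c by auto
    then have 1: "d z z' \<le> (pos z - e) / 2 + 1 + (pos z' - f) / 2"
      using d_triangle[of z "vp e" z'] d_triangle[of "vp e" "vp f" z'] d_sym[of "vp f" z'] i j c e f by simp
    have "d (vp e') (vp f') \<le> 1" using rung_d[OF st(2) e(2), of "vp f'"] f c by auto
    then have 2: "d z z' \<le> (e' - pos z) / 2 + 1 + (f' - pos z') / 2"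
      using d_triangle[of z "vp e'" z'] d_triangle[of "vp e'" "vp f'" z'] d_sym[of "vp f'" z'] i j c e f by simp
    have "e + f = 2 * s + 1" "e' + f' = 2 * t + 1" using e f ef by auto
    then have "real e + real f = 2 * real s + 1" "real e' + real f' = 2 * real t + 1" by linarith+
    then show ?thesis using 1 2 by argo
  qed
qed

definition consecutive :: "nat \<Rightarrow> nat \<Rightarrow> bool" where
  "consecutive s t \<longleftrightarrow> s \<in> S \<and> t \<in> S \<and> s < t \<and> t \<le> s + 2 * h \<and> (\<forall>r\<in>S. \<not> (s < r \<and> r < t))"

lemma consecutive_after:
  assumes "s \<in> S" "s < c - 2" obtains t where "consecutive s t"
proof -
  obtain t0 where t0: "t0 \<in> S" "s < t0" "t0 \<le> s + 2 * h" using gap assms by blast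
  define t where "t = (LEAST t. t \<in> S \<and> s < t)"
  have "t \<in> S \<and> s < t" unfolding t_def by (rule LeastI[of _ t0]) (use t0 in simp)
  moreover have "t \<le> t0" unfolding t_def by (rule Least_le) (use t0 in simp)
  moreover have "\<not> (s < r \<and> r < t)" if "r \<in> S" for r using not_less_Least[of r] that unfolding t_def by blast
  ultimately show ?thesis using that[of t] assms t0 by (auto simp: consecutive_def)
qed

lemma consecutive_before:
  assumes "t \<in> S" "0 < t" obtains s where "consecutive s t"
proof -
  have fin: "finite {s \<in> S. s < t}" by simp
  define s where "s = Max {s \<in> S. s < t}"
  have "{s \<in> S. s < t} \<noteq> {}" using assms S(2) by blast
  then have s: "s \<in> S" "s < t" using Max_in[OF fin] unfolding s_def by auto
  have mx: "r \<le> s" if "r \<in> S" "r < t" for r unfolding s_def by (rule Max_ge[OF fin]) (use that in simp)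
  have "t \<le> c - 2" using assms S(1) by auto
  then obtain t' where t': "consecutive s t'" using consecutive_after[of s] s by auto
  then have "t' = t" using mx[of t'] s assms(1) unfolding consecutive_def by (metis linorder_neqE_nat not_less)
  then show ?thesis using that t' by blast
qed

lemma supp_on_rail:
  assumes "z \<in> P" "\<And>s. s \<in> S \<Longrightarrow> supp z \<noteq> {s, s + 1}" shows "\<exists>i. on_rail i z"
proof -
  consider "supp z \<in> SE" | w where "supp z = {w}" using point_supp[OF assms(1)] by auto
  then show ?thesis
  proof cases
    case 1
    then show ?thesis
    proof (cases rule: SE_cases)
      case (1 n)
      then show ?thesis by (intro exI[of _ n]) (simp add: on_rail_def)
    qed (use assms in auto)
  next
    case 2
    then show ?thesis by (intro exI[of _ w]) (simp add: on_rail_def)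
  qed
qed

text \<open>No rung lies strictly between consecutive ones, so a point between the two rungs that
  belongs to neither is on a rail.\<close>

lemma cell_or_right:
  assumes st: "consecutive s t" and x: "x \<in> P" "supp x \<subseteq> {s..}" "\<not> supp x \<subseteq> {s, s + 1}"
  shows "x \<in> cell s t \<or> supp x \<subseteq> {t..}"
proof (cases "supp x \<subseteq> {t..}")
  case False
  then have "supp x \<subseteq> {..t + 1}" using left_right_point x by blast
  moreover have "\<exists>i. on_rail i x"
  proof (rule supp_on_rail[OF x(1)])
    fix r assume "r \<in> S"
    then have rr: "r \<le> s \<or> t \<le> r" using st by (auto simp: consecutive_def)
    show "supp x \<noteq> {r, r + 1}"
    proof
      assume eq: "supp x = {r, r + 1}"
      then have "{r, r + 1} \<subseteq> {s..}" "\<not> {r, r + 1} \<subseteq> {t..}" using x(2) False by simp_all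
      moreover have "r \<noteq> s" using x(3) eq by blast
      ultimately show False using rr by auto
    qed
  qed
  ultimately show ?thesis using x by (auto simp: cell_def)
qed simp

lemma cell_or_left:
  assumes st: "consecutive s t" and x: "x \<in> P" "supp x \<subseteq> {..t + 1}" "\<not> supp x \<subseteq> {t, t + 1}"
  shows "x \<in> cell s t \<or> supp x \<subseteq> {..s + 1}"
proof (cases "supp x \<subseteq> {..s + 1}")
  case False
  then have "supp x \<subseteq> {s..}" using left_right_point x by blast
  moreover have "\<exists>i. on_rail i x"
  proof (rule supp_on_rail[OF x(1)])
    fix r assume "r \<in> S"
    then have rr: "r \<le> s \<or> t \<le> r" using st by (auto simp: consecutive_def)
    show "supp x \<noteq> {r, r + 1}"
    proof
      assume eq: "supp x = {r, r + 1}"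
      then have "{r, r + 1} \<subseteq> {..t + 1}" "\<not> {r, r + 1} \<subseteq> {..s + 1}" using x(2) False by simp_all
      moreover have "r \<noteq> t" using x(3) eq by blast
      ultimately show False using rr by auto
    qed
  qed
  ultimately show ?thesis using x by (auto simp: cell_def)
qed simp

lemma consecutiveD: "consecutive s t \<Longrightarrow> s \<in> S \<and> t \<in> S \<and> s < t \<and> t + 1 < c \<and> t \<le> s + 2 * h"
  using S_less by (simp add: consecutive_def)

text \<open>\<open>cell_near_end\<close> with the rung at \<open>t\<close> as the separating edge:
  whatever is right of the rung at \<open>s\<close> is in the cell or beyond the rung at
  \<open>t\<close>.\<close>

lemma near_right_end:
  assumes st: "consecutive s t" and xy: "x \<in> P" "y \<in> P" "supp x \<subseteq> {s..}" "supp y \<subseteq> {s..}"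
      "\<not> supp x \<subseteq> {s, s + 1}" "\<not> supp y \<subseteq> {s, s + 1}"
    and p: "p \<in> P" "supp p \<subseteq> {..t + 1}" "\<not> supp p \<subseteq> {t, t + 1}" and eq: "d x p + d p y = d x y"
    and far: "(real t - s - h) / 2 \<le> d p (vp t)" "(real t - s - h) / 2 \<le> d p (vp (t + 1))"
  shows "d p x \<le> 1 + h / 2 \<or> d p y \<le> 1 + h / 2"
proof (rule cell_near_end[OF left_right left_Int_right, where Z = "cell s t" and g = "real t - s"])
  show "{t, t + 1} \<in> SE" using rung st by (simp add: consecutive_def)
  show "d z z' \<le> 1 + (real t - real s) / 2" if "z \<in> cell s t" "z' \<in> cell s t" for z z'
    using cell_diam that st by (simp add: consecutive_def)
  show "vp t \<in> cell s t" "vp (t + 1) \<in> cell s t" using cell_vertex consecutiveD[OF st] by auto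
  show "x \<in> cell s t \<or> supp x \<subseteq> {t..}" by (rule cell_or_right[OF st xy(1,3,5)])
  show "y \<in> cell s t \<or> supp y \<subseteq> {t..}" by (rule cell_or_right[OF st xy(2,4,6)])
  show "real t - real s \<le> 2 * real h" using consecutiveD[OF st] by linarith
qed (use assms in auto)

text \<open>Mirror image of \<open>near_right_end\<close>, with the rung at \<open>s\<close> as the
  separating edge.\<close>

lemma near_left_end:
  assumes st: "consecutive s t" and xy: "x \<in> P" "y \<in> P" "supp x \<subseteq> {..t + 1}" "supp y \<subseteq> {..t + 1}"
      "\<not> supp x \<subseteq> {t, t + 1}" "\<not> supp y \<subseteq> {t, t + 1}"
    and p: "p \<in> P" "supp p \<subseteq> {s..}" "\<not> supp p \<subseteq> {s, s + 1}" and eq: "d x p + d p y = d x y"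
    and far: "(real t - s - h) / 2 \<le> d p (vp s)" "(real t - s - h) / 2 \<le> d p (vp (s + 1))"
  shows "d p x \<le> 1 + h / 2 \<or> d p y \<le> 1 + h / 2"
proof (rule cell_near_end[where L = "{s..}" and R = "{..s + 1}" and u = s and v = "s + 1" and Z = "cell s t" and g = "real t - s"])
  show "e \<subseteq> {s..} \<or> e \<subseteq> {..s + 1}" if "e \<in> SE" for e using left_right[OF that, of s] by blast
  show "{s..} \<inter> {..s + 1} = {s, s + 1}" by auto
  show "{s, s + 1} \<in> SE" using rung st by (simp add: consecutive_def)
  show "d z z' \<le> 1 + (real t - real s) / 2" if "z \<in> cell s t" "z' \<in> cell s t" for z z'
    using cell_diam that st by (simp add: consecutive_def)
  show "vp s \<in> cell s t" "vp (s + 1) \<in> cell s t" using cell_vertex consecutiveD[OF st] by auto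
  show "x \<in> cell s t \<or> supp x \<subseteq> {..s + 1}" by (rule cell_or_left[OF st xy(1,3,5)])
  show "y \<in> cell s t \<or> supp y \<subseteq> {..s + 1}" by (rule cell_or_left[OF st xy(2,4,6)])
  show "real t - real s \<le> 2 * real h" using consecutiveD[OF st] by linarith
qed (use assms in auto)

text \<open>Changing sides would need a break point on the rung, but the whole rung is within
  \<open>D\<close> of \<open>p\<close>.\<close>

lemma sides:
  assumes s: "s \<in> S" "\<And>q. q \<in> P \<Longrightarrow> supp q \<subseteq> {s, s + 1} \<Longrightarrow> d p q \<le> D"
    and ps: "path_between SV SE x y ps" "\<And>q. q \<in> set ps \<Longrightarrow> D < d p q"
  shows "(\<not> supp x \<subseteq> {s, s + 1} \<and> \<not> supp y \<subseteq> {s, s + 1}) \<and>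
    (supp x \<subseteq> {..s + 1} \<and> supp y \<subseteq> {..s + 1} \<or> supp x \<subseteq> {s..} \<and> supp y \<subseteq> {s..})"
proof -
  have avoid: "\<not> supp q \<subseteq> {s, s + 1}" if "q \<in> set ps" for q
  proof
    assume "supp q \<subseteq> {s, s + 1}"
    moreover have "q \<in> P" using that ps by (auto simp: path_between_def)
    ultimately show False using s(2) ps(2)[OF that] by fastforce
  qed
  have xy: "x \<in> set ps" "y \<in> set ps" "x \<in> P" "y \<in> P" using ps(1) by (auto simp: path_between_def)
  have "\<not> (supp x \<subseteq> {..s + 1} \<and> supp y \<subseteq> {s..})"
    using path_separator[OF left_right ps(1), of s] avoid left_Int_right[of s] by metis
  moreover have "\<not> (supp x \<subseteq> {s..} \<and> supp y \<subseteq> {..s + 1})"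
  proof
    assume a: "supp x \<subseteq> {s..} \<and> supp y \<subseteq> {..s + 1}"
    have "\<exists>q\<in>set ps. supp q \<subseteq> {s..} \<inter> {..s + 1}"
      by (rule path_separator[OF _ ps(1)]) (use a left_right in auto)
    then show False using avoid by (metis left_Int_right inf_commute)
  qed
  ultimately show ?thesis using avoid xy left_right_point[of x s] left_right_point[of y s] by blast
qed

text \<open>If \<open>p\<close> is on no rung, the nearer end of its piece of rail is within
  \<open>h / 2\<close>, so the path cannot cross the rung there. By convexity of that rung both
  \<open>x\<close> and \<open>y\<close> lie on the side of \<open>p\<close>, and
  \<open>near_right_end\<close> or \<open>near_left_end\<close> applies. If \<open>p\<close> is on a
  rung, this rung is within 1 and is itself the barrier.\<close>

lemma bottleneck_strip: "bottleneck (1 + h / 2)"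
proof (rule bottleneckI)
  define D where "D = 1 + h / 2"
  fix x y p ps assume P: "x \<in> P" "y \<in> P" "p \<in> P" and eq: "d x p + d p y = d x y"
    and pb: "path_between SV SE x y ps" and far: "\<And>q. q \<in> set ps \<Longrightarrow> 1 + real h / 2 < d p q"
  have fx: "\<not> d p x \<le> 1 + h / 2" "\<not> d p y \<le> 1 + h / 2" using far pb by (auto simp: path_between_def not_le)
  let ?l = "\<lambda>s. supp x \<subseteq> {..s + 1} \<and> supp y \<subseteq> {..s + 1}"
  let ?r = "\<lambda>s. supp x \<subseteq> {s..} \<and> supp y \<subseteq> {s..}"
  let ?off = "\<lambda>s. \<not> supp x \<subseteq> {s, s + 1} \<and> \<not> supp y \<subseteq> {s, s + 1}"
  have side: "?off s \<and> (?l s \<or> ?r s)" if "s \<in> S" "e \<in> {s, s + 1}" "d p (vp e) \<le> h / 2" for s e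
  proof (rule sides[OF that(1) _ pb])
    fix q assume q: "q \<in> P" "supp q \<subseteq> {s, s + 1}"
    have "vp e \<in> P" using that S_less[of s] by auto
    then show "d p q \<le> D" using rung_d[OF that(1,2) q] d_triangle[of p "vp e" q] P q that by (simp add: D_def)
  qed (use far D_def in auto)
  have not_cell: "\<not> (x \<in> cell s t \<and> y \<in> cell s t)" if st: "consecutive s t" for s t
  proof
    assume "x \<in> cell s t \<and> y \<in> cell s t"
    then have "d x y \<le> 1 + (real t - real s) / 2" using cell_diam consecutiveD[OF st] by blast
    moreover have "real t \<le> real s + 2 * real h" using consecutiveD[OF st] by linarith
    moreover have "1 + real h / 2 < d x p" "1 + real h / 2 < d p y" using fx d_sym[OF P(1,3)] by simp_all
    ultimately show False using eq by argo
  qed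
  have vP: "vp v \<in> P" if "v < c" for v using that by simp
  have lip: "(pos p - v) / 2 \<le> d p (vp v)" "(v - pos p) / 2 \<le> d p (vp v)" if "v < c" for v
    using pos_lipschitz[OF P(3) vP[OF that]] that by auto
  show False
  proof (cases "\<exists>s\<in>S. supp p \<subseteq> {s, s + 1}")
    case True
    \<comment> \<open>A vertex can belong to two rungs, so all rungs through \<open>p\<close> are
      collected; an extreme one among them is used to continue on the side of \<open>x\<close> and
      \<open>y\<close>.\<close>
    define Sp where "Sp = {s \<in> S. supp p \<subseteq> {s, s + 1}}"
    have "finite S" using S(1) finite_subset by blast
    then have fin: "finite Sp" and ne: "Sp \<noteq> {}" using True by (auto simp: Sp_def)
    have sideSp: "?off s \<and> (?l s \<or> ?r s)" if "s \<in> Sp" for s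
    proof (rule sides[OF _ _ pb])
      show "s \<in> S" using that by (simp add: Sp_def)
      fix q assume q: "q \<in> P" "supp q \<subseteq> {s, s + 1}"
      have "ce p q" using q that rung by (auto simp: ce_edge Sp_def)
      then have "d p q \<le> 1" using d_ce sg_le_1 P q by simp
      then show "d p q \<le> D" by (simp add: D_def)
    qed (use far D_def in auto)
    show False
    proof (cases "\<exists>s\<in>Sp. ?r s")
      case True
      define s where "s = Max {s \<in> Sp. ?r s}"
      have fin': "finite {s \<in> Sp. ?r s}" using fin by simp
      have "{s \<in> Sp. ?r s} \<noteq> {}" using True by blast
      then have s: "s \<in> Sp" "?r s" using Max_in[OF fin'] unfolding s_def by blast+
      have smax: "r \<le> s" if "r \<in> Sp" "?r r" for r unfolding s_def by (rule Max_ge[OF fin']) (use that in simp)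
      have sS: "s \<in> S" "supp p \<subseteq> {s, s + 1}" using s by (auto simp: Sp_def)
      have off: "?off s" using sideSp s by blast
      have "s \<noteq> c - 2"
      proof
        assume "s = c - 2"
        then have "supp x \<subseteq> {s, s + 1}" using s(2) last_rung[OF P(1)] by simp
        then show False using off by blast
      qed
      then have "s < c - 2" using sS S(1) by force
      then obtain t where st: "consecutive s t" using consecutive_after sS by blast
      note st' = consecutiveD[OF st]
      show False
      proof (cases "t \<in> Sp")
        case True
        \<comment> \<open>By the choice of \<open>s\<close> both ends are left of the rung at
          \<open>t\<close> as well, so they are caught in one cell, whose diameter is too
          small.\<close>
        then have "?l t" "?off t" using sideSp[OF True] smax[OF True] st' by auto
        moreover have "x \<in> cell s t \<or> supp x \<subseteq> {t..}" "y \<in> cell s t \<or> supp y \<subseteq> {t..}"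
          using cell_or_right[OF st] P s off by auto
        ultimately show False using not_cell[OF st] left_Int_right[of t] by blast
      next
        case False
        have "pos p \<le> s + 1" using pos_le[OF P(3), of "s + 1"] sS(2) by fastforce
        moreover have "supp p \<subseteq> {..t + 1}" using sS(2) st' by auto
        moreover have "\<not> supp p \<subseteq> {t, t + 1}" using False st' by (simp add: Sp_def)
        moreover have "(real t - s - h) / 2 \<le> d p (vp t)" "(real t - s - h) / 2 \<le> d p (vp (t + 1))"
        proof -
          have tc: "t < c" "t + 1 < c" using st' by auto
          \<comment> \<open>On the rung the position of \<open>p\<close> exceeds \<open>s\<close> by
            at most 1, which \<open>h \<ge> 1\<close> absorbs.\<close>
          have "real t - s - h \<le> real t - pos p" "real t - s - h \<le> real (t + 1) - pos p"
            using \<open>pos p \<le> s + 1\<close> h1 by simp_all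
          then show "(real t - s - h) / 2 \<le> d p (vp t)" "(real t - s - h) / 2 \<le> d p (vp (t + 1))"
            using lip(2)[OF tc(1)] lip(2)[OF tc(2)] by argo+
        qed
        ultimately show False
          using near_right_end[OF st P(1,2) _ _ _ _ P(3) _ _ eq] s off fx by blast
      qed
    next
      case False
      define t where "t = Min Sp"
      have t: "t \<in> Sp" unfolding t_def by (rule Min_in[OF fin ne])
      have tmin: "t \<le> r" if "r \<in> Sp" for r unfolding t_def by (rule Min_le[OF fin that])
      have tS: "t \<in> S" "supp p \<subseteq> {t, t + 1}" using t by (auto simp: Sp_def)
      have off: "?off t" "?l t" using sideSp[OF t] False t by auto
      have "t \<noteq> 0"
      proof
        assume "t = 0"
        then have "supp x \<subseteq> {t, t + 1}" using off(2) by auto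
        then show False using off by blast
      qed
      then obtain s where st: "consecutive s t" using consecutive_before tS by blast
      note st' = consecutiveD[OF st]
      have "s \<notin> Sp" using tmin[of s] st' by auto
      then have "\<not> supp p \<subseteq> {s, s + 1}" using st' by (simp add: Sp_def)
      moreover have "supp p \<subseteq> {s..}" using tS st' by auto
      moreover have "t \<le> pos p" using pos_ge[OF P(3), of t] tS(2) by fastforce
      moreover have "(real t - s - h) / 2 \<le> d p (vp s)" "(real t - s - h) / 2 \<le> d p (vp (s + 1))"
      proof -
        have sc: "s < c" "s + 1 < c" using st' by auto
        have "real t - s - h \<le> pos p - s" "real t - s - h \<le> pos p - real (s + 1)"
          using \<open>t \<le> pos p\<close> h1 by simp_all
        then show "(real t - s - h) / 2 \<le> d p (vp s)" "(real t - s - h) / 2 \<le> d p (vp (s + 1))"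
          using lip(1)[OF sc(1)] lip(1)[OF sc(2)] by argo+
      qed
      ultimately show False
        using near_left_end[OF st P(1,2) _ _ _ _ P(3) _ _ eq] off fx by blast
    qed
  next
    case False
    then have nr: "\<And>s. s \<in> S \<Longrightarrow> \<not> supp p \<subseteq> {s, s + 1}" by blast
    obtain i where i: "on_rail i p" using supp_on_rail[OF P(3)] nr by blast
    define s where "s = Max {s \<in> S. supp p \<subseteq> {s..}}"
    have "finite S" using S(1) finite_subset by blast
    then have fin: "finite {s \<in> S. supp p \<subseteq> {s..}}" by simp
    have "0 \<in> {s \<in> S. supp p \<subseteq> {s..}}" using S(2) by simp
    then have s: "s \<in> S" "supp p \<subseteq> {s..}" using Max_in[OF fin] unfolding s_def by blast+
    have smax: "r \<le> s" if "r \<in> S" "supp p \<subseteq> {r..}" for r unfolding s_def by (rule Max_ge[OF fin]) (use that in simp)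
    have "s \<noteq> c - 2"
    proof
      assume "s = c - 2"
      then have "supp p \<subseteq> {s, s + 1}" using s(2) last_rung[OF P(3)] by simp
      then show False using nr s by blast
    qed
    then have "s < c - 2" using s S(1) by force
    then obtain t where st: "consecutive s t" using consecutive_after s by blast
    note st' = consecutiveD[OF st]
    have "\<not> supp p \<subseteq> {t..}" using smax[of t] st' by auto
    then have pl: "supp p \<subseteq> {..t + 1}" using left_right_point P by blast
    have pst: "supp p \<subseteq> {s..t + 1}" using pl s by auto
    obtain e e' where e: "e \<in> {s, s + 1}" "e' \<in> {t, t + 1}" "even (e + i)" "even (e' + i)"
      "d p (vp e) = (pos p - e) / 2" "d p (vp e') = (e' - pos p) / 2" "e \<le> pos p" "pos p \<le> e'"
      by (rule rail_ends[of s t p i]) (use st' P i pst in auto)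
    have "even (e' - e)" using e(3,4) by simp
    moreover have "e \<le> e'" using e(7,8) by linarith
    ultimately obtain j where j: "e' = e + 2 * j" by (metis evenE le_add_diff_inverse)
    have "s \<le> e" "e \<le> s + 1" "t \<le> e'" "e' \<le> t + 1" using e(1,2) by auto
    \<comment> \<open>Parity sharpens both estimates: \<open>2 * j \<le> 2 * h + 1\<close> rounds
      down to \<open>j \<le> h\<close>, and the sum of the two bounds on \<open>t\<close> loses its
      odd unit.\<close>
    then have "t \<le> s + 2 * j + 1" "2 * j \<le> 2 * h + 1" "t \<le> s + 2 * h" using st' j by linarith+
    then have "j \<le> h" "2 * t \<le> 2 * s + 2 * j + 2 * h" by presburger+
    then have len: "real e' \<le> real e + 2 * real h" "2 * real t - 2 * real s \<le> real e' - real e + 2 * real h"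
      unfolding j by simp_all
    \<comment> \<open>The unit gained across the rails makes up for the far rung having its other
      end one position closer to \<open>p\<close>.\<close>
    have cross: "(real v + 1 - pos p) / 2 \<le> d p (vp v)" "(pos p - v + 1) / 2 \<le> d p (vp v)" if "v < c" "odd (v + i)" for v
    proof -
      have "real v + 1 - pos p \<le> \<bar>pos p - v\<bar> + 1" "pos p - v + 1 \<le> \<bar>pos p - v\<bar> + 1" by linarith+
      then show "(real v + 1 - pos p) / 2 \<le> d p (vp v)" "(pos p - v + 1) / 2 \<le> d p (vp v)"
        using cross_vertex[OF P(3) i that] by argo+
    qed
    consider "2 * pos p \<le> real e + e'" | "real e + e' \<le> 2 * pos p" by linarith
    then show False
    proof cases
      case 1
      then have "d p (vp e) \<le> h / 2" using e(5) len(1) by argo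
      then have sd: "?off s \<and> (?l s \<or> ?r s)" using side s e(1) by blast
      have "\<not> ?l s"
      proof
        assume l: "?l s"
        have "supp p \<subseteq> {s, s + 1}"
        proof (rule edge_separator_convex[where L = "{s..}" and R = "{..s + 1}" and x = x and y = y])
          show "f \<subseteq> {s..} \<or> f \<subseteq> {..s + 1}" if "f \<in> SE" for f using left_right[OF that, of s] by blast
          show "{s..} \<inter> {..s + 1} = {s, s + 1}" using left_Int_right[of s] by (simp add: Int_commute)
          show "{s, s + 1} \<in> SE" by (rule rung[OF s(1)])
          show "supp x \<subseteq> {..s + 1}" "supp y \<subseteq> {..s + 1}" using l by simp_all
        qed (assumption | fact P s(2) eq)+
        then show False using nr s by blast
      qed
      then have r: "?r s" "?off s" using sd by auto
      have "(real t - s - h) / 2 \<le> d p (vp v)" if v: "v \<in> {t, t + 1}" for v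
      proof -
        have "real t - s - h \<le> real e' - pos p" using 1 len by linarith
        then have ge: "(real t - s - h) / 2 \<le> (real e' - pos p) / 2" by simp
        show ?thesis
        proof (cases "v = e'")
          case True
          then show ?thesis using ge e(6) by simp
        next
          case False
          then have "odd (v + i)" "real e' \<le> real v + 1" "v < c" using v e(2,4) st' by auto
          then have "(real e' - pos p) / 2 \<le> (real v + 1 - pos p) / 2" by simp
          then show ?thesis using cross(1)[of v] ge \<open>odd (v + i)\<close> \<open>v < c\<close> by linarith
        qed
      qed
      then show False
        using near_right_end[OF st P(1,2) _ _ _ _ P(3) pl nr eq] r fx st' by auto
    next
      case 2
      then have "d p (vp e') \<le> h / 2" using e(6) len(1) by argo
      then have sd: "?off t \<and> (?l t \<or> ?r t)" using side st' e(2) by blast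
      have "\<not> ?r t"
      proof
        assume r: "?r t"
        have "supp p \<subseteq> {t, t + 1}"
        proof (rule edge_separator_convex[OF left_right left_Int_right, where x = x and y = y])
          show "{t, t + 1} \<in> SE" using rung st' by blast
          show "supp x \<subseteq> {t..}" "supp y \<subseteq> {t..}" using r by simp_all
        qed (assumption | fact P pl eq)+
        then show False using nr st' by blast
      qed
      then have l: "?l t" "?off t" using sd by auto
      have "(real t - s - h) / 2 \<le> d p (vp v)" if v: "v \<in> {s, s + 1}" for v
      proof -
        have "real t - s - h \<le> pos p - e" using 2 len by linarith
        then have ge: "(real t - s - h) / 2 \<le> (pos p - e) / 2" by simp
        show ?thesis
        proof (cases "v = e")
          case True
          then show ?thesis using ge e(5) by simp
        next
          case False
          then have "odd (v + i)" "real v \<le> real e + 1" "v < c" using v e(1,3) st' by auto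
          then have "(pos p - e) / 2 \<le> (pos p - v + 1) / 2" by simp
          then show ?thesis using cross(2)[of v] ge \<open>odd (v + i)\<close> \<open>v < c\<close> by linarith
        qed
      qed
      then show False
        using near_left_end[OF st P(1,2) _ _ _ _ P(3) s(2) nr eq] l fx st' by auto
    qed
  qed
qed

end

section \<open>The classes of graphs\<close>

lemma rung_set_exists:
  assumes "1 \<le> u" "u + 3 \<le> c" "c \<le> u * k + 3"
  obtains S where "S \<subseteq> {..c - 2 :: nat}" "0 \<in> S" "1 \<in> S" "c - 2 \<in> S" "card S = u + 2"
    "\<And>s. s \<in> S \<Longrightarrow> s < c - 2 \<Longrightarrow> \<exists>t\<in>S. s < t \<and> t \<le> s + k"
proof -
  have k: "1 \<le> k" using assms by (cases k) auto
  \<comment> \<open>From 1 on the rungs advance by \<open>k\<close> as long as possible. The second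
    term of the minimum holds them back just enough for each later rung to advance by at least 1;
    the last one arrives at \<open>c - 2\<close> because \<open>u * k\<close> covers
    \<open>c - 3\<close>.\<close>
  define f where "f j = 1 + min (j * k) (c - 3 - (u - j))" for j
  have step: "f j < f (Suc j)" "f (Suc j) \<le> f j + k" if "j < u" for j
    using that k assms by (auto simp: f_def min_def)
  have f0: "f 0 = 1" and fu: "f u = c - 2" using assms by (auto simp: f_def min_def)
  have mono: "f i < f j" if "i < j" "j \<le> u" for i j
    using that
  proof (induction j)
    case (Suc j)
    then show ?case using step(1)[of j] by (cases "i = j") auto
  qed simp
  have inj: "inj_on f {..u}"
    by (rule linorder_inj_onI) (metis mono atMost_iff less_irrefl, auto)
  define S where "S = insert 0 (f ` {..u})"
  have bound: "f j \<le> c - 2" if "j \<le> u" for j using mono[of j u] fu that by (cases "j = u") auto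
  have pos: "0 < f j" for j by (simp add: f_def)
  have "card S = u + 2" unfolding S_def
  proof -
    have "0 \<notin> f ` {..u}" using pos by (metis imageE less_irrefl)
    then show "card (insert 0 (f ` {..u})) = u + 2" using inj by (simp add: card_image)
  qed
  moreover have "S \<subseteq> {..c - 2}" using bound by (auto simp: S_def)
  moreover have "0 \<in> S" "1 \<in> S" "c - 2 \<in> S"
    unfolding S_def using f0 fu by (simp, metis atMost_iff image_eqI insertCI zero_le, metis atMost_iff image_eqI insertCI order_refl)
  moreover have "\<exists>t\<in>S. s < t \<and> t \<le> s + k" if "s \<in> S" "s < c - 2" for s
  proof (cases "s = 0")
    case True
    then show ?thesis using \<open>1 \<in> S\<close> k by (intro bexI[of _ 1]) auto
  next
    case False
    then have "s \<in> f ` {..u}" using that(1) by (simp add: S_def)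
    then obtain j where j: "s = f j" "j \<le> u" by auto
    then have "j < u" using that(2) fu by (cases "j = u") auto
    then show ?thesis using step[of j] j by (intro bexI[of _ "f (Suc j)"]) (auto simp: S_def)
  qed
  ultimately show ?thesis using that by blast
qed

text \<open>The ladder has \<open>c - 2\<close> rail edges and \<open>u + 2\<close> rungs. The two
  outer rungs complete the Hamiltonian cycle, so \<open>u\<close> rungs remain as chords.\<close>

lemma strip_exists:
  fixes c u k h :: nat
  assumes "4 \<le> c" "1 \<le> u" "u + 3 \<le> c" "c \<le> u * k + 3" "k \<le> 2 * h"
  shows "\<exists>(V, E)\<in>graph_class 3 c (c + u). hyperbolicity V E \<le> 1 + h / 2"
proof -
  obtain S where S: "S \<subseteq> {..c - 2 :: nat}" "0 \<in> S" "1 \<in> S" "c - 2 \<in> S" "card S = u + 2"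
    "\<And>s. s \<in> S \<Longrightarrow> s < c - 2 \<Longrightarrow> \<exists>t\<in>S. s < t \<and> t \<le> s + k"
    by (rule rung_set_exists[OF assms(2-4)]) blast
  have "1 \<le> h" using assms by (cases h) auto
  note cS = S(5)
  interpret strip c h S
  proof unfold_locales
    show "\<exists>t\<in>S. s < t \<and> t \<le> s + 2 * h" if "s \<in> S" "s < c - 2" for s
      using S(6)[OF that] assms(5) by (meson add_left_mono order_trans)
  qed (use assms S \<open>1 \<le> h\<close> in auto)
  have "hyperbolicity SV SE \<le> 1 + h / 2" using hyperbolicity_le bottleneck_strip by simp
  moreover have "(SV, SE) \<in> graph_class 3 c (c + u)"
  proof -
    have "c - 2 + card S = c + u" using cS assms(1) by simp
    then show ?thesis using in_graph_class by metis
  qed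
  ultimately show ?thesis by blast
qed

section \<open>Fans and complete graphs with pendant edges\<close>

definition pairs :: "nat \<Rightarrow> nat set set" where
  "pairs c = {e. e \<subseteq> {..<c} \<and> card e = 2}"

lemma finite_pairs: "finite (pairs c)"
  by (rule finite_subset[of _ "Pow {..<c}"]) (auto simp: pairs_def)

lemma card_pairs: "card (pairs c) = c choose 2"
  using n_subsets[of "{..<c}" 2] by (simp add: pairs_def)

lemma pairsI: "a \<noteq> b \<Longrightarrow> a < c \<Longrightarrow> b < c \<Longrightarrow> {a, b} \<in> pairs c"
  by (simp add: pairs_def)

lemma connected_starI:
  assumes "r \<in> V" "\<And>v. v \<in> V \<Longrightarrow> v \<noteq> r \<Longrightarrow> {r, v} \<in> E" shows "connected_graph V E"
  unfolding connected_graph_def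
proof (intro conjI ballI)
  let ?R = "{(a, b). {a, b} \<in> E}"
  fix u v assume "u \<in> V" "v \<in> V"
  then have "u = r \<or> {r, u} \<in> E" "v = r \<or> {r, v} \<in> E" using assms(2) by blast+
  then have "u = r \<or> (u, r) \<in> ?R" "v = r \<or> (r, v) \<in> ?R" by (auto simp: insert_commute)
  then have "(u, r) \<in> ?R\<^sup>*" "(r, v) \<in> ?R\<^sup>*" by (metis r_into_rtrancl rtrancl.rtrancl_refl)+
  then show "(u, v) \<in> ?R\<^sup>*" by (rule rtrancl_trans)
qed (use assms in auto)

lemma hamiltonian_fan:
  assumes "4 \<le> c" "\<And>i. 1 \<le> i \<Longrightarrow> i < c \<Longrightarrow> {0, i} \<in> E" "\<And>i. 1 \<le> i \<Longrightarrow> i + 1 < c \<Longrightarrow> {i, i + 1} \<in> E"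
  shows "is_cycle E [0..<c]"
proof -
  have "is_cycle E (map (\<lambda>i. i) [0..<c])"
  proof (rule is_cycle_mapI)
    show "{i, Suc i} \<in> E" if "Suc i < c" for i using assms(2)[of 1] assms(3)[of i] that assms(1) by (cases "i = 0") auto
    show "{c - 1, 0} \<in> E" using assms(2)[of "c - 1"] assms(1) by (simp add: insert_commute)
  qed (use assms in auto)
  then show ?thesis by simp
qed

text \<open>A fan on \<open>c\<close> vertices has \<open>2 * c - 3\<close> edges, a dominating
  vertex, a triangle and a Hamiltonian cycle, and all of this survives adding edges up to the
  complete graph.\<close>

lemma fan_exists:
  assumes "4 \<le> c" "2 * c - 3 \<le> m" "m \<le> c choose 2"
  shows "\<exists>(V, E)\<in>graph_class 3 c m. hyperbolicity V E \<le> 3 / 2"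
proof -
  define F where "F = (\<lambda>i. {0, i}) ` {1..<c} \<union> (\<lambda>i. {i, i + 1}) ` {1..<c - 1}"
  have FP: "F \<subseteq> pairs c" using assms(1) by (auto simp: F_def pairs_def)
  have "card F \<le> card {1..<c} + card {1..<c - 1}"
    unfolding F_def by (rule order_trans[OF card_Un_le]) (intro add_mono card_image_le, auto)
  then have "card F \<le> m" using assms by simp
  then obtain E where E: "F \<subseteq> E" "E \<subseteq> pairs c" "card E = m"
    using exists_subset_between[of F m "pairs c"] FP finite_pairs assms(3) card_pairs by metis
  define V where "V = {..<c}"
  have star: "{0, i} \<in> E" if "1 \<le> i" "i < c" for i using that E(1) by (auto simp: F_def)
  have path: "{i, i + 1} \<in> E" if "1 \<le> i" "i + 1 < c" for i using that E(1) by (auto simp: F_def)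
  have dom: "0 \<in> V" "\<And>v. v \<in> V \<Longrightarrow> v \<noteq> 0 \<Longrightarrow> {0, v} \<in> E" using star assms by (auto simp: V_def)
  have sg: "simple_graph V E" using E(2) by (auto simp: simple_graph_def V_def pairs_def)
  have cg: "connected_graph V E" using connected_starI dom by metis
  interpret fgraph V E by unfold_locales (use sg cg star[of 1] assms in auto)
  have cyc: "is_cycle E [0..<c]" using hamiltonian_fan assms(1) star path by blast
  have "circumference E = c"
    by (rule circumferenceI[OF cyc]) (use is_cycle_length in \<open>auto simp: V_def\<close>)
  moreover have "girth E = 3" using girth_3I[of 0 1 2] star[of 1] star[of 2] path[of 1] assms by (simp add: numeral_2_eq_2)
  ultimately have "(V, E) \<in> graph_class 3 c m" using sg cg E by (simp add: graph_class_def)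
  moreover have "hyperbolicity V E \<le> 3 / 2"
    by (rule hyperbolicity_le[OF bottleneck_dominating[OF dom]]) simp_all
  ultimately show ?thesis by blast
qed

text \<open>Surplus edges become pendant edges at vertex 0. They do not affect the circumference,
  since a cycle through a pendant vertex would have vertex 0 as both of its neighbours.\<close>

lemma pendants_exist:
  assumes "4 \<le> c" "c choose 2 \<le> m"
  shows "\<exists>(V, E)\<in>graph_class 3 c m. hyperbolicity V E \<le> 1"
proof -
  define j where "j = m - (c choose 2)"
  define Q where "Q = (\<lambda>v. {0, v}) ` {c..<c + j}"
  define V where "V = {..<c + j}"
  define E where "E = pairs c \<union> Q"
  have disj: "pairs c \<inter> Q = {}" by (auto simp: pairs_def Q_def)
  have "inj_on (\<lambda>v::nat. {0, v}) {c..<c + j}" by (auto simp: inj_on_def doubleton_eq_iff)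
  then have "card Q = j" by (simp add: Q_def card_image)
  then have cE: "card E = m"
    using disj finite_pairs card_pairs assms by (simp add: E_def card_Un_disjoint Q_def j_def)
  have dom: "0 \<in> V" "\<And>v. v \<in> V \<Longrightarrow> v \<noteq> 0 \<Longrightarrow> {0, v} \<in> E"
  proof -
    show "0 \<in> V" using assms(1) by (simp add: V_def)
    show "{0, v} \<in> E" if "v \<in> V" "v \<noteq> 0" for v
    proof (cases "v < c")
      case True
      then show ?thesis using pairsI[of 0 v c] that assms(1) by (simp add: E_def)
    next
      case False
      then have "v \<in> {c..<c + j}" using that by (simp add: V_def)
      then show ?thesis by (simp add: E_def Q_def)
    qed
  qed
  have sg: "simple_graph V E" using assms(1) by (auto simp: simple_graph_def V_def E_def Q_def pairs_def)
  have cg: "connected_graph V E" using connected_starI dom by metis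
  have inE: "{a, b} \<in> E" if "a \<noteq> b" "a < c" "b < c" for a b using pairsI that by (simp add: E_def)
  interpret fgraph V E by unfold_locales (use sg cg inE[of 0 1] assms in auto)
  have cyc: "is_cycle E [0..<c]" using hamiltonian_fan[OF assms(1)] inE by simp
  have pend: "w = 0" if "{v, w} \<in> E" "c \<le> v" for v w
    using that assms(1) by (auto simp: E_def Q_def pairs_def doubleton_eq_iff)
  have "length cs \<le> c" if cs: "is_cycle E cs" for cs
  proof -
    have n: "3 \<le> length cs" using cs by (simp add: is_cycle_def)
    have "v < c" if v: "v \<in> set cs" for v
    proof (rule ccontr)
      assume "\<not> v < c"
      then have vc: "c \<le> v" by simp
      obtain i where i: "i < length cs" "v = cs ! i" using v by (auto simp: in_set_conv_nth)
      let ?n = "length cs"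
      have "{v, cs ! (Suc i mod ?n)} \<in> E" using is_cycle_nth[OF cs, of i] i by simp
      then have 1: "cs ! (Suc i mod ?n) = 0" using pend vc by blast
      have "Suc (i + ?n - 1) = i + ?n" using n by simp
      then have "Suc (i + ?n - 1) mod ?n = i" using i by simp
      then have "{v, cs ! ((i + ?n - 1) mod ?n)} \<in> E" using is_cycle_nth[OF cs, of "i + ?n - 1"] i by (simp add: insert_commute)
      then have "cs ! ((i + ?n - 1) mod ?n) = 0" using pend vc by blast
      then have "(i + ?n - 1) mod ?n = Suc i mod ?n" using is_cycle_nth_inj[OF cs] 1 by metis
      moreover have "Suc i \<le> i + ?n - 1" using n by simp
      \<comment> \<open>The positions after and before \<open>i\<close> differ by
        \<open>n - 2\<close> modulo \<open>n\<close>, so they coincide for no cycle of length at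
        least 3.\<close>
      ultimately have "?n dvd (i + ?n - 1) - Suc i" using mod_eq_dvd_iff_nat by metis
      then have "?n dvd ?n - 2" by (simp add: numeral_2_eq_2)
      then show False using n by (auto dest: dvd_imp_le)
    qed
    then have "set cs \<subseteq> {..<c}" by blast
    then have "card (set cs) \<le> c" using card_mono[of "{..<c}"] by fastforce
    then show ?thesis using cs by (simp add: is_cycle_def distinct_card)
  qed
  then have "circumference E = c" using circumferenceI[OF cyc] by simp
  moreover have "girth E = 3" using girth_3I[of 0 1 2] inE assms by simp
  ultimately have "(V, E) \<in> graph_class 3 c m" using sg cg cE by (simp add: graph_class_def)
  moreover have "bottleneck 1"
  proof (rule bottleneck_pendants[of "{..<c}" 0])
    show "e \<subseteq> {..<c} \<or> (\<exists>v. v \<notin> {..<c} \<and> e = {0, v})" if "e \<in> E" for e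
      using that by (auto simp: E_def Q_def pairs_def)
  qed (use assms inE in \<open>auto simp: V_def\<close>)
  then have "hyperbolicity V E \<le> 1" by (rule hyperbolicity_le) simp
  ultimately show ?thesis by blast
qed

section \<open>Assembling the bounds\<close>

lemma graph_class_ge_1:
  assumes "(V, E) \<in> graph_class 3 c m" "4 \<le> c" "0 < m" shows "1 \<le> hyperbolicity V E"
proof -
  interpret fgraph V E using graph_class_fgraph assms by blast
  have "circumference E = c" using assms by (simp add: graph_class_def)
  then obtain cs where "is_cycle E cs" "length cs = c" using circumferenceD[of c] assms by auto
  then show ?thesis using hyperbolicity_ge_1 assms by blast
qed

lemma alpha_bounds:
  assumes "4 \<le> c" "0 < m" "\<exists>(V, E)\<in>graph_class 3 c m. hyperbolicity V E \<le> r"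
  shows "1 \<le> alpha 3 c m" "alpha 3 c m \<le> r"
proof -
  have ne: "graph_class 3 c m \<noteq> {}" using assms(3) by auto
  show "1 \<le> alpha 3 c m" using alpha_attained(1)[OF assms(2) ne] graph_class_ge_1 assms(1,2) by fastforce
  obtain V E where "(V, E) \<in> graph_class 3 c m" "hyperbolicity V E \<le> r" using assms(3) by auto
  then show "alpha 3 c m \<le> r" using alpha_attained(2)[OF assms(2) ne] by fastforce
qed

theorem theorem5p3:
  fixes c m :: nat
  assumes "e_admissible 3 c m" and "3 \<le> c" and "c \<le> m"
  shows "(c = 3 \<longrightarrow> alpha 3 3 m = 3 / 4 \<and> beta 3 3 m = 3 / 4)
    \<and> (4 \<le> c \<and> m = c + 1 \<longrightarrow>
         alpha 3 c (c + 1) = real c / 4 \<and> beta 3 c (c + 1) = real c / 4)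
    \<and> (\<forall>u::nat. 4 \<le> c \<and> m = c + u \<and> 2 \<le> u \<and> int u < \<lfloor>(real c - 2) / 2\<rfloor> \<longrightarrow>
         1 \<le> alpha 3 c (c + u) \<and>
         alpha 3 c (c + u) \<le> 5 / 4 + 1 / 4 * real_of_int \<lceil>(real c - 2) / real u\<rceil>)
    \<and> (4 \<le> c \<and> int c + \<lfloor>(real c - 2) / 2\<rfloor> \<le> int m \<and> m < c choose 2 \<longrightarrow>
         1 \<le> alpha 3 c m \<and> alpha 3 c m \<le> 3 / 2)
    \<and> (4 \<le> c \<and> c choose 2 \<le> m \<longrightarrow> alpha 3 c m = 1)"
proof (intro conjI impI allI)
  have m0: "0 < m" using assms by simp
  have ne: "graph_class 3 c m \<noteq> {}" using assms(1) by (simp add: e_admissible_def)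
  have fg: "fgraph V E" if "(V, E) \<in> graph_class 3 c m" for V E using graph_class_fgraph that m0 by blast
  {
    assume c: "c = 3"
    have hyp: "hyperbolicity V E = 3 / 4" if VE: "(V, E) \<in> graph_class 3 3 m" for V E
      using fgraph.hyperbolicity_circumference_3[OF fg] VE c by (auto simp: graph_class_def)
    show "alpha 3 3 m = 3 / 4" "beta 3 3 m = 3 / 4" using alpha_beta_const[OF _ hyp] ne c by auto
  next
    assume c: "4 \<le> c \<and> m = c + 1"
    have hyp: "hyperbolicity V E = real c / 4" if VE: "(V, E) \<in> graph_class 3 c (c + 1)" for V E
      using fgraph.hyperbolicity_one_chord[OF fg, of V E c] VE c by (auto simp: graph_class_def)
    show "alpha 3 c (c + 1) = real c / 4" "beta 3 c (c + 1) = real c / 4"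
      using alpha_beta_const[OF _ hyp] ne c by auto
  next
    fix u :: nat
    assume u: "4 \<le> c \<and> m = c + u \<and> 2 \<le> u \<and> int u < \<lfloor>(real c - 2) / 2\<rfloor>"
    define k where "k = nat \<lceil>(real c - 2) / real u\<rceil>"
    \<comment> \<open>Half of \<open>k\<close> rounded up: the gaps \<open>k\<close> have to be at
      most \<open>2 * h\<close>, and \<open>2 * h \<le> k + 1\<close> turns the ladder bound
      \<open>1 + h / 2\<close> into \<open>5 / 4 + k / 4\<close>.\<close>
    define h where "h = (k + 1) div 2"
    have k: "real_of_int \<lceil>(real c - 2) / real u\<rceil> = real k" using u by (simp add: k_def)
    have "(real c - 2) / real u \<le> real k" using k le_of_int_ceiling by metis
    then have "real c - 2 \<le> real k * real u" using u by (simp add: pos_divide_le_eq)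
    then have "real c \<le> real (u * k + 2)" by (simp add: mult.commute)
    then have ck: "c \<le> u * k + 3" by linarith
    have "int u + 1 \<le> \<lfloor>(real c - 2) / 2\<rfloor>" using u by linarith
    then have "of_int (int u + 1) \<le> (real c - 2) / 2" by (simp only: le_floor_iff)
    then have "real (2 * u + 4) \<le> real c" by simp
    then have uc: "u + 3 \<le> c" by linarith
    have ex: "\<exists>(V, E)\<in>graph_class 3 c (c + u). hyperbolicity V E \<le> 1 + h / 2"
      by (rule strip_exists[OF _ _ uc ck]) (use u in \<open>auto simp: h_def\<close>)
    have "2 * h \<le> k + 1" by (simp add: h_def)
    then have "2 * real h \<le> real k + 1" by linarith
    then have "1 + h / 2 \<le> 5 / 4 + 1 / 4 * real k" by simp
    then show "1 \<le> alpha 3 c (c + u)"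
      "alpha 3 c (c + u) \<le> 5 / 4 + 1 / 4 * real_of_int \<lceil>(real c - 2) / real u\<rceil>"
      using alpha_bounds[OF _ _ ex] u unfolding k by fastforce+
  next
    assume c: "4 \<le> c \<and> int c + \<lfloor>(real c - 2) / 2\<rfloor> \<le> int m \<and> m < c choose 2"
    have "\<lfloor>(real c - 2) / 2\<rfloor> = int ((c - 2) div 2)"
      using c floor_divide_of_nat_eq[of "c - 2" 2, where 'a = real] by (simp add: of_nat_diff)
    then have cm: "c + (c - 2) div 2 \<le> m" using c by linarith
    \<comment> \<open>Up to \<open>2 * c - 3\<close> edges there is a ladder with gaps at most 2,
      that is, with \<open>h = 1\<close>. Beyond this number the ladder has no room for further
      rungs, and the fan takes over.\<close>
    have "\<exists>(V, E)\<in>graph_class 3 c m. hyperbolicity V E \<le> 3 / 2"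
    proof (cases "m \<le> 2 * c - 3")
      case True
      have "\<exists>(V, E)\<in>graph_class 3 c (c + (m - c)). hyperbolicity V E \<le> 1 + real 1 / 2"
        by (rule strip_exists[of c "m - c" 2 1]) (use True c cm in linarith)+
      then show ?thesis using cm by simp
    next
      case False
      then show ?thesis using fan_exists[of c m] c by simp
    qed
    then show "1 \<le> alpha 3 c m" "alpha 3 c m \<le> 3 / 2" using alpha_bounds[of c m "3 / 2"] c m0 by blast+
  next
    assume c: "4 \<le> c \<and> c choose 2 \<le> m"
    then show "alpha 3 c m = 1" using alpha_bounds[OF _ m0 pendants_exist, of c] by force
  }
qed

end
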